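(* Consider the charged-particle equation $\ddot x=\dot x\times B(x)+E(x)$ in $\mathbb{R}^3$ with $B(x)=\frac1\varepsilon B_0+B_1(x)$, $|B_0|=1$, $0<\varepsilon\ll1$, and $E(x)=-\nabla\phi(x)$, with initial data $x(0),\dot x(0)$ bounded independently of $\varepsilon$. Let $(x^n,v^n)$ be the numerical solution of the standard (unfiltered) variational integrator (defined in the context) with step size $h$ satisfying $0<\varepsilon\le h^2\ll1$ and with modified starting velocity $v^0=v^0_\parallel+v^0_\perp$, $$v^0_\parallel=P_0\dot x(0),\qquad v^0_\perp=\varepsilon\bigl(v^0_\parallel\times B_1(x^0)+E(x^0)\bigr)\times B_0 .$$ Assume that $x^n$ stays in a compact set $K$ for $0\le nh\le c\,\varepsilon^{-1}$ (with $K$ and $c$ independent of $\varepsilon$ and $h$). Then the total energy $H(x,v)=\frac12|v|^2+\phi(x)$ remains $O(h^2)$-close to the initial energy over times $c\min(\varepsilon^{-1},h^{-6})$: $$|H(x^n,v^n)-H(x^0,v^0)|\le Ch^2,\qquad 0\le nh\le c\min(\varepsilon^{-1},h^{-6}).$$ Moreover, the magnetic moment $I(x,v)=\frac1{2\varepsilon}\frac{|v\times B(x)|^2}{|B(x)|^3}$ remains $O(\varepsilon^2)$ small over times $c\,\varepsilon^{-1}$: $$|I(x^n,v^n)|\le C\varepsilon^2,\qquad 0\le nh\le c\,\varepsilon^{-1}.$$ The constants $C$ are independent of $\varepsilon$, $h$ and $n$ with $0\le nh\le c/\varepsilon$, but depend on bounds of derivatives of $B_1$ and $E$ on the compact set $K$,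 and on $c$.
   Context: Setting: $B_0\in\mathbb{R}^3$ is a fixed unit vector and $P_0=B_0B_0^\top$; $B_1,E:\mathbb{R}^3\to\mathbb{R}^3$ are smooth with derivatives bounded independently of $\varepsilon$ on bounded subsets of $\mathbb{R}^3$. $B_1=\nabla\times A_1$ with a known vector potential $A_1$ (smooth, with the same kind of bounds), so $B=\nabla\times A$ with $A(x)=-\frac1{2\varepsilon}x\times B_0+A_1(x)$. The starting position $x^0$ is $x(0)$ or its guiding-centre approximation $x(0)+\varepsilon\dot x(0)\times B_0$. The condition $h^2\ll1$ means that $h$ is at most a sufficiently small constant independent of $\varepsilon$. Standard variational integrator: with $A'(x)=(\partial_jA_i(x))_{i,j=1}^3$ and $E^n=E(x^n)$, $$\frac{x^{n+1}-2x^n+x^{n-1}}{h^2}=A'(x^n)^\top\frac{x^{n+1}-x^{n-1}}{2h}-\frac{A(x^{n+1})-A(x^{n-1})}{2h}+E^n,\qquad v^n=\frac{x^{n+1}-x^{n-1}}{2h};$$ it is started from $x^0,v^0$ by determining $x^1,x^{-1}$ from these two relations for $n=0$.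
   Formalization: The implicit scheme can have spurious far-away solutions that break the claim at the last step; the numerical solution is therefore taken to satisfy |x^{n+1}-x^n| ≤ ρ with ρ any constant independent of ε and h; the constants may also depend on ρ and on bounds of A_1 on bounded sets. *)

theory Defs
  imports "HOL-Analysis.Analysis"
begin

unbundle cross3_syntax

type_synonym vfield = "real^3 \<Rightarrow> real^3"

text \<open>Iterated partial derivatives; the head of the list is the outermost derivative.\<close>

fun iter_partial :: "3 list \<Rightarrow> vfield \<Rightarrow> vfield" where
  "iter_partial [] f = f"
| "iter_partial (j # js) f = (\<lambda>x. frechet_derivative (iter_partial js f) (at x) (axis j 1))"

text \<open>Requiring every iterated partial derivative to be (Frechet) differentiable everywhere
  is the same as being of class \<open>C\<^sup>\<infinity>\<close>.\<close>

definition smooth_field :: "vfield \<Rightarrow> bool" where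
  "smooth_field f \<longleftrightarrow> (\<forall>js x. iter_partial js f differentiable (at x))"

text \<open>\<open>M k R\<close> bounds all derivatives of order \<open>k\<close> (order 0 being the field itself) on the ball of
  radius \<open>R\<close>. Derivative bounds that are uniform on bounded sets for a family of fields are
  expressed by one function \<open>M\<close> serving all members of the family.\<close>

definition derivs_bounded_by :: "(nat \<Rightarrow> real \<Rightarrow> real) \<Rightarrow> vfield \<Rightarrow> bool" where
  "derivs_bounded_by M f \<longleftrightarrow>
     (\<forall>js R. \<forall>x \<in> cball 0 R. norm (iter_partial js f x) \<le> M (length js) R)"

text \<open>The entry of the library's \<open>jacobian A (at x)\<close> in row \<open>i\<close> and column \<open>j\<close> is the
  \<open>j\<close>-th partial derivative of the \<open>i\<close>-th component of \<open>A\<close>.\<close>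

definition curl :: "vfield \<Rightarrow> vfield" where
  "curl A x = (let J = jacobian A (at x) in
     vector [J $ 3 $ 2 - J $ 2 $ 3, J $ 1 $ 3 - J $ 3 $ 1, J $ 2 $ 1 - J $ 1 $ 2])"

definition magnetic_field :: "real \<Rightarrow> real^3 \<Rightarrow> vfield \<Rightarrow> vfield" where
  "magnetic_field \<epsilon> B0 B1 x = (1 / \<epsilon>) *\<^sub>R B0 + B1 x"

definition vector_potential :: "real \<Rightarrow> real^3 \<Rightarrow> vfield \<Rightarrow> vfield" where
  "vector_potential \<epsilon> B0 A1 x = - (1 / (2 * \<epsilon>)) *\<^sub>R (x \<times> B0) + A1 x"

definition parallel_projection :: "real^3 \<Rightarrow> real^3^3" where
  "parallel_projection B0 = (columnvector B0 :: real^1^3) ** (rowvector B0 :: real^3^1)"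

definition modified_start_velocity ::
    "real \<Rightarrow> real^3 \<Rightarrow> vfield \<Rightarrow> vfield \<Rightarrow> real^3 \<Rightarrow> real^3 \<Rightarrow> real^3" where
  "modified_start_velocity \<epsilon> B0 B1 E x0 xdot =
     (let vpar = parallel_projection B0 *v xdot;
          vperp = \<epsilon> *\<^sub>R ((vpar \<times> B1 x0 + E x0) \<times> B0)
      in vpar + vperp)"

text \<open>One step of the standard variational integrator, relating three consecutive positions.\<close>

definition variational_step ::
    "real \<Rightarrow> vfield \<Rightarrow> vfield \<Rightarrow> real^3 \<Rightarrow> real^3 \<Rightarrow> real^3 \<Rightarrow> bool" where
  "variational_step h A E xprev x xnext \<longleftrightarrow>
     (1 / h\<^sup>2) *\<^sub>R (xnext - 2 *\<^sub>R x + xprev) =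
       transpose (jacobian A (at x)) *v ((1 / (2 * h)) *\<^sub>R (xnext - xprev))
       - (1 / (2 * h)) *\<^sub>R (A xnext - A xprev) + E x"

text \<open>Numerical solution \<open>(x n, v n)\<close> for \<open>0 \<le> n h \<le> T\<close>. The last velocity uses the position one
  step beyond \<open>T\<close>, and the relations for \<open>n = 0\<close> together with prescribed \<open>x 0\<close> and \<open>v 0\<close>
  determine \<open>x 1\<close> and \<open>x (-1)\<close>. The equation for \<open>x (n + 1)\<close> is implicit; besides the solution
  near \<open>x n\<close> it may, for nonlinear \<open>A\<close>, have spurious solutions whose distance from \<open>x n\<close> tends to
  infinity as \<open>h\<close> tends to 0. The radius \<open>\<rho>\<close>, an arbitrary positive number that must not depend on
  \<open>\<epsilon>\<close> and \<open>h\<close>, excludes these. It matters only for the position beyond \<open>T\<close> if the others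
  are known to stay in a fixed bounded set.\<close>

definition numerical_solution ::
    "real \<Rightarrow> real \<Rightarrow> vfield \<Rightarrow> vfield \<Rightarrow> real \<Rightarrow> (int \<Rightarrow> real^3) \<Rightarrow> (int \<Rightarrow> real^3) \<Rightarrow> bool" where
  "numerical_solution \<rho> h A E T x v \<longleftrightarrow>
     (\<forall>n\<ge>0. of_int n * h \<le> T \<longrightarrow>
        variational_step h A E (x (n - 1)) (x n) (x (n + 1)) \<and>
        v n = (1 / (2 * h)) *\<^sub>R (x (n + 1) - x (n - 1)) \<and>
        dist (x (n + 1)) (x n) \<le> \<rho>)"

definition total_energy :: "(real^3 \<Rightarrow> real) \<Rightarrow> real^3 \<Rightarrow> real^3 \<Rightarrow> real" where
  "total_energy \<phi> x v = (norm v)\<^sup>2 / 2 + \<phi> x"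

definition magnetic_moment :: "real \<Rightarrow> vfield \<Rightarrow> real^3 \<Rightarrow> real^3 \<Rightarrow> real" where
  "magnetic_moment \<epsilon> B x v = (1 / (2 * \<epsilon>)) * ((norm (v \<times> B x))\<^sup>2 / (norm (B x)) ^ 3)"

end

theory Submission
  imports Defs
begin

text \<open>
  Everything is estimated on the grid. Let \<open>u\<close> be the one-step difference quotients of the positions and \<open>v\<close>
  the averages of two consecutive \<open>u\<close>. The acceleration parallel to \<open>B\<^sub>0\<close> is bounded and the
  positions stay bounded, so the parallel velocity is bounded without any recourse to the energy.
  The perpendicular part of \<open>u\<close> is rotated in each step by an angle close to \<open>\<pi>\<close>. Summing by parts twice
  against this rotation leaves a forcing of size \<open>O(\<epsilon> h\<^sup>2)\<close> per step, so that this part stays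
  \<open>O(h)\<close> for \<open>c/(\<epsilon> h)\<close> steps. In \<open>v\<close> consecutive values nearly cancel, which leaves a perpendicular
  velocity of size \<open>O(\<epsilon>)\<close> and gives the bound on the magnetic moment.

  For the energy, positions along even (or odd) step numbers have \<open>k\<close>-th differences of size \<open>O(h^k)\<close>.
  Pairing the scheme with an eighth order central difference quotient that uses even
  offsets only, the kinetic, magnetic and potential contributions telescope, the last two up to
  \<open>O(h^9)\<close> per step, and the telescoping quantity differs from the energy by \<open>O(h\<^sup>2)\<close>.
\<close>

section \<open>Derivative bounds, Taylor expansion and finite differences\<close>

text \<open>Every estimate on a run presupposes a provisional bound \<open>U\<close> for the
  one-step velocities, and its constant depends on \<open>U\<close>. The circle closes because, for
  small \<open>h\<close>, the bounds that \<open>U\<close> must exceed do not grow with it: the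
  parallel velocity is limited by the start, the radius \<open>R\<close> and the electric field, and
  the perpendicular velocity is \<open>O(h)\<close>, hence at most 1 however large its constant. The
  condition \<open>eps \<le> h ^ 2\<close> acts through \<open>eps / h \<le> h\<close>. It makes
  averaged perpendicular velocities smaller than the gyration by a factor \<open>h\<close>, and it
  supplies the power of \<open>h\<close> that perpendicular positions would otherwise miss in the
  bounds on their differences. The gyration feeds back into the force, so the perpendicular bound is
  of Gronwall type: relative growth \<open>eps * h\<close> per step over
  \<open>c / (eps * h)\<close> steps costs only a factor independent of \<open>eps\<close> and
  \<open>h\<close>. The order eight is dictated by the time scale: a defect \<open>h ^ 9\<close> in
  each of \<open>n\<close> steps with \<open>n * h \<le> c / h ^ 6\<close> adds up to
  \<open>c * h ^ 2\<close>.\<close>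

text \<open>The derivatives of \<open>F\<close> up to order \<open>k\<close> exist everywhere, and the \<open>j\<close>-th one is bounded by
  \<open>C h^j\<close> on \<open>I\<close>. The factor \<open>h^j\<close> is natural because \<open>F\<close> will be parametrised by step numbers.\<close>

fun dbound :: "nat \<Rightarrow> real set \<Rightarrow> real \<Rightarrow> real \<Rightarrow> (real \<Rightarrow> 'a::real_normed_vector) \<Rightarrow> bool" where
  "dbound 0 I h C F \<longleftrightarrow> (\<forall>s\<in>I. norm (F s) \<le> C)"
| "dbound (Suc k) I h C F \<longleftrightarrow> (\<forall>s\<in>I. norm (F s) \<le> C) \<and>
     (\<exists>F'. (\<forall>s. (F has_vector_derivative F' s) (at s)) \<and> dbound k I h (C * h) F')"

lemma dbound_SucI:
  assumes "\<And>s. s \<in> I \<Longrightarrow> norm (F s) \<le> C" "\<And>s. (F has_vector_derivative F' s) (at s)"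
    and "dbound k I h (C * h) F'"
  shows "dbound (Suc k) I h C F"
  using assms by auto

lemma dbound_norm: "dbound k I h C F \<Longrightarrow> s \<in> I \<Longrightarrow> norm (F s) \<le> C"
  by (cases k) auto

lemma dbound_weaken:
  assumes "dbound k I h C F" "C \<le> C'" "0 \<le> h"
  shows "dbound k I h C' F"
  using assms(1,2)
proof (induction k arbitrary: F C C')
  case 0
  then show ?case by (auto intro: order_trans)
next
  case (Suc k)
  then obtain F' where F': "\<forall>s. (F has_vector_derivative F' s) (at s)" "dbound k I h (C * h) F'"
    and "\<forall>s\<in>I. norm (F s) \<le> C"
    by auto
  moreover have "C * h \<le> C' * h"
    using Suc.prems(2) assms(3) by (rule mult_right_mono)
  ultimately show ?case
    using Suc.IH[OF F'(2)] Suc.prems(2) by (auto intro: order_trans)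
qed

lemma dbound_lower: "dbound (Suc k) I h C F \<Longrightarrow> dbound k I h C F"
proof (induction k arbitrary: F C)
  case (Suc k)
  then obtain F' where "\<forall>s. (F has_vector_derivative F' s) (at s)" "dbound (Suc k) I h (C * h) F'"
    and "\<forall>s\<in>I. norm (F s) \<le> C"
    by (auto simp del: dbound.simps simp: dbound.simps(2)[of "Suc k"])
  with Suc.IH show ?case by auto
qed auto

lemma dbound_const: "norm c \<le> C \<Longrightarrow> 0 \<le> h \<Longrightarrow> dbound k I h C (\<lambda>_. c)"
proof (induction k arbitrary: c C)
  case (Suc k)
  have "0 \<le> C * h" using Suc.prems norm_ge_zero[of c] by (intro mult_nonneg_nonneg) linarith+
  with Suc.prems Suc.IH[of 0 "C * h"] show ?case by (auto intro!: exI[of _ "\<lambda>_. 0"])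
qed auto

lemma dbound_add:
  "dbound k I h C F \<Longrightarrow> dbound k I h D G \<Longrightarrow> dbound k I h (C + D) (\<lambda>s. F s + G s)"
proof (induction k arbitrary: F G C D)
  case 0
  then show ?case by (force intro: norm_triangle_le)
next
  case (Suc k)
  then obtain F' G' where F': "\<forall>s. (F has_vector_derivative F' s) (at s)" "dbound k I h (C * h) F'"
    and G': "\<forall>s. (G has_vector_derivative G' s) (at s)" "dbound k I h (D * h) G'"
    by auto
  have "\<forall>s. ((\<lambda>s. F s + G s) has_vector_derivative F' s + G' s) (at s)"
    using F' G' by (auto intro!: derivative_intros)
  moreover have "dbound k I h ((C + D) * h) (\<lambda>s. F' s + G' s)"
    using Suc.IH[OF F'(2) G'(2)] by (simp add: algebra_simps)
  moreover have "\<forall>s\<in>I. norm (F s + G s) \<le> C + D"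
    using Suc.prems by (auto intro: norm_triangle_mono)
  ultimately show ?case by (auto intro!: dbound_SucI simp del: dbound.simps)
qed

lemma dbound_sum:
  assumes "finite A" "\<And>i. i \<in> A \<Longrightarrow> dbound k I h (C i) (F i)" "0 \<le> h"
  shows "dbound k I h (\<Sum>i\<in>A. C i) (\<lambda>s. \<Sum>i\<in>A. F i s)"
  using assms
proof (induction A rule: finite_induct)
  case empty
  then show ?case by (simp add: dbound_const)
next
  case (insert x A)
  then show ?case by (simp add: dbound_add)
qed

lemma dbound_linear:
  assumes "bounded_linear T" "\<And>x. norm (T x) \<le> K * norm x" "0 \<le> K" "dbound k I h C F"
  shows "dbound k I h (K * C) (\<lambda>s. T (F s))"
  using assms(4)
proof (induction k arbitrary: F C)
  case 0
  then show ?case using assms(3) by (auto intro!: order_trans[OF assms(2)] mult_left_mono)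
next
  case (Suc k)
  then obtain F' where F': "\<forall>s. (F has_vector_derivative F' s) (at s)" "dbound k I h (C * h) F'"
    by auto
  have "\<forall>s. ((\<lambda>s. T (F s)) has_vector_derivative T (F' s)) (at s)"
    using F' assms(1) by (auto intro: bounded_linear.has_vector_derivative)
  moreover have "dbound k I h (K * C * h) (\<lambda>s. T (F' s))"
    using Suc.IH[OF F'(2)] by (simp add: algebra_simps)
  moreover have "\<forall>s\<in>I. norm (T (F s)) \<le> K * C"
    using Suc.prems assms(2,3) by (auto intro!: order_trans[OF assms(2)] mult_left_mono)
  ultimately show ?case by (auto intro!: dbound_SucI simp del: dbound.simps)
qed

text \<open>Each differentiation splits a product in two, hence the factor \<open>2 ^ k\<close>;
  boundedness enters only through the norm inequality, which serves inner and scalar products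
  alike.\<close>

lemma dbound_bilinear:
  assumes bl: "bounded_bilinear P" and P: "\<And>x y. norm (P x y) \<le> norm x * norm y" and h: "0 \<le> h"
  assumes "dbound k I h C F" "dbound k I h D G" "0 \<le> C" "0 \<le> D"
  shows "dbound k I h (2 ^ k * C * D) (\<lambda>s. P (F s) (G s))"
  using assms(4-)
proof (induction k arbitrary: F G C D)
  case 0
  then show ?case
    using P by (auto intro!: order_trans[OF P] mult_mono)
next
  case (Suc k)
  then obtain F' G' where F': "\<forall>s. (F has_vector_derivative F' s) (at s)" "dbound k I h (C * h) F'"
    and G': "\<forall>s. (G has_vector_derivative G' s) (at s)" "dbound k I h (D * h) G'"
    by auto
  have low: "dbound k I h C F" "dbound k I h D G"
    using Suc.prems(1,2) by (simp_all only: dbound_lower)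
  have "\<forall>s. ((\<lambda>s. P (F s) (G s)) has_vector_derivative P (F s) (G' s) + P (F' s) (G s)) (at s)"
    using F' G' bl by (auto intro: bounded_bilinear.has_vector_derivative)
  moreover have "dbound k I h (2 ^ k * C * (D * h) + 2 ^ k * (C * h) * D)
      (\<lambda>s. P (F s) (G' s) + P (F' s) (G s))"
    using Suc.IH[OF low(1) G'(2)] Suc.IH[OF F'(2) low(2)] Suc.prems(3,4) h
    by (intro dbound_add) auto
  then have "dbound k I h (2 ^ Suc k * C * D * h) (\<lambda>s. P (F s) (G' s) + P (F' s) (G s))"
    by (simp add: algebra_simps)
  moreover have "norm (P (F s) (G s)) \<le> 2 ^ Suc k * C * D" if "s \<in> I" for s
  proof -
    have "norm (P (F s) (G s)) \<le> C * D"
      using Suc.prems that by (auto intro!: order_trans[OF P] mult_mono)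
    also have "\<dots> \<le> 2 ^ Suc k * (C * D)"
      using Suc.prems mult_right_mono[of 1 "2 ^ Suc k" "C * D"] one_le_power[of "2::real" "Suc k"] by simp
    finally show ?thesis by (simp add: algebra_simps)
  qed
  ultimately show ?case by (auto intro!: dbound_SucI simp del: dbound.simps)
qed

lemma dbound_inner:
  assumes "0 \<le> h" "dbound k I h C F" "dbound k I h D G" "0 \<le> C" "0 \<le> D"
  shows "dbound k I h (2 ^ k * C * D) (\<lambda>s. F s \<bullet> G s)"
  using assms by (intro dbound_bilinear bounded_bilinear_inner) (auto simp: Cauchy_Schwarz_ineq2)

lemma dbound_scaleR:
  assumes "0 \<le> h" "dbound k I h C F" "dbound k I h D G" "0 \<le> C" "0 \<le> D"
  shows "dbound k I h (2 ^ k * C * D) (\<lambda>s. F s *\<^sub>R G s)"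
  using assms by (intro dbound_bilinear bounded_bilinear_scaleR) auto

lemma dbound_inner_right:
  assumes "dbound k I h C F"
  shows "dbound k I h (norm w * C) (\<lambda>s. F s \<bullet> w)"
  using assms
  by (intro dbound_linear[OF bounded_linear_inner_left])
     (auto simp: mult.commute Cauchy_Schwarz_ineq2)

lemma dbound_cmult:
  "dbound k I h C F \<Longrightarrow> dbound k I h (\<bar>c\<bar> * C) (\<lambda>s. c *\<^sub>R F s)"
  by (intro dbound_linear[OF bounded_linear_scaleR_right]) auto

lemma dbound_minus:
  "dbound k I h C F \<Longrightarrow> dbound k I h C (\<lambda>s. - F s)"
  using dbound_cmult[of k I h C F "-1"] by simp

lemma dbound_scaleR_const:
  fixes F :: "real \<Rightarrow> real"
  shows "dbound k I h C F \<Longrightarrow> dbound k I h (norm a * C) (\<lambda>s. F s *\<^sub>R a)"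
  by (intro dbound_linear[OF bounded_linear_scaleR_left]) auto

text \<open>The linear factors of the Newton basis. Scaled by \<open>h\<close>, they fit the pattern
  of \<open>dbound\<close>: the slope is \<open>h\<close>, which is at most \<open>c * h\<close>
  since \<open>1 \<le> c\<close>.\<close>

lemma dbound_affine:
  assumes "\<And>s. s \<in> I \<Longrightarrow> \<bar>s - r\<bar> \<le> c" "1 \<le> c" "0 \<le> h" "h \<le> 1"
  shows "dbound k I h c (\<lambda>s. h * (s - r))"
proof -
  have bd: "norm (h * (s - r)) \<le> c" if "s \<in> I" for s
    using mult_mono[of h 1 "\<bar>s - r\<bar>" c] assms that by (auto simp: abs_mult)
  show ?thesis
  proof (cases k)
    case 0
    then show ?thesis using bd by auto
  next
    case (Suc m)
    have "dbound m I h (c * h) (\<lambda>_. h)"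
      using assms mult_right_mono[of 1 c h] by (intro dbound_const) auto
    with bd show ?thesis unfolding Suc
      by (intro dbound_SucI[where F' = "\<lambda>_. h"]) (auto intro!: derivative_eq_intros)
  qed
qed

lemma dbound_prod:
  fixes F :: "nat \<Rightarrow> real \<Rightarrow> real"
  assumes "\<And>i. dbound k I h C (F i)" "0 \<le> h" "0 \<le> C"
  shows "dbound k I h ((2 ^ k * C) ^ j) (\<lambda>s. \<Prod>i<j. F i s)"
proof (induction j)
  case 0
  then show ?case using assms by (simp add: dbound_const)
next
  case (Suc j)
  have "dbound k I h (2 ^ k * C * (2 ^ k * C) ^ j) (\<lambda>s. F j s *\<^sub>R (\<Prod>i<j. F i s))"
    using Suc assms by (intro dbound_scaleR) auto
  then show ?case by (simp add: mult.commute)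
qed

text \<open>Unrolls the nested existential quantifiers into one sequence of derivatives, the form in
  which Taylor's theorem takes them.\<close>

lemma dbound_family:
  assumes "dbound k I h C F"
  obtains D where "D 0 = F"
    "\<And>m s. m < k \<Longrightarrow> (D m has_vector_derivative D (Suc m) s) (at s)"
    "\<And>m s. m \<le> k \<Longrightarrow> s \<in> I \<Longrightarrow> norm (D m s) \<le> C * h ^ m"
  using assms
proof (induction k arbitrary: F C thesis)
  case 0
  then show ?case by (auto intro: "0.prems"(1)[of "\<lambda>_. F"])
next
  case (Suc k)
  then obtain F' where F': "\<forall>s. (F has_vector_derivative F' s) (at s)" "dbound k I h (C * h) F'"
    by auto
  from Suc.IH[OF _ F'(2)] obtain D where D: "D 0 = F'"
    "\<And>m s. m < k \<Longrightarrow> (D m has_vector_derivative D (Suc m) s) (at s)"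
    "\<And>m s. m \<le> k \<Longrightarrow> s \<in> I \<Longrightarrow> norm (D m s) \<le> C * h * h ^ m" by blast
  define D' where "D' = case_nat F D"
  show ?case
  proof (rule Suc.prems(1))
    show "D' 0 = F" by (simp add: D'_def)
    show "(D' m has_vector_derivative D' (Suc m) s) (at s)" if "m < Suc k" for m s
      using that D F'(1) by (cases m) (auto simp: D'_def)
    show "norm (D' m s) \<le> C * h ^ m" if "m \<le> Suc k" "s \<in> I" for m s
      using that D Suc.prems(2) by (cases m) (auto simp: D'_def algebra_simps)
  qed
qed

section \<open>Taylor remainders and the accuracy of the difference quotient\<close>

lemma taylor_remainder:
  fixes D :: "nat \<Rightarrow> real \<Rightarrow> real"
  assumes "0 < k" "\<And>m s. m < k \<Longrightarrow> (D m has_vector_derivative D (Suc m) s) (at s)"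
    and "\<And>s. s \<in> {a..b} \<Longrightarrow> \<bar>D k s\<bar> \<le> B" "c \<in> {a..b}" "c + t \<in> {a..b}"
  shows "\<bar>D 0 (c + t) - (\<Sum>m<k. D m c / fact m * t ^ m)\<bar> \<le> B * \<bar>t\<bar> ^ k / fact k"
proof (cases "t = 0")
  case True
  have "(\<Sum>m<k. D m c / fact m * 0 ^ m) = (\<Sum>m\<in>{0}. D m c / fact m * 0 ^ m)"
    using assms(1) by (intro sum.mono_neutral_right) auto
  with True assms(1) show ?thesis by (simp add: zero_power)
next
  case False
  have "\<exists>s. (if c + t < c then c + t < s \<and> s < c else c < s \<and> s < c + t) \<and>
      D 0 (c + t) = (\<Sum>m<k. (D m c / fact m) * (c + t - c) ^ m) + (D k s / fact k) * (c + t - c) ^ k"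
    using assms False
    by (intro Taylor[of k D "D 0" a b])
       (auto simp: has_real_derivative_iff_has_vector_derivative)
  then obtain s where s': "if c + t < c then c + t < s \<and> s < c else c < s \<and> s < c + t"
    "D 0 (c + t) = (\<Sum>m<k. D m c / fact m * t ^ m) + D k s / fact k * t ^ k"
    by auto
  then have s: "s \<in> {a..b}" "D 0 (c + t) = (\<Sum>m<k. D m c / fact m * t ^ m) + D k s / fact k * t ^ k"
    using assms(4,5) by (auto split: if_splits)
  have "\<bar>D k s / fact k * t ^ k\<bar> = \<bar>D k s\<bar> * \<bar>t\<bar> ^ k / fact k"
    by (simp add: abs_mult power_abs)
  also have "\<dots> \<le> B * \<bar>t\<bar> ^ k / fact k"
    using assms(3)[OF s(1)] by (intro divide_right_mono mult_right_mono) auto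
  finally show ?thesis using s(2) by simp
qed

text \<open>The weights of the eighth order central difference quotient with nodes \<open>-4, \<dots>, 4\<close>; \<open>f k\<close> is
  the difference of the values at the nodes \<open>k\<close> and \<open>-k\<close>.\<close>

definition stencil :: "(nat \<Rightarrow> 'a) \<Rightarrow> 'a::real_vector" where
  "stencil f = (4/5) *\<^sub>R f 1 - (1/5) *\<^sub>R f 2 + (4/105) *\<^sub>R f 3 - (1/280) *\<^sub>R f 4"

text \<open>Differences of opposite nodes contain only odd Taylor terms; the weights keep order 1
  with coefficient 1 and annihilate the orders 3, 5 and 7. What is left are the ninth-order
  remainders, whose weighted sum is below \<open>C * h ^ 9\<close> even with factors up to
  \<open>4 ^ 9\<close>.\<close>

lemma stencil_error:
  fixes F :: "real \<Rightarrow> real"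
  assumes "\<And>s. (F has_vector_derivative F' s) (at s)" "dbound 8 {c - 4..c + 4} h (C * h) F'"
  shows "\<bar>stencil (\<lambda>k. F (c + real k) - F (c - real k)) - F' c\<bar> \<le> C * h ^ 9"
proof -
  obtain D where D: "D 0 = F'"
    "\<And>m s. m < 8 \<Longrightarrow> (D m has_vector_derivative D (Suc m) s) (at s)"
    "\<And>m s. m \<le> 8 \<Longrightarrow> s \<in> {c - 4..c + 4} \<Longrightarrow> norm (D m s) \<le> C * h * h ^ m"
    using dbound_family[OF assms(2)] by blast
  define D' where "D' = case_nat F D"
  have D': "(D' m has_vector_derivative D' (Suc m) s) (at s)" if "m < 9" for m s
    using that D assms(1) by (cases m) (auto simp: D'_def)
  have bd: "\<bar>D' 9 s\<bar> \<le> C * h ^ 9" if "s \<in> {c - 4..c + 4}" for s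
    using D(3)[of 8 s] that by (simp add: D'_def eval_nat_numeral mult.assoc)
  have tay: "\<bar>F (c + t) - (\<Sum>m<9. D' m c / fact m * t ^ m)\<bar> \<le> C * h ^ 9 * \<bar>t\<bar> ^ 9 / fact 9"
    if "\<bar>t\<bar> \<le> 4" for t
    using taylor_remainder[of 9 D' "c - 4" "c + 4" "C * h ^ 9" c t] D' bd that
    by (auto simp: D'_def abs_le_iff)
  have "0 \<le> C * h ^ 9" using bd[of c] by auto
  moreover have "D' (Suc 0) c = F' c" "D' 0 = F" by (simp_all add: D'_def D)
  ultimately show ?thesis
    using tay[of 1, unfolded abs_le_iff] tay[of "-1", unfolded abs_le_iff]
      tay[of 2, unfolded abs_le_iff] tay[of "-2", unfolded abs_le_iff]
      tay[of 3, unfolded abs_le_iff] tay[of "-3", unfolded abs_le_iff]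
      tay[of 4, unfolded abs_le_iff] tay[of "-4", unfolded abs_le_iff]
    unfolding stencil_def abs_le_iff
    by (simp add: lessThan_nat_numeral lessThan_Suc fact_numeral divide_simps)
qed

text \<open>The parameter \<open>h\<close> will be the length of a displacement and \<open>F\<close>
  a component of a field along the segment. In the last bound the second-order Taylor terms cancel
  by symmetry, which gains one power.\<close>

lemma taylor_line:
  fixes F :: "real \<Rightarrow> real"
  assumes F: "dbound 3 {-1..1} h C F" and F': "\<And>s. (F has_vector_derivative F' s) (at s)"
  shows "\<bar>F 1 - F 0\<bar> \<le> C * h" "\<bar>F 1 - F 0 - F' 0\<bar> \<le> C * h\<^sup>2"
    "\<bar>F 1 - F (-1) - 2 * F' 0\<bar> \<le> C * h ^ 3"
proof -
  obtain D where D: "D 0 = F"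
    "\<And>m s. m < 3 \<Longrightarrow> (D m has_vector_derivative D (Suc m) s) (at s)"
    "\<And>m s. m \<le> 3 \<Longrightarrow> s \<in> {-1..1} \<Longrightarrow> norm (D m s) \<le> C * h ^ m"
    using dbound_family[OF F] by blast
  have eq: "D (Suc 0) 0 = F' 0"
    using D(2)[of 0 0] F'[of 0] D(1) by (auto intro: vector_derivative_unique_at)
  have tay: "\<bar>F t - (\<Sum>m<k. D m 0 / fact m * t ^ m)\<bar> \<le> C * h ^ k * \<bar>t\<bar> ^ k / fact k"
    if "t \<in> {-1..1}" "k \<in> {1..3}" for k t
    using taylor_remainder[of k D "-1" 1 "C * h ^ k" 0 t] D that by auto
  have nn: "0 \<le> C * h ^ k" if "k \<le> 3" for k
    using order_trans[OF norm_ge_zero D(3)[of k 0]] that by auto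
  show "\<bar>F 1 - F 0\<bar> \<le> C * h" using tay[of 1 1] D(1) by simp
  have "\<bar>F 1 - F 0 - F' 0\<bar> \<le> C * h\<^sup>2 / 2"
    using tay[of 1 2] D(1) eq
    by (simp add: lessThan_nat_numeral lessThan_Suc algebra_simps)
  then show "\<bar>F 1 - F 0 - F' 0\<bar> \<le> C * h\<^sup>2" using nn[of 2] by simp
  show "\<bar>F 1 - F (-1) - 2 * F' 0\<bar> \<le> C * h ^ 3"
    using tay[of 1 3, unfolded abs_le_iff] tay[of "-1" 3, unfolded abs_le_iff] D(1) eq nn[of 3]
    unfolding abs_le_iff
    by (simp add: lessThan_nat_numeral lessThan_Suc fact_numeral divide_simps)
qed

lemma norm_unit_increment:
  assumes "\<And>s. (F has_vector_derivative F' s) (at s)" "\<And>s. s \<in> {0..b + 1} \<Longrightarrow> norm (F' s) \<le> B"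
    and "s \<in> {0..b}"
  shows "norm (F (s + 1) - F s) \<le> B"
proof -
  have "norm (F (s + 1) - F s) \<le> B * norm (s + 1 - s)"
  proof (rule differentiable_bound[where S = "{0..b+1}" and f' = "\<lambda>s t. t *\<^sub>R F' s"])
    fix r assume r: "r \<in> {0..b+1}"
    show "(F has_derivative (\<lambda>t. t *\<^sub>R F' r)) (at r within {0..b + 1})"
      using assms(1)[of r] by (auto simp: has_vector_derivative_def intro: has_derivative_at_withinI)
    have B: "norm (F' r) \<le> B" by (rule assms(2)[OF r])
    then show "onorm (\<lambda>t. t *\<^sub>R F' r) \<le> B"
      using mult_left_mono[OF B, of "\<bar>_\<bar>"] order_trans[OF norm_ge_zero B]
      by (intro onorm_bound) (auto simp: mult.commute[of B])
  qed (use assms(3) in auto)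
  then show ?thesis by simp
qed

text \<open>A unit difference of \<open>F\<close> is bounded by \<open>F'\<close>, by the mean value
  inequality, and its derivative is the unit difference of \<open>F'\<close>. So one derivative buys
  one factor \<open>h\<close>, at the price of one unit of the interval.\<close>

lemma dbound_difference:
  assumes "dbound (Suc k) {0..b + 1} h C F"
  shows "dbound k {0..b} h (C * h) (\<lambda>s. F (s + 1) - F s)"
  using assms
proof (induction k arbitrary: F C)
  case 0
  then obtain F' where "\<forall>s. (F has_vector_derivative F' s) (at s)"
    "\<forall>s\<in>{0..b+1}. norm (F' s) \<le> C * h" by auto
  then show ?case using norm_unit_increment[of F F' b "C * h"] by auto
next
  case (Suc k)
  then obtain F' where F': "\<And>s. (F has_vector_derivative F' s) (at s)"
    "dbound (Suc k) {0..b+1} h (C * h) F'" by (subst (asm) dbound.simps(2)) blast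
  show ?case
  proof (rule dbound_SucI)
    show "norm (F (s + 1) - F s) \<le> C * h" if "s \<in> {0..b}" for s
      using F'(1) dbound_norm[OF F'(2)] that by (rule norm_unit_increment)
    show "((\<lambda>s. F (s + 1) - F s) has_vector_derivative F' (s + 1) - F' s) (at s)" for s
    proof -
      have "((F \<circ> (\<lambda>s. s + 1)) has_vector_derivative 1 *\<^sub>R F' (s + 1)) (at s)"
        using F'(1)[of "s + 1"]
        by (intro vector_diff_chain_at) (auto intro!: derivative_eq_intros)
      then show ?thesis using F'(1)[of s] by (auto simp: o_def intro!: has_vector_derivative_diff)
    qed
    show "dbound k {0..b} h (C * h * h) (\<lambda>s. F' (s + 1) - F' s)"
      by (rule Suc.IH[OF F'(2)])
  qed
qed

section \<open>Differences of stride two and Newton interpolation\<close>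

definition fwd :: "(real \<Rightarrow> 'a) \<Rightarrow> real \<Rightarrow> 'a::ab_group_add" where
  "fwd F s = F (s + 1) - F s"

definition diff2 :: "(int \<Rightarrow> 'a) \<Rightarrow> int \<Rightarrow> 'a::ab_group_add" where
  "diff2 a n = a (n + 2) - a n"

lemma norm_fwd_power_le:
  assumes "dbound (k + m) {0..real k + b} h C F" 
  shows "dbound m {0..b} h (C * h ^ k) ((fwd ^^ k) F)"
  using assms
proof (induction k arbitrary: F C)
  case (Suc k)
  have "dbound (k + m) {0..real k + b} h (C * h) (fwd F)"
    using Suc.prems dbound_difference[of "k + m" "real k + b" h C F]
    by (simp add: fwd_def[abs_def] algebra_simps)
  from Suc.IH[OF this] show ?case by (simp add: funpow_swap1 algebra_simps)
qed simp

lemma diff2_power_samples: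
  assumes "\<And>i. i \<le> k \<Longrightarrow> a (n + 2 * int i) = F (real i)" "i + j \<le> k"
  shows "(diff2 ^^ j) a (n + 2 * int i) = (fwd ^^ j) F (real i)"
  using assms(2)
proof (induction j arbitrary: i)
  case 0
  then show ?case using assms(1) by simp
next
  case (Suc j)
  have "(diff2 ^^ Suc j) a (n + 2 * int i) =
      (diff2 ^^ j) a (n + 2 * int (Suc i)) - (diff2 ^^ j) a (n + 2 * int i)"
    by (simp add: diff2_def algebra_simps)
  also have "\<dots> = (fwd ^^ j) F (real (Suc i)) - (fwd ^^ j) F (real i)"
    using Suc.IH[of "Suc i"] Suc.IH[of i] Suc.prems by simp
  also have "\<dots> = (fwd ^^ Suc j) F (real i)" by (simp add: fwd_def[of "(fwd ^^ j) F"] add.commute)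
  finally show ?case .
qed

lemma norm_diff2_power_samples:
  assumes "\<And>i. i \<le> k \<Longrightarrow> a (n + 2 * int i) = F (real i)" "dbound k {0..real k} h C F"
  shows "norm ((diff2 ^^ k) a n) \<le> C * h ^ k"
proof -
  have "dbound 0 {0..0} h (C * h ^ k) ((fwd ^^ k) F)"
    using assms(2) by (intro norm_fwd_power_le) simp
  then show ?thesis using diff2_power_samples[of k a n F 0 k] assms(1) by simp
qed

text \<open>Newton's forward formula along every second index: a shift by two is the identity plus
  \<open>diff2\<close>, and Pascal's rule adds the coefficients.\<close>

lemma newton_forward:
  fixes a :: "int \<Rightarrow> 'a::real_vector"
  shows "a (n + 2 * int i) = (\<Sum>j\<le>i. real (i choose j) *\<^sub>R (diff2 ^^ j) a n)"
proof (induction i arbitrary: n)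
  case (Suc i)
  have shift: "(diff2 ^^ j) a (n + 2) = (diff2 ^^ j) a n + (diff2 ^^ Suc j) a n" for j
    by (simp add: diff2_def)
  have "a (n + 2 * int (Suc i)) = a ((n + 2) + 2 * int i)" by (simp add: algebra_simps)
  also have "\<dots> = (\<Sum>j\<le>i. real (i choose j) *\<^sub>R (diff2 ^^ j) a n)
      + (\<Sum>j\<le>i. real (i choose j) *\<^sub>R (diff2 ^^ Suc j) a n)"
    by (simp only: Suc shift scaleR_right_distrib sum.distrib)
  also have "(\<Sum>j\<le>i. real (i choose j) *\<^sub>R (diff2 ^^ j) a n) =
      (\<Sum>j\<le>Suc i. real (i choose j) *\<^sub>R (diff2 ^^ j) a n)" by simp
  also have "\<dots> = a n + (\<Sum>j\<le>i. real (i choose Suc j) *\<^sub>R (diff2 ^^ Suc j) a n)"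
    by (simp add: sum.atMost_Suc_shift del: sum.atMost_Suc)
  finally have "a (n + 2 * int (Suc i)) =
      a n + (\<Sum>j\<le>i. real (Suc i choose Suc j) *\<^sub>R (diff2 ^^ Suc j) a n)"
    by (simp only: sum.distrib[symmetric] scaleR_left_distrib[symmetric] add.assoc binomial_Suc_Suc of_nat_add
        add.commute[of "real (i choose Suc _)"])
  then show ?case by (simp add: sum.atMost_Suc_shift del: sum.atMost_Suc funpow.simps)
qed simp

text \<open>The interpolation polynomial of \<open>a n, a (n + 2), ..., a (n + 2 * k)\<close>,
  reparametrised to the nodes \<open>0, ..., k\<close>; generalised binomial coefficients make sense
  of it at real arguments.\<close>

definition newton_poly :: "nat \<Rightarrow> (int \<Rightarrow> 'a) \<Rightarrow> int \<Rightarrow> real \<Rightarrow> 'a::real_vector" where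
  "newton_poly k a n s = (\<Sum>j\<le>k. (s gchoose j) *\<^sub>R (diff2 ^^ j) a n)"

lemma newton_poly_node:
  assumes "i \<le> k"
  shows "newton_poly k a n (real i) = a (n + 2 * int i)"
proof -
  have "newton_poly k a n (real i) = (\<Sum>j\<le>k. real (i choose j) *\<^sub>R (diff2 ^^ j) a n)"
    by (simp add: newton_poly_def binomial_gbinomial)
  also have "\<dots> = (\<Sum>j\<le>i. real (i choose j) *\<^sub>R (diff2 ^^ j) a n)"
    using assms by (intro sum.mono_neutral_right) (auto simp: binomial_eq_0)
  finally show ?thesis by (simp add: newton_forward)
qed

definition newton_const :: "nat \<Rightarrow> nat \<Rightarrow> real" where
  "newton_const m k = (\<Sum>j\<le>k. (2 ^ m * (real k + 1)) ^ j)"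

lemma newton_const_nonneg: "0 \<le> newton_const m k"
  by (simp add: newton_const_def sum_nonneg)

text \<open>The factor \<open>h ^ j\<close> in the bound on the \<open>j\<close>-th difference is
  handed to the \<open>j\<close> linear factors of \<open>s gchoose j\<close>, one each; the
  resulting product is controlled by \<open>dbound_prod\<close>.\<close>

lemma dbound_newton_poly:
  assumes "\<And>j. j \<le> k \<Longrightarrow> norm ((diff2 ^^ j) a n) \<le> C * h ^ j" "0 < h" "h \<le> 1"
  shows "dbound m {0..real k} h (newton_const m k * C) (newton_poly k a n)"
proof -
  have C: "0 \<le> C" using order_trans[OF norm_ge_zero assms(1)[of 0]] by simp
  have "dbound m {0..real k} h ((2 ^ m * (real k + 1)) ^ j * C) (\<lambda>s. (s gchoose j) *\<^sub>R (diff2 ^^ j) a n)"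
    if "j \<le> k" for j
  proof (cases "j = 0")
    case True
    then show ?thesis using assms(1)[of 0] assms(2) by (auto intro: dbound_const)
  next
    case False
    have "dbound m {0..real k} h (real k + 1) (\<lambda>s. h * (s - real i))" if "i < j" for i
      using assms(2,3) that \<open>j \<le> k\<close> by (intro dbound_affine) (auto simp: abs_le_iff)
    \<comment> \<open>\<open>dbound_prod\<close> wants a bound for every index, so the factors from
      \<open>j\<close> on are replaced by 0; the product never reaches them.\<close>
    then have "dbound m {0..real k} h (real k + 1) (\<lambda>s. if i < j then h * (s - real i) else 0)" for i
      using assms(2) by (cases "i < j") (auto intro: dbound_const)
    from dbound_prod[where F = "\<lambda>i s. if i < j then h * (s - real i) else 0", OF this, of j] have
      "dbound m {0..real k} h ((2 ^ m * (real k + 1)) ^ j) (\<lambda>s. \<Prod>i<j. if i < j then h * (s - real i) else 0)"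
      using assms(2) by simp
    also have "(\<lambda>s. \<Prod>i<j. if i < j then h * (s - real i) else 0) = (\<lambda>s. h ^ j * (\<Prod>i<j. s - real i))"
      by (simp add: prod.distrib)
    finally have P: "dbound m {0..real k} h ((2 ^ m * (real k + 1)) ^ j) (\<lambda>s. h ^ j * (\<Prod>i<j. s - real i))" .
    define w where "w = (1 / (h ^ j * fact j)) *\<^sub>R (diff2 ^^ j) a n"
    have "norm w \<le> C"
    proof -
      have "norm w \<le> C / fact j"
        using assms(1)[OF that] assms(2) by (simp add: w_def field_simps)
      also have "\<dots> \<le> C / 1" using C by (intro divide_left_mono fact_ge_1) simp_all
      also have "\<dots> = C" by simp
      finally show ?thesis .
    qed
    moreover have "dbound m {0..real k} h (norm w * (2 ^ m * (real k + 1)) ^ j)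
        (\<lambda>s. (h ^ j * (\<Prod>i<j. s - real i)) *\<^sub>R w)"
      by (rule dbound_scaleR_const[OF P])
    moreover have "(h ^ j * (\<Prod>i<j. s - real i)) *\<^sub>R w = (s gchoose j) *\<^sub>R (diff2 ^^ j) a n" for s
      using assms(2) by (simp add: w_def gbinomial_prod_rev atLeast0LessThan)
    moreover have "norm w * (2 ^ m * (real k + 1)) ^ j \<le> (2 ^ m * (real k + 1)) ^ j * C"
      using \<open>norm w \<le> C\<close> by (simp add: mult.commute mult_left_mono)
    ultimately show ?thesis using assms(2) by (simp add: dbound_weaken)
  qed
  then have "dbound m {0..real k} h (\<Sum>j\<le>k. (2 ^ m * (real k + 1)) ^ j * C)
      (\<lambda>s. \<Sum>j\<le>k. (s gchoose j) *\<^sub>R (diff2 ^^ j) a n)"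
    using assms(2) by (intro dbound_sum) auto
  then show ?thesis by (simp add: newton_poly_def[abs_def] newton_const_def sum_distrib_right)
qed

section \<open>Smooth vector fields along curves\<close>

definition field_bound :: "nat \<Rightarrow> real \<Rightarrow> real \<Rightarrow> vfield \<Rightarrow> bool" where
  "field_bound m R L f \<longleftrightarrow> smooth_field f \<and>
     (\<forall>js x. length js \<le> m \<longrightarrow> x \<in> cball 0 R \<longrightarrow> norm (iter_partial js f x) \<le> L)"

abbreviation partial :: "3 \<Rightarrow> vfield \<Rightarrow> vfield" where
  "partial i f \<equiv> iter_partial [i] f"

lemma iter_partial_append: "iter_partial (is @ js) f = iter_partial is (iter_partial js f)"
  by (induction "is") auto

lemma field_bound_partial: "field_bound (Suc m) R L f \<Longrightarrow> field_bound m R L (partial i f)"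
  unfolding field_bound_def smooth_field_def
  by (auto simp del: iter_partial.simps simp: iter_partial_append[symmetric])

lemma field_bound_lower: "field_bound m R L f \<Longrightarrow> m' \<le> m \<Longrightarrow> field_bound m' R L f"
  unfolding field_bound_def by auto

lemma field_bound_norm: "field_bound m R L f \<Longrightarrow> norm x \<le> R \<Longrightarrow> norm (f x) \<le> L"
  unfolding field_bound_def by (force dest: spec[of _ "[]"])

lemma field_bound_derivs:
  assumes "smooth_field f" "derivs_bounded_by M f"
  shows "field_bound m R (\<Sum>l\<le>m. \<bar>M l R\<bar>) f"
proof -
  have "norm (iter_partial js f x) \<le> (\<Sum>l\<le>m. \<bar>M l R\<bar>)" if "length js \<le> m" "x \<in> cball 0 R" for js x
  proof -
    have "norm (iter_partial js f x) \<le> M (length js) R"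
      using assms(2) that(2) by (auto simp: derivs_bounded_by_def)
    also have "\<dots> \<le> \<bar>M (length js) R\<bar>" by simp
    also have "\<dots> \<le> (\<Sum>l\<le>m. \<bar>M l R\<bar>)" using that(1) by (intro member_le_sum) auto
    finally show ?thesis .
  qed
  with assms(1) show ?thesis by (auto simp: field_bound_def)
qed

text \<open>The directional derivative spelled out by partial derivatives: these are again fields
  with bounded iterated partials, so the chain rule can be applied repeatedly.\<close>

definition dir :: "vfield \<Rightarrow> real^3 \<Rightarrow> real^3 \<Rightarrow> real^3" where
  "dir f x w = (\<Sum>i\<in>UNIV. w $ i *\<^sub>R partial i f x)"

lemma smooth_field_differentiable: "smooth_field f \<Longrightarrow> f differentiable (at x)"
  unfolding smooth_field_def by (force dest: spec[of _ "[]"])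

lemma frechet_derivative_dir:
  assumes "smooth_field f"
  shows "frechet_derivative f (at x) w = dir f x w"
proof -
  have lin: "linear (frechet_derivative f (at x))"
    using smooth_field_differentiable[OF assms] by (rule linear_frechet_derivative)
  have "frechet_derivative f (at x) w = frechet_derivative f (at x) (\<Sum>i\<in>UNIV. w $ i *\<^sub>R axis i 1)"
    using basis_expansion[of w] by (simp add: scalar_mult_eq_scaleR)
  also have "\<dots> = dir f x w"
    using lin by (simp add: linear_sum linear_cmul dir_def)
  finally show ?thesis .
qed

lemma has_derivative_dir: "smooth_field f \<Longrightarrow> (f has_derivative dir f x) (at x)"
  using smooth_field_differentiable[of f x] frechet_derivative_dir[of f x]
  by (metis ext frechet_derivative_works)

lemma has_vector_derivative_along:
  assumes "smooth_field f" "(q has_vector_derivative q') (at s)"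
  shows "((\<lambda>s. f (q s)) has_vector_derivative dir f (q s) q') (at s)"
  using has_derivative_compose[OF assms(2)[unfolded has_vector_derivative_def] has_derivative_dir[OF assms(1), of "q s"]]
  by (simp add: has_vector_derivative_def dir_def scaleR_right.sum)

text \<open>Chosen for the recursion produced by the chain rule: the value at \<open>Suc k\<close>
  has to dominate both \<open>L\<close> and
  \<open>3 * 2 ^ k * chain_const k L D * D\<close>.\<close>

definition chain_const :: "nat \<Rightarrow> real \<Rightarrow> real \<Rightarrow> real" where
  "chain_const k L D = L * (1 + 3 * 2 ^ k * D) ^ k"

lemma chain_const_nonneg: "0 \<le> L \<Longrightarrow> 0 \<le> D \<Longrightarrow> 0 \<le> chain_const k L D"
  by (simp add: chain_const_def)

text \<open>By induction over all fields: the derivative of \<open>f (q s)\<close> is a sum over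
  three coordinates of a component of \<open>q'\<close> times a partial derivative of
  \<open>f\<close> along the same curve. Only \<open>q'\<close> has to supply the factor
  \<open>h\<close>.\<close>

lemma dbound_field_along:
  assumes "field_bound k R L f" "\<And>s. (q has_vector_derivative q' s) (at s)"
    "dbound k I h (D * h) q'" "\<And>s. s \<in> I \<Longrightarrow> norm (q s) \<le> R" "0 \<le> D" "0 \<le> h" "0 \<le> L"
  shows "dbound k I h (chain_const k L D) (\<lambda>s. f (q s))"
  using assms(1,3)
proof (induction k arbitrary: f)
  case 0
  then show ?case using assms(4) by (auto simp: chain_const_def intro: field_bound_norm)
next
  case (Suc k)
  have smooth: "smooth_field f" using Suc.prems(1) by (simp add: field_bound_def)
  let ?c = "chain_const k L D"
  have ge: "L \<le> chain_const (Suc k) L D" "3 * 2 ^ k * ?c * D \<le> chain_const (Suc k) L D"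
  proof -
    have p: "(1 + 3 * 2 ^ k * D) ^ k \<le> (1 + 3 * 2 ^ Suc k * D) ^ k"
      using assms(5) by (intro power_mono) auto
    show "L \<le> chain_const (Suc k) L D"
      using assms(5,7) mult_left_mono[of 1 "(1 + 3 * 2 ^ Suc k * D) ^ Suc k" L] one_le_power[of "1 + 3 * 2 ^ Suc k * D" "Suc k"]
      by (simp add: chain_const_def)
    have "3 * 2 ^ k * ?c * D = L * ((3 * 2 ^ k * D) * (1 + 3 * 2 ^ k * D) ^ k)"
      by (simp add: chain_const_def)
    also have "\<dots> \<le> L * ((1 + 3 * 2 ^ Suc k * D) * (1 + 3 * 2 ^ Suc k * D) ^ k)"
      using assms(5,7) p by (intro mult_left_mono mult_mono) auto
    finally show "3 * 2 ^ k * ?c * D \<le> chain_const (Suc k) L D" by (simp add: chain_const_def)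
  qed
  have q': "dbound k I h (D * h) q'" using Suc.prems(2) by (rule dbound_lower)
  have comp: "dbound k I h (2 ^ k * (1 * (D * h)) * ?c) (\<lambda>s. (q' s $ i) *\<^sub>R partial i f (q s))" for i
    using assms(5,6,7) q' Suc.IH[OF field_bound_partial[OF Suc.prems(1), of i] q'] chain_const_nonneg[OF assms(7,5), of k]
    by (intro dbound_scaleR dbound_linear[OF bounded_linear_vec_nth]) (auto simp: component_le_norm_cart)
  have "dbound k I h (\<Sum>i\<in>(UNIV::3 set). 2 ^ k * (1 * (D * h)) * ?c) (\<lambda>s. dir f (q s) (q' s))"
    unfolding dir_def using comp assms(6) by (intro dbound_sum) auto
  moreover have "(\<Sum>i\<in>(UNIV::3 set). 2 ^ k * (1 * (D * h)) * ?c) \<le> chain_const (Suc k) L D * h"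
    using mult_right_mono[OF ge(2) assms(6)] by (simp add: algebra_simps)
  ultimately have "dbound k I h (chain_const (Suc k) L D * h) (\<lambda>s. dir f (q s) (q' s))"
    using assms(6) by (rule dbound_weaken)
  then show ?case
    using field_bound_norm[OF Suc.prems(1) assms(4)] ge(1) has_vector_derivative_along[OF smooth assms(2)]
    by (intro dbound_SucI[where F' = "\<lambda>s. dir f (q s) (q' s)"]) (auto intro: order_trans)
qed

lemma norm_dir_le:
  assumes "field_bound 1 R L f" "norm x \<le> R"
  shows "norm (dir f x w) \<le> 3 * L * norm w"
proof -
  have "norm (w $ i *\<^sub>R partial i f x) \<le> norm w * L" for i
    using field_bound_norm[OF field_bound_partial[of 0 R L f i] assms(2)] assms(1) component_le_norm_cart[of w i]
    by (auto intro!: mult_mono)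
  then have "norm (dir f x w) \<le> (\<Sum>i\<in>(UNIV::3 set). norm w * L)"
    unfolding dir_def by (intro sum_norm_le) auto
  then show ?thesis by (simp add: algebra_simps)
qed

text \<open>Testing with vectors of the unit ball reduces vector estimates to real functions, for
  which Taylor's formula with Lagrange remainder holds.\<close>

lemma norm_le_inner_unit:
  assumes "\<And>w. norm w \<le> 1 \<Longrightarrow> \<bar>(y::'a::real_inner) \<bullet> w\<bar> \<le> B"
  shows "norm y \<le> B"
proof (cases "y = 0")
  case True then show ?thesis using assms[of 0] by simp
next
  case False
  then have "y \<bullet> (y /\<^sub>R norm y) = norm y"
    by (simp add: power2_norm_eq_inner[symmetric] power2_eq_square)
  then show ?thesis using assms[of "y /\<^sub>R norm y"] False by simp
qed

text \<open>By convexity of the ball the whole segment from \<open>m - d\<close> to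
  \<open>m + d\<close> lies in it, so \<open>taylor_line\<close> applies to every component of
  \<open>f\<close> along the segment, with \<open>norm d\<close> as scale.\<close>

lemma
  assumes f: "field_bound 3 R L f" and ball: "norm (m - d) \<le> R" "norm (m + d) \<le> R"
  shows field_lipschitz_aux: "norm (f (m + d) - f m) \<le> chain_const 3 L 1 * norm d"
    and field_taylor_aux: "norm (f (m + d) - f m - dir f m d) \<le> chain_const 3 L 1 * (norm d)\<^sup>2"
    and field_central: "norm (f (m + d) - f (m - d) - 2 *\<^sub>R dir f m d) \<le> chain_const 3 L 1 * norm d ^ 3"
proof -
  let ?q = "\<lambda>s. m + s *\<^sub>R d"
  have L: "0 \<le> L" using order_trans[OF norm_ge_zero field_bound_norm[OF f ball(1)]] .
  have in_ball: "norm (?q s) \<le> R" if "s \<in> {-1..1}" for s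
  proof -
    have "?q s = ((1 - s) / 2) *\<^sub>R (m - d) + ((1 + s) / 2) *\<^sub>R (m + d)"
      by (simp add: vec_eq_iff field_simps)
    also have "\<dots> \<in> cball 0 R"
      by (rule convexD[OF convex_cball]) (use ball that in \<open>auto simp: field_simps\<close>)
    finally show ?thesis by simp
  qed
  have "dbound 3 {-1..1} (norm d) (chain_const 3 L 1) (\<lambda>s. f (?q s))"
    using L f in_ball
    by (intro dbound_field_along[where q' = "\<lambda>_. d" and R = R] dbound_const) (auto intro!: derivative_eq_intros)
  moreover have der: "((\<lambda>s. f (?q s)) has_vector_derivative dir f (?q s) d) (at s)" for s
    using f by (intro has_vector_derivative_along) (auto simp: field_bound_def intro!: derivative_eq_intros)
  ultimately have "\<bar>f (m + d) \<bullet> w - f m \<bullet> w\<bar> \<le> chain_const 3 L 1 * norm d \<and>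
    \<bar>f (m + d) \<bullet> w - f m \<bullet> w - dir f m d \<bullet> w\<bar> \<le> chain_const 3 L 1 * (norm d)\<^sup>2 \<and>
    \<bar>f (m + d) \<bullet> w - f (m - d) \<bullet> w - 2 * (dir f m d \<bullet> w)\<bar> \<le> chain_const 3 L 1 * norm d ^ 3"
    if "norm w \<le> 1" for w
  proof -
    have "dbound 3 {-1..1} (norm d) (norm w * chain_const 3 L 1) (\<lambda>s. f (?q s) \<bullet> w)"
      by (rule dbound_inner_right) fact
    then have "dbound 3 {-1..1} (norm d) (chain_const 3 L 1) (\<lambda>s. f (?q s) \<bullet> w)"
      by (rule dbound_weaken) (use that L chain_const_nonneg[of L 1 3] in \<open>auto intro: mult_left_le_one_le\<close>)
    from taylor_line[OF this bounded_linear.has_vector_derivative[OF bounded_linear_inner_left der]]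
    show ?thesis by simp
  qed
  then show "norm (f (m + d) - f m) \<le> chain_const 3 L 1 * norm d"
    "norm (f (m + d) - f m - dir f m d) \<le> chain_const 3 L 1 * (norm d)\<^sup>2"
    "norm (f (m + d) - f (m - d) - 2 *\<^sub>R dir f m d) \<le> chain_const 3 L 1 * norm d ^ 3"
    by (auto intro!: norm_le_inner_unit simp: inner_diff_left)
qed

text \<open>The auxiliary estimate is symmetric about \<open>x\<close> and therefore also needs the
  point \<open>x - (y - x)\<close>; it has norm at most \<open>3 * R\<close>, whence the enlarged
  radius.\<close>

lemma field_lipschitz:
  assumes "field_bound 3 (3 * R) L f" "norm x \<le> R" "norm y \<le> R"
  shows "norm (f y - f x) \<le> chain_const 3 L 1 * norm (y - x)"
proof -
  have "norm (x - (y - x)) \<le> 3 * R"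
    using norm_triangle_ineq4[of x "y - x"] norm_triangle_ineq4[of y x] assms(2,3) by linarith
  moreover have "norm (x + (y - x)) \<le> 3 * R" using assms(3) norm_ge_zero[of y] by (simp; linarith)
  ultimately have "norm (x - (y - x)) \<le> 3 * R" "norm (x + (y - x)) \<le> 3 * R" .
  from field_lipschitz_aux[OF assms(1) this] show ?thesis by simp
qed

lemma field_taylor:
  assumes "field_bound 3 (3 * R) L f" "norm x \<le> R" "norm y \<le> R"
  shows "norm (f y - f x - dir f x (y - x)) \<le> chain_const 3 L 1 * (norm (y - x))\<^sup>2"
proof -
  have "norm (x - (y - x)) \<le> 3 * R"
    using norm_triangle_ineq4[of x "y - x"] norm_triangle_ineq4[of y x] assms(2,3) by linarith
  moreover have "norm (x + (y - x)) \<le> 3 * R" using assms(3) norm_ge_zero[of y] by (simp; linarith)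
  ultimately have "norm (x - (y - x)) \<le> 3 * R" "norm (x + (y - x)) \<le> 3 * R" .
  from field_taylor_aux[OF assms(1) this] show ?thesis by simp
qed

lemma dir_add: "dir f x (v + w) = dir f x v + dir f x w"
  by (simp add: dir_def scaleR_left_distrib sum.distrib)

lemma dir_diff: "dir f x (v - w) = dir f x v - dir f x w"
  by (simp add: dir_def scaleR_left_diff_distrib sum_subtractf)

lemma dir_scaleR: "dir f x (c *\<^sub>R w) = c *\<^sub>R dir f x w"
  by (simp add: dir_def scaleR_sum_right)

lemma dir_lipschitz:
  assumes "field_bound 4 (3 * R) L f" "norm x \<le> R" "norm y \<le> R"
  shows "norm (dir f y w - dir f x w) \<le> 3 * chain_const 3 L 1 * norm (y - x) * norm w"
proof -
  have "norm (w $ i *\<^sub>R (partial i f y - partial i f x)) \<le> norm w * (chain_const 3 L 1 * norm (y - x))" for i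
    using field_lipschitz[OF field_bound_partial[of 3 "3 * R" L f i] assms(2,3)] assms(1) component_le_norm_cart[of w i]
    by (auto intro!: mult_mono)
  then have "norm (\<Sum>i\<in>UNIV. w $ i *\<^sub>R (partial i f y - partial i f x))
      \<le> (\<Sum>i\<in>(UNIV::3 set). norm w * (chain_const 3 L 1 * norm (y - x)))"
    by (intro sum_norm_le) auto
  then show ?thesis
    by (simp add: dir_def scaleR_right_diff_distrib sum_subtractf algebra_simps)
qed

text \<open>The adjoint of \<open>dir f x\<close>, that is, multiplication by the transposed
  Jacobian.\<close>

definition tdir :: "vfield \<Rightarrow> real^3 \<Rightarrow> real^3 \<Rightarrow> real^3" where
  "tdir f x w = (\<Sum>i\<in>UNIV. (partial i f x \<bullet> w) *\<^sub>R axis i 1)"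

lemma tdir_component: "tdir f x w $ i = partial i f x \<bullet> w"
  by (simp add: tdir_def axis_def if_distrib cong: if_cong)

lemma tdir_add: "tdir f x (v + w) = tdir f x v + tdir f x w"
  by (simp add: vec_eq_iff tdir_component inner_add_right del: iter_partial.simps)

lemma tdir_scaleR: "tdir f x (c *\<^sub>R w) = c *\<^sub>R tdir f x w"
  by (simp add: vec_eq_iff tdir_component del: iter_partial.simps)

lemma tdir_inner: "tdir f x v \<bullet> w = v \<bullet> dir f x w"
proof -
  have "tdir f x v \<bullet> w = (\<Sum>i\<in>UNIV. (partial i f x \<bullet> v) * w $ i)"
    unfolding inner_vec_def[of "tdir f x v" w] tdir_component by (simp del: iter_partial.simps)
  also have "\<dots> = v \<bullet> dir f x w"
    by (simp add: dir_def inner_sum_right inner_commute mult.commute del: iter_partial.simps)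
  finally show ?thesis .
qed

lemma norm_tdir_le:
  assumes "field_bound 1 R L f" "norm x \<le> R"
  shows "norm (tdir f x w) \<le> 3 * L * norm w"
proof (rule norm_le_inner_unit)
  fix z :: "real^3" assume z: "norm z \<le> 1"
  have L: "0 \<le> L" using order_trans[OF norm_ge_zero field_bound_norm[OF assms]] .
  have "\<bar>tdir f x w \<bullet> z\<bar> \<le> norm w * norm (dir f x z)"
    by (simp add: tdir_inner Cauchy_Schwarz_ineq2)
  also have "\<dots> \<le> norm w * (3 * L * 1)"
    using norm_dir_le[OF assms, of z] mult_left_mono[OF z, of "3 * L"] L
    by (intro mult_left_mono) auto
  finally show "\<bar>tdir f x w \<bullet> z\<bar> \<le> 3 * L * norm w" by (simp add: mult.commute)
qed

lemma norm_cross_le: "norm (x \<times> y) \<le> norm x * norm y"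
proof (rule power2_le_imp_le)
  show "(norm (x \<times> y))\<^sup>2 \<le> (norm x * norm y)\<^sup>2"
    using norm_cross_dot[of x y] zero_le_power2[of "x \<bullet> y"] by linarith
qed simp

section \<open>Runs of the integrator and uniform estimates\<close>

text \<open>The scheme holds for the steps \<open>0, \<dots>, fin\<close>, so the positions \<open>-1, \<dots>, fin + 1\<close> matter. The last index
  is kept as a component because the a priori bounds are obtained by induction on it.\<close>

datatype run = Run (eps: real) (stp: real) (pot: vfield) (ele: vfield) (enp: "real^3 \<Rightarrow> real")
  (pos: "int \<Rightarrow> real^3") (fin: int)

text \<open>Belongs to the middle of the step from \<open>n\<close> to \<open>n + 1\<close>. The
  average \<open>mvel r n\<close> of two neighbours is the velocity that the integrator itself
  reports at \<open>n\<close>.\<close>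

definition vel :: "run \<Rightarrow> int \<Rightarrow> real^3" where
  "vel r n = (1 / stp r) *\<^sub>R (pos r (n + 1) - pos r n)"

definition mvel :: "run \<Rightarrow> int \<Rightarrow> real^3" where
  "mvel r n = (1 / 2) *\<^sub>R (vel r n + vel r (n - 1))"

definition dpot :: "run \<Rightarrow> int \<Rightarrow> real^3" where
  "dpot r n = (1 / (2 * stp r)) *\<^sub>R (pot r (pos r (n + 1)) - pot r (pos r (n - 1)))"

text \<open>The force without the stiff linear part of the vector potential. Transposed derivative
  minus difference quotient is the discrete counterpart of
  \<open>v \<times> curl A1\<close>.\<close>

definition frc :: "run \<Rightarrow> int \<Rightarrow> real^3" where
  "frc r n = tdir (pot r) (pos r n) (mvel r n) - dpot r n + ele r (pos r n)"

lemma pos_vel: "stp r \<noteq> 0 \<Longrightarrow> pos r (n + 1) = pos r n + stp r *\<^sub>R vel r n"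
  by (simp add: vel_def)

lemma pos_mvel: "stp r \<noteq> 0 \<Longrightarrow> pos r (n + 1) - pos r (n - 1) = (2 * stp r) *\<^sub>R mvel r n"
  by (simp add: vel_def mvel_def algebra_simps)

lemma norm_frc_le:
  assumes "field_bound 3 (3 * R) L (pot r)" "field_bound 0 (3 * R) L (ele r)" "0 < stp r"
    and "norm (pos r n) \<le> R" "norm (pos r (n + 1)) \<le> R" "norm (pos r (n - 1)) \<le> R"
  shows "norm (frc r n) \<le> (3 * L + chain_const 3 L 1) * norm (mvel r n) + L"
proof -
  have R: "0 \<le> R" using order_trans[OF norm_ge_zero assms(4)] .
  have 1: "norm (tdir (pot r) (pos r n) (mvel r n)) \<le> 3 * L * norm (mvel r n)"
    using assms R by (intro norm_tdir_le[OF field_bound_lower[OF assms(1)]]) auto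
  have "norm (dpot r n) = (1 / (2 * stp r)) * norm (pot r (pos r (n + 1)) - pot r (pos r (n - 1)))"
    using assms(3) by (simp add: dpot_def)
  also have "\<dots> \<le> (1 / (2 * stp r)) * (chain_const 3 L 1 * norm ((2 * stp r) *\<^sub>R mvel r n))"
    using field_lipschitz[OF assms(1) assms(6,5)] assms(3) by (intro mult_left_mono) (auto simp: pos_mvel)
  also have "\<dots> = chain_const 3 L 1 * norm (mvel r n)"
    using assms(3) by simp
  finally have "norm (dpot r n) \<le> chain_const 3 L 1 * norm (mvel r n)" .
  moreover have "norm (ele r (pos r n)) \<le> L"
    using assms(4) R by (intro field_bound_norm[OF assms(2)]) auto
  ultimately show ?thesis using 1
    unfolding frc_def
    using norm_triangle_ineq[of "tdir (pot r) (pos r n) (mvel r n) - dpot r n" "ele r (pos r n)"]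
      norm_triangle_ineq4[of "tdir (pot r) (pos r n) (mvel r n)" "dpot r n"]
    by (simp add: algebra_simps)
qed

section \<open>Landau estimates uniform in the run and the step number\<close>

definition ubd :: "(run \<Rightarrow> int \<Rightarrow> bool) \<Rightarrow> (run \<Rightarrow> int \<Rightarrow> 'a::real_normed_vector) \<Rightarrow> (run \<Rightarrow> int \<Rightarrow> real) \<Rightarrow> bool" where
  "ubd S f g \<longleftrightarrow> (\<exists>C\<ge>0. \<forall>r n. S r n \<longrightarrow> norm (f r n) \<le> C * g r n)"

lemma ubdI: "0 \<le> C \<Longrightarrow> (\<And>r n. S r n \<Longrightarrow> norm (f r n) \<le> C * g r n) \<Longrightarrow> ubd S f g"
  by (auto simp: ubd_def)

lemma ubdE:
  assumes "ubd S f g" obtains C where "0 \<le> C" "\<And>r n. S r n \<Longrightarrow> norm (f r n) \<le> C * g r n"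
  using assms by (auto simp: ubd_def)

lemma ubd_add: "ubd S f g \<Longrightarrow> ubd S f' g \<Longrightarrow> ubd S (\<lambda>r n. f r n + f' r n) g"
proof (elim ubdE)
  fix C C' assume "0 \<le> C" "0 \<le> C'" "\<And>r n. S r n \<Longrightarrow> norm (f r n) \<le> C * g r n"
    "\<And>r n. S r n \<Longrightarrow> norm (f' r n) \<le> C' * g r n"
  then show ?thesis
    by (intro ubdI[of "C + C'"]) (auto simp: distrib_right intro: norm_triangle_mono)
qed

lemma ubd_minus: "ubd S f g \<Longrightarrow> ubd S (\<lambda>r n. - f r n) g"
  by (simp add: ubd_def)

lemma ubd_diff: "ubd S f g \<Longrightarrow> ubd S f' g \<Longrightarrow> ubd S (\<lambda>r n. f r n - f' r n) g"
  using ubd_add[of S f g "\<lambda>r n. - f' r n"] ubd_minus[of S f' g] by simp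

lemma ubd_dom:
  assumes "ubd S f g" "0 \<le> K" "\<And>r n. S r n \<Longrightarrow> norm (f' r n) \<le> K * norm (f r n)"
  shows "ubd S f' g"
  using assms(1)
proof (elim ubdE)
  fix C assume C: "0 \<le> C" "\<And>r n. S r n \<Longrightarrow> norm (f r n) \<le> C * g r n"
  show ?thesis
  proof (rule ubdI[of "K * C"])
    fix r n assume "S r n"
    then show "norm (f' r n) \<le> K * C * g r n"
      using assms(2) assms(3) mult_left_mono[OF C(2), of r n K] by fastforce
  qed (use C assms(2) in auto)
qed

lemma ubd_cong: "ubd S f g \<Longrightarrow> (\<And>r n. S r n \<Longrightarrow> f' r n = f r n) \<Longrightarrow> ubd S f' g"
  by (rule ubd_dom[of S f g 1]) auto

lemma ubd_mono:
  assumes "ubd S f g" "0 \<le> K" "\<And>r n. S r n \<Longrightarrow> g r n \<le> K * g' r n"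
  shows "ubd S f g'"
  using assms(1)
proof (elim ubdE)
  fix C assume C: "0 \<le> C" "\<And>r n. S r n \<Longrightarrow> norm (f r n) \<le> C * g r n"
  show ?thesis
  proof (rule ubdI[of "C * K"])
    fix r n assume "S r n"
    then show "norm (f r n) \<le> C * K * g' r n"
      using C(2)[of r n] mult_left_mono[OF assms(3), of r n C] C(1) by fastforce
  qed (use C assms(2) in auto)
qed

lemma ubd_le: "ubd S f g \<Longrightarrow> (\<And>r n. S r n \<Longrightarrow> g r n \<le> g' r n) \<Longrightarrow> ubd S f g'"
  by (rule ubd_mono[of S f g 1]) auto

lemma ubd_prod:
  assumes "\<And>x y. norm (P x y) \<le> norm x * norm y" "ubd S f g" "ubd S f' g'"
  shows "ubd S (\<lambda>r n. P (f r n) (f' r n)) (\<lambda>r n. g r n * g' r n)"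
  using assms(2,3)
proof (elim ubdE)
  fix C C' assume C: "0 \<le> C" "0 \<le> C'" "\<And>r n. S r n \<Longrightarrow> norm (f r n) \<le> C * g r n"
    "\<And>r n. S r n \<Longrightarrow> norm (f' r n) \<le> C' * g' r n"
  show ?thesis
  proof (rule ubdI[of "C * C'"])
    fix r n assume S: "S r n"
    have "norm (P (f r n) (f' r n)) \<le> norm (f r n) * norm (f' r n)" by (rule assms)
    also have "\<dots> \<le> (C * g r n) * (C' * g' r n)"
      using C(3,4)[OF S] order_trans[OF norm_ge_zero C(3)[OF S]] by (intro mult_mono) auto
    finally show "norm (P (f r n) (f' r n)) \<le> C * C' * (g r n * g' r n)"
      by (simp add: mult.assoc mult.left_commute)
  qed (use C in auto)
qed

lemma ubd_scaleR: "ubd S f g \<Longrightarrow> ubd S f' g' \<Longrightarrow> ubd S (\<lambda>r n. f r n *\<^sub>R f' r n) (\<lambda>r n. g r n * g' r n)"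
  by (rule ubd_prod) auto

lemma ubd_inner: "ubd S f g \<Longrightarrow> ubd S f' g' \<Longrightarrow> ubd S (\<lambda>r n. f r n \<bullet> f' r n) (\<lambda>r n. g r n * g' r n)"
  by (rule ubd_prod) (auto simp: Cauchy_Schwarz_ineq2)

lemma ubd_inner_const: "ubd S f g \<Longrightarrow> ubd S (\<lambda>r n. f r n \<bullet> w) g"
  by (rule ubd_dom[of S f g "norm w"]) (auto simp: Cauchy_Schwarz_ineq2 mult.commute[of "norm w"])

lemma ubd_cross_const: "ubd S f g \<Longrightarrow> ubd S (\<lambda>r n. f r n \<times> w) g"
  by (rule ubd_dom[of S f g "norm w"]) (auto simp: norm_cross_le mult.commute[of "norm w"])

lemma ubd_const_scaleR: "ubd S f g \<Longrightarrow> ubd S (\<lambda>r n. k *\<^sub>R f r n) g"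
  by (rule ubd_dom[of S f g "\<bar>k\<bar>"]) auto

lemma ubd_scaleR_one: "ubd S f g \<Longrightarrow> ubd S f' (\<lambda>r n. 1) \<Longrightarrow> ubd S (\<lambda>r n. f r n *\<^sub>R f' r n) g"
  using ubd_scaleR[of S f g f' "\<lambda>r n. 1"] by simp

lemma ubd_one_scaleR: "ubd S f (\<lambda>r n. 1) \<Longrightarrow> ubd S f' g \<Longrightarrow> ubd S (\<lambda>r n. f r n *\<^sub>R f' r n) g"
  using ubd_scaleR[of S f "\<lambda>r n. 1" f' g] by simp

lemma ubd_inner_one: "ubd S f g \<Longrightarrow> ubd S f' (\<lambda>r n. 1) \<Longrightarrow> ubd S (\<lambda>r n. f r n \<bullet> f' r n) g"
  using ubd_inner[of S f g f' "\<lambda>r n. 1"] by simp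

lemma ubd_one_inner: "ubd S f (\<lambda>r n. 1) \<Longrightarrow> ubd S f' g \<Longrightarrow> ubd S (\<lambda>r n. f r n \<bullet> f' r n) g"
  using ubd_inner[of S f "\<lambda>r n. 1" f' g] by simp

lemma ubd_zero: "(\<And>r n. S r n \<Longrightarrow> 0 \<le> g r n) \<Longrightarrow> ubd S (\<lambda>r n. 0) g"
  by (rule ubdI[of 0]) auto

lemma ubd_sum:
  assumes "finite A" "\<And>i. i \<in> A \<Longrightarrow> ubd S (f i) g" "\<And>r n. S r n \<Longrightarrow> 0 \<le> g r n"
  shows "ubd S (\<lambda>r n. \<Sum>i\<in>A. f i r n) g"
  using assms
proof (induction A rule: finite_induct)
  case empty
  then show ?case by (simp add: ubd_zero)
next
  case (insert x F)
  then show ?case by (simp add: ubd_add)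
qed

text \<open>The double summation by parts in one component. \<open>w\<close> and \<open>Jw\<close>
  stand for the perpendicular velocity and its product with \<open>b\<close>, \<open>g\<close> and
  \<open>j\<close> for the force crossed with \<open>b\<close> once and twice, \<open>k\<close> for
  \<open>gyr r\<close>; primes and increasing indices go back in time. After the corrections only
  second differences of \<open>g\<close> and \<open>j\<close> remain as forcing.\<close>

lemma oscillation_identity_real:
  fixes w w' :: real
  assumes "w - k * Jw = w' + k * Jw' + 2 * e * k * g0" "k \<noteq> 0"
  shows "(w - e * j0 - e / 2 * ((j0 - j1) + 1 / k * (g0 - g1)))
      - k * (Jw + e * g0 - e / 2 * (1 / k * (j0 - j1) - (g0 - g1)))
    = (w' - e * j1 - e / 2 * ((j1 - j2) + 1 / k * (g1 - g2)))
      + k * (Jw' + e * g1 - e / 2 * (1 / k * (j1 - j2) - (g1 - g2)))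
      + e / 2 * ((k - 1 / k) * (g0 - 2 * g1 + g2) - 2 * (j0 - 2 * j1 + j2))"
proof -
  have w: "w = w' + k * Jw' + 2 * e * k * g0 + k * Jw" using assms(1) by simp
  show ?thesis unfolding w using assms(2) by (simp add: field_simps)
qed

section \<open>Algebra of differences with stride two\<close>

lemma diff2_shift_scale:
  fixes a :: "int \<Rightarrow> 'a::real_vector"
  shows "(diff2 ^^ j) (\<lambda>m. k *\<^sub>R a (m + p)) n = k *\<^sub>R (diff2 ^^ j) a (n + p)"
proof (induction j arbitrary: n)
  case (Suc j)
  then show ?case by (simp add: diff2_def[of "(diff2 ^^ j) _"] scaleR_diff_right ac_simps)
qed simp

lemma diff2_shift: "(diff2 ^^ j) (\<lambda>m. a (m + p)) n = (diff2 ^^ j) a (n + p)" for a :: "int \<Rightarrow> 'a::real_vector"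
  using diff2_shift_scale[of j 1 a p n] by simp

lemma diff2_add: "(diff2 ^^ j) (\<lambda>m. f m + g m) n = (diff2 ^^ j) f n + (diff2 ^^ j) g n"
proof (induction j arbitrary: n)
  case (Suc j)
  then show ?case by (simp add: diff2_def[of "(diff2 ^^ j) _"])
qed simp

lemma diff2_minus: "(diff2 ^^ j) (\<lambda>m. f m - g m) n = (diff2 ^^ j) f n - (diff2 ^^ j) g n"
proof (induction j arbitrary: n)
  case (Suc j)
  then show ?case by (simp add: diff2_def[of "(diff2 ^^ j) _"])
qed simp

lemma diff2_linear:
  assumes "\<And>x y. T (x - y) = T x - T y"
  shows "(diff2 ^^ j) (\<lambda>m. T (a m)) n = T ((diff2 ^^ j) a n)"
proof (induction j arbitrary: n)
  case (Suc j)
  then show ?case by (simp add: diff2_def[of "(diff2 ^^ j) _"] assms)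
qed simp

lemma diff2_cong:
  assumes "\<And>i. i \<le> j \<Longrightarrow> f (n + 2 * int i) = g (n + 2 * int i)"
  shows "(diff2 ^^ j) f n = (diff2 ^^ j) g n"
  using assms
proof (induction j arbitrary: n)
  case (Suc j)
  have "(diff2 ^^ j) f (n + 2) = (diff2 ^^ j) g (n + 2)"
    using Suc.prems[of "Suc _"] by (intro Suc.IH) (simp add: algebra_simps)
  moreover have "(diff2 ^^ j) f n = (diff2 ^^ j) g n"
    using Suc.prems by (intro Suc.IH) simp
  ultimately show ?case by (simp add: diff2_def[of "(diff2 ^^ j) _"])
qed (use assms[of 0] in simp)

lemma diff2_power_Suc: "(diff2 ^^ Suc j) a n = (diff2 ^^ j) (diff2 a) n"
  by (simp only: funpow_Suc_right o_apply)

definition along_const :: "(nat \<Rightarrow> real \<Rightarrow> real) \<Rightarrow> nat \<Rightarrow> nat \<Rightarrow> real \<Rightarrow> real" where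
  "along_const M m k C = chain_const m (\<Sum>l\<le>m. \<bar>M l (newton_const (Suc m) k * C)\<bar>) (newton_const (Suc m) k * C)"

lemma along_const_nonneg: "0 \<le> C \<Longrightarrow> 0 \<le> along_const M m k C"
  unfolding along_const_def by (intro chain_const_nonneg sum_nonneg mult_nonneg_nonneg newton_const_nonneg) auto

lemma newton_poly_derivative:
  assumes "\<And>j. j \<le> k \<Longrightarrow> norm ((diff2 ^^ j) a n) \<le> C * h ^ j" "0 < h" "h \<le> 1"
  obtains q' where "\<And>s. (newton_poly k a n has_vector_derivative q' s) (at s)"
    "dbound m {0..real k} h (newton_const (Suc m) k * C * h) q'"
proof -
  have "dbound (Suc m) {0..real k} h (newton_const (Suc m) k * C) (newton_poly k a n)"
    using assms by (rule dbound_newton_poly)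
  then show thesis using that by auto
qed

text \<open>An interpolant may leave the ball that contains its nodes, so \<open>M\<close> is
  evaluated at the radius given by the interpolant's own bound.\<close>

lemma dbound_field_newton:
  assumes "smooth_field f" "derivs_bounded_by M f"
    and a: "\<And>j. j \<le> k \<Longrightarrow> norm ((diff2 ^^ j) a n) \<le> C * h ^ j" and h: "0 < h" "h \<le> 1"
  shows "dbound m {0..real k} h (along_const M m k C) (\<lambda>s. f (newton_poly k a n s))"
proof -
  have C: "0 \<le> C" using order_trans[OF norm_ge_zero a[of 0]] by simp
  obtain q' where q': "\<And>s. (newton_poly k a n has_vector_derivative q' s) (at s)"
    "dbound m {0..real k} h (newton_const (Suc m) k * C * h) q'"
    using newton_poly_derivative[OF a h, where m = m] by blast
  have "norm (newton_poly k a n s) \<le> newton_const (Suc m) k * C" if "s \<in> {0..real k}" for s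
    using dbound_norm[OF dbound_newton_poly[OF a h, where m = "Suc m"] that] .
  then show ?thesis
    unfolding along_const_def using q' C h newton_const_nonneg
    by (intro dbound_field_along[where f = f and q = "newton_poly k a n" and q' = q' and R = "newton_const (Suc m) k * C"]
          field_bound_derivs assms(1,2)) (auto intro: sum_nonneg)
qed

lemma partial_smooth:
  assumes "smooth_field f" "derivs_bounded_by M f"
  shows "smooth_field (partial i f)" "derivs_bounded_by (\<lambda>l. M (Suc l)) (partial i f)"
proof -
  show "smooth_field (partial i f)"
    using assms(1) unfolding smooth_field_def iter_partial_append[symmetric] by blast
  show "derivs_bounded_by (\<lambda>l. M (Suc l)) (partial i f)"
    unfolding derivs_bounded_by_def iter_partial_append[symmetric]
  proof (intro allI ballI)
    fix js R and x :: "real^3" assume "x \<in> cball 0 R"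
    then show "norm (iter_partial (js @ [i]) f x) \<le> M (Suc (length js)) R"
      using assms(2)[unfolded derivs_bounded_by_def, rule_format, of x R "js @ [i]"] by simp
  qed
qed

text \<open>Differencing a sum over a window leaves its two ends. Read backwards, a difference over
  \<open>j\<close> steps becomes a difference over one step, which is how the parts of the modified
  energy arise.\<close>

lemma sum_telescope_shift:
  fixes f :: "int \<Rightarrow> 'a::ab_group_add"
  shows "(\<Sum>l<j. f (n - int l)) - (\<Sum>l<j. f (n - 1 - int l)) = f n - f (n - int j)"
proof (induction j)
  case (Suc j)
  have "n - 1 - int j = n - int (Suc j)" by simp
  with Suc show ?case by (simp add: algebra_simps)
qed simp

lemma stencil_diff: "stencil (\<lambda>k. f k - g k) = stencil f - stencil g"
  by (simp add: stencil_def algebra_simps)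

lemma stencil_cong: "(\<And>k. k \<in> {1..4} \<Longrightarrow> f k = g k) \<Longrightarrow> stencil f = stencil g"
  by (simp add: stencil_def)

lemma cross_inner_skew: "(x \<times> y) \<bullet> z = - ((z \<times> y) \<bullet> x)" for x y z :: "real^3"
  by (simp add: cross3_simps)

lemma sum_arith: "(\<Sum>l<m. a - real l) = real m * a - real m * (real m - 1) / 2"
  by (induction m) (simp_all add: field_simps)

lemma transpose_mult_inner: "(transpose A *v x) \<bullet> y = x \<bullet> (A *v y)" for A :: "real^3^3"
  by (simp add: transpose_matrix_vector dot_lmul_matrix)

section \<open>The scheme as a recursion for the one-step velocities\<close>

lemma vector_potential_has_derivative:
  assumes "smooth_field A1"
  shows "(vector_potential e B0 A1 has_derivative (\<lambda>w. - (1 / (2 * e)) *\<^sub>R (w \<times> B0) + dir A1 x w)) (at x)"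
proof -
  have "bounded_linear (\<lambda>w. w \<times> B0)"
    by (intro linear_conv_bounded_linear[THEN iffD1] linearI) (simp_all add: cross_add_left cross_mult_left)
  then have "bounded_linear (\<lambda>w. - (1 / (2 * e)) *\<^sub>R (w \<times> B0))"
    by (rule bounded_linear_compose[OF bounded_linear_scaleR_right])
  then have "((\<lambda>w. - (1 / (2 * e)) *\<^sub>R (w \<times> B0)) has_derivative (\<lambda>w. - (1 / (2 * e)) *\<^sub>R (w \<times> B0))) (at x)"
    by (rule bounded_linear_imp_has_derivative)
  from has_derivative_add[OF this has_derivative_dir[OF assms]] show ?thesis
    by (simp add: vector_potential_def[abs_def])
qed

text \<open>The linear part of the potential has a skew Jacobian, so transposition reverses its
  sign. This supplies one half of the stiff Lorentz term; the difference quotient of the potential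
  supplies the other.\<close>

lemma transpose_jacobian_vector_potential:
  assumes "smooth_field A1"
  shows "transpose (jacobian (vector_potential e B0 A1) (at x)) *v w = (1 / (2 * e)) *\<^sub>R (w \<times> B0) + tdir A1 x w"
proof -
  let ?J = "jacobian (vector_potential e B0 A1) (at x)"
  note D = vector_potential_has_derivative[OF assms, of e B0 x]
  then have "(vector_potential e B0 A1 has_derivative (\<lambda>z. ?J *v z)) (at x)"
    by (intro jacobian_works[THEN iffD1] differentiableI)
  from has_derivative_unique[OF this D]
  have J: "?J *v z = - (1 / (2 * e)) *\<^sub>R (z \<times> B0) + dir A1 x z" for z
    by (rule fun_cong)
  have "(transpose ?J *v w) \<bullet> z = ((1 / (2 * e)) *\<^sub>R (w \<times> B0) + tdir A1 x w) \<bullet> z" for z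
    unfolding transpose_mult_inner J
    using cross_inner_skew[of w B0 z]
    by (simp add: inner_add_left inner_add_right inner_diff_right tdir_inner inner_commute[of w "z \<times> B0"])
  then show ?thesis using vector_eq_rdot by blast
qed

lemma variational_step_vel:
  fixes r :: run
  assumes "smooth_field (pot r)" "0 < stp r" "0 < eps r"
    and step: "variational_step (stp r) (vector_potential (eps r) B0 (pot r)) (ele r) (pos r (n - 1)) (pos r n) (pos r (n + 1))"
  shows "vel r n - vel r (n - 1) = (stp r / eps r) *\<^sub>R (mvel r n \<times> B0) + stp r *\<^sub>R frc r n"
proof -
  let ?A = "vector_potential (eps r) B0 (pot r)"
  have v: "(1 / (2 * stp r)) *\<^sub>R (pos r (n + 1) - pos r (n - 1)) = mvel r n"
    using pos_mvel[of r n] assms(2) by simp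
  have "(1 / (2 * stp r)) *\<^sub>R (?A (pos r (n + 1)) - ?A (pos r (n - 1)))
      = - (1 / (2 * eps r)) *\<^sub>R (((1 / (2 * stp r)) *\<^sub>R (pos r (n + 1) - pos r (n - 1))) \<times> B0) + dpot r n"
    by (simp add: vector_potential_def dpot_def cross_mult_left Cross3.left_diff_distrib algebra_simps)
  then have A: "(1 / (2 * stp r)) *\<^sub>R (?A (pos r (n + 1)) - ?A (pos r (n - 1))) = - (1 / (2 * eps r)) *\<^sub>R (mvel r n \<times> B0) + dpot r n"
    by (simp only: v)
  have "(1 / stp r) *\<^sub>R (vel r n - vel r (n - 1)) = (1 / (stp r)\<^sup>2) *\<^sub>R (pos r (n + 1) - 2 *\<^sub>R pos r n + pos r (n - 1))"
    by (simp add: vel_def vec_eq_iff power2_eq_square field_simps)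
  also have "\<dots> = (1 / (2 * eps r)) *\<^sub>R (mvel r n \<times> B0) + tdir (pot r) (pos r n) (mvel r n)
      - (- (1 / (2 * eps r)) *\<^sub>R (mvel r n \<times> B0) + dpot r n) + ele r (pos r n)"
    using step unfolding variational_step_def v A transpose_jacobian_vector_potential[OF assms(1)] .
  also have "\<dots> = (1 / eps r) *\<^sub>R (mvel r n \<times> B0) + frc r n"
    using assms(3) by (simp add: frc_def vec_eq_iff field_simps)
  finally have "stp r *\<^sub>R ((1 / stp r) *\<^sub>R (vel r n - vel r (n - 1))) = stp r *\<^sub>R ((1 / eps r) *\<^sub>R (mvel r n \<times> B0) + frc r n)"
    by simp
  then show ?thesis using assms(2) by (simp add: scaleR_right_distrib)
qed

lemma parallel_projection_mult: "parallel_projection B0 *v w = (B0 \<bullet> w) *\<^sub>R B0"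
  by (simp add: parallel_projection_def vec_eq_iff matrix_vector_mul_assoc[symmetric])
     (simp add: matrix_vector_mult_def columnvector_def rowvector_def inner_vec_def mult.commute)

lemma derivs_bounded_by_norm:
  assumes "derivs_bounded_by M f" "norm x \<le> R"
  shows "norm (f x) \<le> \<bar>M 0 R\<bar>"
  using assms(1)[unfolded derivs_bounded_by_def, rule_format, of x R "[]"] assms(2) by simp

text \<open>The part of the starting velocity across \<open>B0\<close> carries an explicit factor
  \<open>e\<close>. It compensates the factor \<open>h / eps\<close> in the scheme, so the first
  velocity increment is \<open>O(h)\<close>.\<close>

lemma modified_start_velocity_bounds:
  assumes b: "norm B0 = 1" and e: "0 < e" "e \<le> 1"
    and B1: "norm (B1 x0) \<le> m" and E: "norm (E x0) \<le> m" and xd: "norm xd \<le> W"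
  defines "v0 \<equiv> modified_start_velocity e B0 B1 E x0 xd"
  shows "norm v0 \<le> W + (W * m + m)" "norm (v0 \<times> B0) \<le> e * (W * m + m)"
proof -
  let ?p = "(B0 \<bullet> xd) *\<^sub>R B0"
  let ?y = "?p \<times> B1 x0 + E x0"
  have v0: "v0 = ?p + e *\<^sub>R (?y \<times> B0)"
    by (simp add: v0_def modified_start_velocity_def parallel_projection_mult Let_def)
  have W: "0 \<le> W" using order_trans[OF norm_ge_zero xd] .
  have cr: "norm (z \<times> B0) \<le> norm z" for z using norm_cross_le[of z B0] b by simp
  have p: "norm ?p \<le> W" using Cauchy_Schwarz_ineq2[of B0 xd] b xd by simp
  have "norm (?p \<times> B1 x0) \<le> W * m"
    using p B1 W by (intro order_trans[OF norm_cross_le] mult_mono) auto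
  then have y: "norm ?y \<le> W * m + m" using E by (intro norm_triangle_le) simp
  have ey: "norm (e *\<^sub>R (?y \<times> B0)) \<le> e * (W * m + m)"
    using e cr[of ?y] y by simp
  also have "\<dots> \<le> W * m + m" using e y order_trans[OF norm_ge_zero y] by (simp add: mult_left_le_one_le)
  finally show "norm v0 \<le> W + (W * m + m)" unfolding v0 using p by (intro norm_triangle_le) simp
  have "v0 \<times> B0 = (e *\<^sub>R (?y \<times> B0)) \<times> B0" by (simp add: v0 cross_add_left cross_mult_left)
  then show "norm (v0 \<times> B0) \<le> e * (W * m + m)" using order_trans[OF cr ey] by (simp only:)
qed

section \<open>Runs in a fixed ball\<close>

locale run_family =
  fixes b :: "real^3" and M :: "nat \<Rightarrow> real \<Rightarrow> real" and c R U :: real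
  assumes norm_b: "norm b = 1" and R_nonneg: "0 \<le> R" and U_ge: "1 \<le> U"
begin

text \<open>Contains the velocity bound \<open>U\<close>, which the theorem does not assume;
  \<open>started_good\<close> provides it. Indices begin at -1 because the start determines a
  position before the initial one.\<close>

definition good :: "run \<Rightarrow> bool" where
  "good r \<longleftrightarrow> 0 < eps r \<and> eps r \<le> (stp r)\<^sup>2 \<and> 0 < stp r \<and> stp r \<le> 1 \<and>
     smooth_field (pot r) \<and> derivs_bounded_by M (pot r) \<and>
     smooth_field (ele r) \<and> derivs_bounded_by M (ele r) \<and> (\<forall>y. GDERIV (enp r) y :> - ele r y) \<and>
     (\<forall>n\<in>{-1..fin r + 1}. norm (pos r n) \<le> R) \<and>
     (\<forall>n\<in>{0..fin r}. vel r n - vel r (n - 1) = (stp r / eps r) *\<^sub>R (mvel r n \<times> b) + stp r *\<^sub>R frc r n) \<and>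
     (\<forall>n\<in>{-1..fin r}. norm (vel r n) \<le> U) \<and>
     real_of_int (fin r) * stp r \<le> c / eps r \<and> norm (vel r (-1) \<times> b) \<le> U * stp r"

text \<open>\<open>a\<close> and \<open>e\<close> record how many steps an estimate loses at either
  end of the run, since shifts and differences use up neighbours.\<close>

definition win :: "int \<Rightarrow> int \<Rightarrow> run \<Rightarrow> int \<Rightarrow> bool" where
  "win a e r n \<longleftrightarrow> good r \<and> a \<le> n \<and> n \<le> fin r + e"

lemma ubd_shift:
  assumes "ubd (win a e) f g" "a \<le> a' + k" "e' + k \<le> e"
  shows "ubd (win a' e') (\<lambda>r n. f r (n + k)) (\<lambda>r n. g r (n + k))"
  using assms(1)
proof (elim ubdE)
  fix C assume "0 \<le> C" "\<And>r n. win a e r n \<Longrightarrow> norm (f r n) \<le> C * g r n"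
  then show ?thesis using assms(2,3) by (intro ubdI[of C]) (auto simp: win_def)
qed

lemma ubd_sub: "ubd (win a e) f g \<Longrightarrow> a \<le> a' \<Longrightarrow> e' \<le> e \<Longrightarrow> ubd (win a' e') f g"
  using ubd_shift[of a e f g a' 0 e'] by simp

definition L :: real where "L = (\<Sum>l\<le>4. \<bar>M l (3 * R)\<bar>)"

definition L' :: real where "L' = chain_const 3 L 1"

lemma L_nonneg: "0 \<le> L" and L'_nonneg: "0 \<le> L'"
  by (simp_all add: L_def L'_def sum_nonneg chain_const_nonneg)

lemma goodD:
  assumes "good r"
  shows "0 < eps r" "eps r \<le> (stp r)\<^sup>2" "0 < stp r" "stp r \<le> 1" "smooth_field (pot r)" "smooth_field (ele r)"
    "derivs_bounded_by M (pot r)" "derivs_bounded_by M (ele r)"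
    "field_bound 4 (3 * R) L (pot r)" "field_bound 4 (3 * R) L (ele r)" "stp r \<noteq> 0" "eps r \<noteq> 0"
    "real_of_int (fin r) * stp r \<le> c / eps r" "norm (vel r (-1) \<times> b) \<le> U * stp r"
    "eps r \<le> stp r" "eps r \<le> 1" "(stp r)\<^sup>2 \<le> stp r" "(stp r)\<^sup>2 \<le> 1"
proof -
  show *: "0 < eps r" "eps r \<le> (stp r)\<^sup>2" "0 < stp r" "stp r \<le> 1" "smooth_field (pot r)" "smooth_field (ele r)"
    "derivs_bounded_by M (pot r)" "derivs_bounded_by M (ele r)"
    "real_of_int (fin r) * stp r \<le> c / eps r" "norm (vel r (-1) \<times> b) \<le> U * stp r"
    using assms by (auto simp: good_def)
  then show "field_bound 4 (3 * R) L (pot r)" "field_bound 4 (3 * R) L (ele r)"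
    by (auto simp: L_def intro: field_bound_derivs)
  show "(stp r)\<^sup>2 \<le> stp r" using * by (simp add: power2_eq_square mult_left_le)
  then show "eps r \<le> stp r" "eps r \<le> 1" "(stp r)\<^sup>2 \<le> 1" using * by linarith+
  show "stp r \<noteq> 0" "eps r \<noteq> 0" using * by auto
qed

lemma goodD_field3:
  assumes "good r"
  shows "field_bound 3 (3 * R) L (pot r)" "field_bound 3 (3 * R) L (ele r)"
    "field_bound 3 (3 * R) L (partial i (pot r))"
proof -
  show "field_bound 3 (3 * R) L (pot r)" "field_bound 3 (3 * R) L (ele r)"
    using goodD[OF assms] by (auto intro: field_bound_lower)
  have "field_bound (Suc 3) (3 * R) L (pot r)" using goodD(9)[OF assms] by simp
  then show "field_bound 3 (3 * R) L (partial i (pot r))" by (rule field_bound_partial)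
qed

lemma good_potential: "good r \<Longrightarrow> GDERIV (enp r) y :> - ele r y"
  by (auto simp: good_def)

lemma good_pos: "good r \<Longrightarrow> -1 \<le> n \<Longrightarrow> n \<le> fin r + 1 \<Longrightarrow> norm (pos r n) \<le> R"
  by (auto simp: good_def)

lemma good_step: "good r \<Longrightarrow> 0 \<le> n \<Longrightarrow> n \<le> fin r \<Longrightarrow>
    vel r n - vel r (n - 1) = (stp r / eps r) *\<^sub>R (mvel r n \<times> b) + stp r *\<^sub>R frc r n"
  by (auto simp: good_def)

lemma good_vel: "good r \<Longrightarrow> -1 \<le> n \<Longrightarrow> n \<le> fin r \<Longrightarrow> norm (vel r n) \<le> U"
  by (auto simp: good_def)

lemma ubd_vel: "ubd (win (-1) 0) vel (\<lambda>r n. 1)"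
  using U_ge by (intro ubdI[of U]) (auto simp: win_def good_vel)

lemma ubd_mvel: "ubd (win 0 0) mvel (\<lambda>r n. 1)"
  unfolding mvel_def[abs_def]
  using ubd_vel ubd_shift[OF ubd_vel, of 0 "-1" 0]
  by (intro ubd_const_scaleR ubd_add) (auto intro: ubd_sub)

lemma ubd_frc: "ubd (win 0 0) frc (\<lambda>r n. 1)"
  using ubd_mvel
proof (rule ubdE)
  fix C assume C: "0 \<le> C" "\<And>r n. win 0 0 r n \<Longrightarrow> norm (mvel r n) \<le> C * 1"
  show ?thesis
  proof (rule ubdI[of "(3 * L + L') * C + L"])
    fix r n assume w: "win 0 0 r n"
    have "norm (frc r n) \<le> (3 * L + L') * norm (mvel r n) + L"
      unfolding L'_def using w
      by (intro norm_frc_le[where R = R] goodD_field3 field_bound_lower[OF goodD_field3(2), where m' = 0])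
         (auto simp: win_def goodD good_pos R_nonneg)
    also have "\<dots> \<le> (3 * L + L') * C + L"
      using C(2)[OF w] L_nonneg L'_nonneg by (intro add_right_mono mult_left_mono) auto
    finally show "norm (frc r n) \<le> ((3 * L + L') * C + L) * 1" by simp
  qed (use C L_nonneg L'_nonneg in auto)
qed

text \<open>Unit of measurement for as long as nothing better than \<open>U\<close> is known about
  the gyration. Estimates in terms of \<open>sp\<close> feed the Gronwall argument and turn into
  powers of \<open>h\<close> after \<open>ubd_perp\<close>.\<close>

definition sp :: "run \<Rightarrow> int \<Rightarrow> real" where
  "sp r n = stp r + norm (vel r n \<times> b) + norm (vel r (n - 1) \<times> b)"

lemma sp_ge: "good r \<Longrightarrow> stp r \<le> sp r n" and sp_pos: "good r \<Longrightarrow> 0 < sp r n"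
  using goodD(3)[of r] by (simp_all add: sp_def add_pos_nonneg)

lemma norm_decomp: "norm y \<le> norm (y \<times> b) + \<bar>y \<bullet> b\<bar>"
proof -
  have "(norm y)\<^sup>2 = (norm (y \<times> b))\<^sup>2 + (y \<bullet> b)\<^sup>2"
    using norm_cross_dot[of y b] norm_b by simp
  also have "\<dots> \<le> (norm (y \<times> b) + \<bar>y \<bullet> b\<bar>)\<^sup>2"
    by (simp add: power2_sum)
  finally show ?thesis by (rule power2_le_imp_le) simp
qed

lemma cross_b_cross_b: "(y \<times> b) \<times> b = (y \<bullet> b) *\<^sub>R b - y"
proof -
  have "b \<bullet> b = 1" using norm_b by (simp add: dot_square_norm)
  then have "b$1 * b$1 + b$2 * b$2 + b$3 * b$3 = 1" by (simp add: inner_vec_def sum_3)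
  then show ?thesis
    unfolding vec_eq_iff forall_3 cross3_def inner_vec_def sum_3 vector_def
    by (simp add: algebra_simps) algebra
qed

text \<open>Parallel to \<open>b\<close> the stiff term drops out and the increment is
  \<open>h\<close> times a bounded force; across \<open>b\<close> the triangle inequality is
  enough.\<close>

lemma ubd_dvel: "ubd (win 0 0) (\<lambda>r n. vel r n - vel r (n - 1)) sp"
  using ubd_frc
proof (rule ubdE)
  fix C assume C: "0 \<le> C" "\<And>r n. win 0 0 r n \<Longrightarrow> norm (frc r n) \<le> C * 1"
  show ?thesis
  proof (rule ubdI[of "1 + C"])
    fix r n assume w: "win 0 0 r n"
    let ?y = "vel r n - vel r (n - 1)"
    have "?y \<bullet> b = stp r * (frc r n \<bullet> b)"
      using good_step[of r n] w by (simp add: win_def inner_add_left dot_cross_self)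
    moreover have "\<bar>frc r n \<bullet> b\<bar> \<le> C"
      using Cauchy_Schwarz_ineq2[of "frc r n" b] C(2)[OF w] norm_b by simp
    ultimately have "\<bar>?y \<bullet> b\<bar> \<le> stp r * C"
      using w goodD(3)[of r] by (auto simp: win_def abs_mult intro: mult_left_mono)
    moreover have "stp r * C \<le> C * sp r n"
      using w C(1) sp_ge[of r n] by (auto simp: win_def mult.commute intro: mult_left_mono)
    moreover have "norm (?y \<times> b) \<le> 1 * sp r n"
      using norm_triangle_ineq4[of "vel r n \<times> b" "vel r (n - 1) \<times> b"] w goodD(3)[of r]
      by (simp add: sp_def Cross3.left_diff_distrib win_def)
    ultimately show "norm ?y \<le> (1 + C) * sp r n"
      using norm_decomp[of ?y] by (simp add: distrib_right)
  qed (use C in auto)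
qed

text \<open>The scheme solved for its stiff term: \<open>mvel \<times> b\<close> is
  \<open>eps / h\<close> times that part of the velocity increment which does not come from
  \<open>frc\<close>. This expresses that the gyration almost cancels in averages.\<close>

lemma ubd_mvel_cross: "ubd (win 0 0) (\<lambda>r n. mvel r n \<times> b) (\<lambda>r n. eps r / stp r * sp r n)"
proof -
  have "ubd (win 0 0) (\<lambda>r n. stp r *\<^sub>R frc r n) (\<lambda>r n. stp r * 1)"
    using ubd_frc by (intro ubd_scaleR) (auto intro!: ubdI[of 1] simp: win_def goodD less_imp_le)
  then have "ubd (win 0 0) (\<lambda>r n. stp r *\<^sub>R frc r n) sp"
    by (rule ubd_le) (auto simp: win_def sp_ge)
  then have "ubd (win 0 0) (\<lambda>r n. vel r n - vel r (n - 1) - stp r *\<^sub>R frc r n) sp"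
    by (rule ubd_diff[OF ubd_dvel])
  moreover have "ubd (win 0 0) (\<lambda>r n. eps r / stp r) (\<lambda>r n. eps r / stp r)"
    by (intro ubdI[of 1]) (auto simp: win_def goodD less_imp_le)
  ultimately have "ubd (win 0 0) (\<lambda>r n. (eps r / stp r) *\<^sub>R (vel r n - vel r (n - 1) - stp r *\<^sub>R frc r n))
      (\<lambda>r n. eps r / stp r * sp r n)"
    by (intro ubd_scaleR)
  then show ?thesis
    by (rule ubd_cong) (auto simp: win_def good_step goodD)
qed

lemma eps_over_stp: "good r \<Longrightarrow> eps r / stp r \<le> stp r"
  using goodD[of r] by (simp add: divide_le_eq power2_eq_square)

lemma ubd_mvel_cross': "ubd (win 0 0) (\<lambda>r n. mvel r n \<times> b) (\<lambda>r n. stp r * sp r n)"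
  by (rule ubd_le[OF ubd_mvel_cross])
     (simp only: win_def mult_right_mono[OF eps_over_stp less_imp_le[OF sp_pos]])

text \<open>The quotient is expanded about the midpoint \<open>?m\<close> of the outer positions,
  where symmetry removes the second order. Moving the base point to \<open>pos r n\<close> costs
  little, because the two points differ by half of \<open>h\<close> times a velocity
  increment.\<close>

lemma ubd_dpot_dir: "ubd (win 0 0) (\<lambda>r n. dpot r n - dir (pot r) (pos r n) (mvel r n)) (\<lambda>r n. stp r * sp r n)"
proof -
  obtain C where C: "0 \<le> C" "\<And>r n. win 0 0 r n \<Longrightarrow> norm (mvel r n) \<le> C * 1"
    using ubd_mvel by (rule ubdE) blast
  obtain C' where C': "0 \<le> C'" "\<And>r n. win 0 0 r n \<Longrightarrow> norm (vel r n - vel r (n - 1)) \<le> C' * sp r n"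
    using ubd_dvel by (rule ubdE) blast
  show ?thesis
  proof (rule ubdI[of "L' * C ^ 3 + 3 * L' * C' * C"])
    fix r n assume w: "win 0 0 r n"
    then have g: "good r" "0 \<le> n" "n \<le> fin r" by (auto simp: win_def)
    note h = goodD(3,4,11)[OF g(1)]
    let ?m = "(1/2) *\<^sub>R (pos r (n + 1) + pos r (n - 1))" and ?d = "stp r *\<^sub>R mvel r n"
    have md: "?m + ?d = pos r (n + 1)" "?m - ?d = pos r (n - 1)"
      using h by (simp_all add: mvel_def vel_def vec_eq_iff field_simps)
    have x: "norm (pos r (n + 1)) \<le> R" "norm (pos r (n - 1)) \<le> R" "norm (pos r n) \<le> R"
      using g by (auto intro: good_pos)
    have m: "norm ?m \<le> R"
      using norm_triangle_ineq[of "pos r (n + 1)" "pos r (n - 1)"] x by simp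
    have mx: "?m - pos r n = (stp r / 2) *\<^sub>R (vel r n - vel r (n - 1))"
      using h by (simp add: vel_def vec_eq_iff field_simps)
    have v: "norm (mvel r n) \<le> C" using C(2)[OF w] by simp
    have s: "stp r \<le> sp r n" "0 \<le> sp r n" using g sp_ge[of r n] h by auto
    have "norm (pot r (?m + ?d) - pot r (?m - ?d) - 2 *\<^sub>R dir (pot r) ?m ?d) \<le> L' * norm ?d ^ 3"
      unfolding L'_def using goodD_field3(1)[OF g(1)] x R_nonneg
      by (intro field_central[where R = "3 * R"]) (auto simp: md)
    also have "\<dots> = L' * (stp r ^ 3 * norm (mvel r n) ^ 3)"
      using h by (simp add: power_mult_distrib)
    also have "\<dots> \<le> L' * (stp r ^ 3 * C ^ 3)"
      using v h L'_nonneg by (intro mult_left_mono power_mono) auto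
    finally have 1: "norm (pot r (pos r (n+1)) - pot r (pos r (n-1)) - 2 *\<^sub>R dir (pot r) ?m ?d) \<le> L' * C ^ 3 * stp r ^ 3"
      by (simp add: md mult.commute mult.left_commute)
    have "norm (dir (pot r) ?m (mvel r n) - dir (pot r) (pos r n) (mvel r n))
        \<le> 3 * L' * norm (?m - pos r n) * norm (mvel r n)"
      unfolding L'_def using goodD(9)[OF g(1)] x m by (intro dir_lipschitz)
    also have "\<dots> \<le> 3 * L' * (stp r * (C' * sp r n)) * C"
    proof -
      have "norm (?m - pos r n) = (stp r / 2) * norm (vel r n - vel r (n - 1))"
        unfolding mx using h by simp
      also have "\<dots> \<le> stp r * (C' * sp r n)"
        using C'(2)[OF w] h by (intro mult_mono) auto
      finally show ?thesis
        using v L'_nonneg C(1) C'(1) s h by (intro mult_mono mult_nonneg_nonneg) auto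
    qed
    finally have 2: "norm (dir (pot r) ?m (mvel r n) - dir (pot r) (pos r n) (mvel r n)) \<le> 3 * L' * C' * C * (stp r * sp r n)"
      by (simp add: algebra_simps)
    have "dpot r n - dir (pot r) ?m (mvel r n) =
        (1 / (2 * stp r)) *\<^sub>R (pot r (pos r (n+1)) - pot r (pos r (n-1)) - 2 *\<^sub>R dir (pot r) ?m ?d)"
      using h by (simp add: dpot_def dir_scaleR scaleR_diff_right)
    then have "norm (dpot r n - dir (pot r) ?m (mvel r n)) \<le> (1 / (2 * stp r)) * (L' * C ^ 3 * stp r ^ 3)"
      using mult_left_mono[OF 1, of "1 / (2 * stp r)"] h by simp
    also have "\<dots> = L' * C ^ 3 * (stp r * stp r) / 2"
      using h by (simp add: field_simps eval_nat_numeral)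
    also have "\<dots> \<le> L' * C ^ 3 * (stp r * stp r)"
      using L'_nonneg C(1) h by simp
    also have "\<dots> \<le> L' * C ^ 3 * (stp r * sp r n)"
      using s h L'_nonneg C(1) by (intro mult_left_mono) auto
    finally have 3: "norm (dpot r n - dir (pot r) ?m (mvel r n)) \<le> L' * C ^ 3 * (stp r * sp r n)" .
    show "norm (dpot r n - dir (pot r) (pos r n) (mvel r n)) \<le> (L' * C ^ 3 + 3 * L' * C' * C) * (stp r * sp r n)"
      using norm_triangle_ineq[of "dpot r n - dir (pot r) ?m (mvel r n)"
          "dir (pot r) ?m (mvel r n) - dir (pot r) (pos r n) (mvel r n)"] 2 3
      by (simp add: distrib_right)
  qed (use C C' L'_nonneg in auto)
qed

text \<open>Equals \<open>b \<times> curl (pot r)\<close> at the current position: the magnetic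
  force per unit of parallel velocity. Being orthogonal to \<open>b\<close>, it does not contribute
  to the parallel acceleration.\<close>

definition bet :: "run \<Rightarrow> int \<Rightarrow> real^3" where
  "bet r n = tdir (pot r) (pos r n) b - dir (pot r) (pos r n) b"

definition rem :: "run \<Rightarrow> int \<Rightarrow> real^3" where
  "rem r n = frc r n - ((mvel r n \<bullet> b) *\<^sub>R bet r n + ele r (pos r n))"

lemma bet_perp: "bet r n \<bullet> b = 0"
  using tdir_inner[of "pot r" "pos r n" b b] by (simp add: bet_def inner_diff_left inner_commute[of b])

text \<open>In \<open>frc\<close> the parallel part of the velocity yields \<open>bet\<close>
  exactly. The perpendicular part is controlled by \<open>ubd_mvel_cross'\<close>, and the
  replacement of the difference quotient by a derivative is controlled by
  \<open>ubd_dpot_dir\<close>.\<close>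

lemma ubd_rem: "ubd (win 0 0) rem (\<lambda>r n. stp r * sp r n)"
proof -
  have rem_eq: "rem r n = (tdir (pot r) (pos r n) (- ((mvel r n \<times> b) \<times> b)) - dir (pot r) (pos r n) (- ((mvel r n \<times> b) \<times> b)))
      - (dpot r n - dir (pot r) (pos r n) (mvel r n))" for r n
  proof -
    have "mvel r n = (mvel r n \<bullet> b) *\<^sub>R b + (- ((mvel r n \<times> b) \<times> b))"
      by (simp add: cross_b_cross_b)
    then have "tdir (pot r) (pos r n) (mvel r n) = (mvel r n \<bullet> b) *\<^sub>R tdir (pot r) (pos r n) b
        + tdir (pot r) (pos r n) (- ((mvel r n \<times> b) \<times> b))"
      and "dir (pot r) (pos r n) (mvel r n) = (mvel r n \<bullet> b) *\<^sub>R dir (pot r) (pos r n) b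
        + dir (pot r) (pos r n) (- ((mvel r n \<times> b) \<times> b))"
      by (metis tdir_add tdir_scaleR, metis dir_add dir_scaleR)
    then show ?thesis by (simp add: rem_def frc_def bet_def algebra_simps)
  qed
  have "ubd (win 0 0) (\<lambda>r n. tdir (pot r) (pos r n) (- ((mvel r n \<times> b) \<times> b))) (\<lambda>r n. stp r * sp r n)"
  proof (rule ubd_dom[OF ubd_mvel_cross', of "3 * L"])
    fix r n assume w: "win 0 0 r n"
    then have "norm (tdir (pot r) (pos r n) (- ((mvel r n \<times> b) \<times> b))) \<le> 3 * L * norm (- ((mvel r n \<times> b) \<times> b))"
      using good_pos[of r n] R_nonneg
      by (intro norm_tdir_le[where R = "3 * R"] field_bound_lower[OF goodD_field3(1)]) (auto simp: win_def)
    also have "\<dots> \<le> 3 * L * (norm (mvel r n \<times> b) * 1)"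
      using norm_cross_le[of "mvel r n \<times> b" b] norm_b L_nonneg by (intro mult_left_mono) auto
    finally show "norm (tdir (pot r) (pos r n) (- ((mvel r n \<times> b) \<times> b))) \<le> 3 * L * norm (mvel r n \<times> b)" by simp
  qed (use L_nonneg in auto)
  moreover have "ubd (win 0 0) (\<lambda>r n. dir (pot r) (pos r n) (- ((mvel r n \<times> b) \<times> b))) (\<lambda>r n. stp r * sp r n)"
  proof (rule ubd_dom[OF ubd_mvel_cross', of "3 * L"])
    fix r n assume w: "win 0 0 r n"
    then have "norm (dir (pot r) (pos r n) (- ((mvel r n \<times> b) \<times> b))) \<le> 3 * L * norm (- ((mvel r n \<times> b) \<times> b))"
      using good_pos[of r n] R_nonneg
      by (intro norm_dir_le[where R = "3 * R"] field_bound_lower[OF goodD_field3(1)]) (auto simp: win_def)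
    also have "\<dots> \<le> 3 * L * (norm (mvel r n \<times> b) * 1)"
      using norm_cross_le[of "mvel r n \<times> b" b] norm_b L_nonneg by (intro mult_left_mono) auto
    finally show "norm (dir (pot r) (pos r n) (- ((mvel r n \<times> b) \<times> b))) \<le> 3 * L * norm (mvel r n \<times> b)" by simp
  qed (use L_nonneg in auto)
  ultimately show ?thesis
    unfolding rem_eq[abs_def] by (intro ubd_diff ubd_dpot_dir)
qed

lemma frc_inner_b: "frc r n \<bullet> b = ele r (pos r n) \<bullet> b + rem r n \<bullet> b"
  by (simp add: rem_def inner_diff_left inner_add_left bet_perp)

lemma parallel_step:
  assumes "good r" "0 \<le> n" "n \<le> fin r"
  shows "(vel r n - vel r (n - 1)) \<bullet> b = stp r * (frc r n \<bullet> b)"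
  using good_step[OF assms] by (simp add: inner_add_left dot_cross_self)

lemma norm_cross_b_le: "norm (y \<times> b) \<le> norm y"
  using norm_cross_le[of y b] norm_b by simp

lemma abs_inner_b_le: "\<bar>y \<bullet> b\<bar> \<le> norm y"
  using Cauchy_Schwarz_ineq2[of y b] norm_b by simp

lemma sp_le: "good r \<Longrightarrow> 0 \<le> n \<Longrightarrow> n \<le> fin r \<Longrightarrow> sp r n \<le> 1 + 2 * U"
  unfolding sp_def
  using goodD(4)[of r] good_vel[of r n] good_vel[of r "n - 1"] norm_cross_b_le[of "vel r n"]
    norm_cross_b_le[of "vel r (n - 1)"] by simp

text \<open>A sequence with bounded values and bounded second difference quotient has a bounded
  first difference quotient. The bound does not involve \<open>U\<close>, which closes the bootstrap.\<close>

lemma parallel_velocity_bound: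
  "\<exists>h0>0. \<forall>r n. good r \<longrightarrow> stp r \<le> h0 \<longrightarrow> \<bar>vel r (-1) \<bullet> b\<bar> \<le> V \<longrightarrow> -1 \<le> n \<longrightarrow> n \<le> fin r \<longrightarrow>
     \<bar>vel r n \<bullet> b\<bar> \<le> V + 2 * R + 2 * (\<bar>M 0 R\<bar> + 1)"
proof -
  obtain C where C: "0 \<le> C" "\<And>r n. win 0 0 r n \<Longrightarrow> norm (rem r n) \<le> C * (stp r * sp r n)"
    using ubd_rem by (rule ubdE) blast
  \<comment> \<open>Small enough that the remainder adds at most 1 to the parallel acceleration;
    this is the 1 in \<open>B\<close>.\<close>
  define h0 where "h0 = 1 / (C * (1 + 2 * U) + 1)"
  define B where "B = \<bar>M 0 R\<bar> + 1"
  have den: "0 < C * (1 + 2 * U) + 1" using C(1) U_ge by (simp add: add_nonneg_pos)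
  have B: "0 \<le> B" by (simp add: B_def)
  have main: "\<bar>vel r n \<bullet> b\<bar> \<le> V + 2 * R + 2 * B"
    if r: "good r" "stp r \<le> h0" "\<bar>vel r (-1) \<bullet> b\<bar> \<le> V" and n: "-1 \<le> n" "n \<le> fin r" for r n
  proof -
    note h = goodD(3,4)[OF r(1)]
    have acc: "\<bar>frc r m \<bullet> b\<bar> \<le> B" if "0 \<le> m" "m \<le> fin r" for m
    proof -
      have "norm (iter_partial [] (ele r) (pos r m)) \<le> M (length ([]::3 list)) R"
        using good_pos[OF r(1), of m] that
        by (intro goodD(8)[OF r(1), unfolded derivs_bounded_by_def, rule_format]) simp
      then have 1: "\<bar>ele r (pos r m) \<bullet> b\<bar> \<le> \<bar>M 0 R\<bar>"
        using abs_inner_b_le[of "ele r (pos r m)"] by simp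
      have "norm (rem r m) \<le> C * (stp r * sp r m)" using C(2)[of r m] that r by (simp add: win_def)
      also have "\<dots> \<le> C * (stp r * (1 + 2 * U))"
        using sp_le[OF r(1) that] h C(1) by (intro mult_left_mono) auto
      also have "\<dots> = stp r * (C * (1 + 2 * U))" by simp
      also have "\<dots> \<le> h0 * (C * (1 + 2 * U))"
        using r(2) C(1) U_ge by (intro mult_right_mono) auto
      also have "\<dots> \<le> 1" using den by (simp add: h0_def divide_le_eq)
      finally show ?thesis
        using 1 abs_inner_b_le[of "rem r m"] by (simp add: frc_inner_b B_def)
    qed
    have step: "\<bar>vel r m \<bullet> b - vel r (m - int k) \<bullet> b\<bar> \<le> real k * (stp r * B)"
      if "-1 \<le> m - int k" "m \<le> n" for m k
      using that
    proof (induction k)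
      case (Suc k)
      have "\<bar>(vel r (m - int k) - vel r (m - int k - 1)) \<bullet> b\<bar> \<le> stp r * B"
        using parallel_step[OF r(1), of "m - int k"] acc[of "m - int k"] Suc.prems n h
        by (simp add: abs_mult)
      moreover have "m - int k - 1 = m - int (Suc k)" by simp
      ultimately show ?case using Suc.IH Suc.prems by (simp add: inner_diff_left distrib_right)
    qed simp
    show ?thesis
    proof (cases "real_of_int (n + 1) * stp r \<le> 2")
      case True
      have "\<bar>vel r n \<bullet> b - vel r (-1) \<bullet> b\<bar> \<le> real_of_int (n + 1) * stp r * B"
        using step[of n "nat (n + 1)"] n by (simp add: mult.assoc)
      also have "\<dots> \<le> 2 * B" using True B by (intro mult_right_mono)
      finally show ?thesis using r(3) R_nonneg by linarith
    next
      case False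
      \<comment> \<open>\<open>m\<close> steps last between 1 and 2 units of time: long enough that
        the mean parallel velocity over them is at most \<open>2 * R\<close>, because positions are
        bounded, and short enough that the current one differs from that mean by at most
        \<open>2 * B\<close>.\<close>
      define m where "m = nat \<lceil>1 / stp r\<rceil>"
      have "1 / stp r \<le> real m" "real m \<le> 1 / stp r + 1"
        using h by (simp_all add: m_def le_nat_iff)
      then have "1 / stp r * stp r \<le> real m * stp r" "real m * stp r \<le> (1 / stp r + 1) * stp r"
        using h by (simp_all only: mult_right_mono less_imp_le)
      then have m: "1 \<le> real m * stp r" "real m * stp r \<le> 2"
        using h by (simp_all add: distrib_right)
      have "real m * stp r < real_of_int (n + 1) * stp r" using m False by linarith
      then have "real m < real_of_int (n + 1)" using h by (simp add: mult_less_cancel_right)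
      then have nm: "int m < n + 1" by linarith
      have telescope: "pos r (n + 1) - pos r (n + 1 - int k) = stp r *\<^sub>R (\<Sum>j<k. vel r (n - int j))" for k
      proof (induction k)
        case (Suc k)
        then show ?case
          using goodD(11)[OF r(1)] pos_vel[of r "n - int k"]
          by (simp add: scaleR_right_distrib algebra_simps)
      qed simp
      have "\<bar>real m * (vel r n \<bullet> b) - (\<Sum>j<m. vel r (n - int j)) \<bullet> b\<bar>
          = \<bar>\<Sum>j<m. vel r n \<bullet> b - vel r (n - int j) \<bullet> b\<bar>"
        by (simp add: sum_subtractf inner_sum_left)
      also have "\<dots> \<le> (\<Sum>j<m. \<bar>vel r n \<bullet> b - vel r (n - int j) \<bullet> b\<bar>)" by (rule sum_abs)
      also have "\<dots> \<le> (\<Sum>j<m. real m * (stp r * B))"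
      proof (rule sum_mono)
        fix j assume "j \<in> {..<m}"
        then have "real j * (stp r * B) \<le> real m * (stp r * B)"
          using B h by (intro mult_right_mono) auto
        with step[of n j] \<open>j \<in> {..<m}\<close> nm show "\<bar>vel r n \<bullet> b - vel r (n - int j) \<bullet> b\<bar> \<le> real m * (stp r * B)"
          by force
      qed
      also have "\<dots> = real m * (real m * stp r * B)" by simp
      also have "\<dots> \<le> real m * (2 * B)" using m B by (intro mult_left_mono mult_right_mono) auto
      finally have 1: "\<bar>real m * (vel r n \<bullet> b) - (\<Sum>j<m. vel r (n - int j)) \<bullet> b\<bar> \<le> real m * (2 * B)" .
      have "\<bar>(pos r (n + 1) - pos r (n + 1 - int m)) \<bullet> b\<bar> \<le> 2 * R"
        using abs_inner_b_le[of "pos r (n + 1) - pos r (n + 1 - int m)"]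
          norm_triangle_ineq4[of "pos r (n + 1)" "pos r (n + 1 - int m)"]
          good_pos[OF r(1), of "n + 1"] good_pos[OF r(1), of "n + 1 - int m"] n nm by linarith
      then have "stp r * \<bar>(\<Sum>j<m. vel r (n - int j)) \<bullet> b\<bar> \<le> 2 * R"
        using h by (simp add: telescope abs_mult)
      also have "\<dots> \<le> (real m * stp r) * (2 * R)" using m R_nonneg mult_right_mono[OF m(1), of "2 * R"] by simp
      also have "\<dots> = stp r * (real m * (2 * R))" by simp
      finally have "\<bar>(\<Sum>j<m. vel r (n - int j)) \<bullet> b\<bar> \<le> real m * (2 * R)"
        using h by (simp only: mult_le_cancel_left_pos)
      with 1 have "\<bar>real m * (vel r n \<bullet> b)\<bar> \<le> real m * (2 * R + 2 * B)"
        by (simp add: distrib_left)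
      moreover have "0 < real m" using m by (cases m) auto
      ultimately have "\<bar>vel r n \<bullet> b\<bar> \<le> 2 * R + 2 * B"
        by (simp add: abs_mult)
      then show ?thesis using r(3) by linarith
    qed
  qed
  have "0 < h0" using den by (simp add: h0_def)
  then show ?thesis using main unfolding B_def by blast
qed

section \<open>The gyration of the perpendicular velocity as a Cayley transform\<close>

lemma norm_rotation:
  assumes "y \<bullet> b = 0"
  shows "norm (y + k *\<^sub>R (y \<times> b)) = sqrt (1 + k\<^sup>2) * norm y"
proof -
  have "(norm (y + k *\<^sub>R (y \<times> b)))\<^sup>2 = (norm y)\<^sup>2 + k\<^sup>2 * (norm (y \<times> b))\<^sup>2"
    unfolding power2_norm_eq_inner
    by (simp add: inner_add_left inner_add_right dot_cross_self power2_eq_square)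
  also have "(norm (y \<times> b))\<^sup>2 = (norm y)\<^sup>2"
    using norm_cross_dot[of y b] assms norm_b by simp
  also have "(norm y)\<^sup>2 + k\<^sup>2 * (norm y)\<^sup>2 = (sqrt (1 + k\<^sup>2) * norm y)\<^sup>2"
    by (simp add: power_mult_distrib distrib_right)
  finally show ?thesis by (simp add: power2_eq_iff_nonneg)
qed

lemma cross_b_perp: "(y \<times> b) \<bullet> b = 0"
  by (simp add: dot_cross_self)

lemma cross_b_twice: "((y \<times> b) \<times> b) \<times> b = - (y \<times> b)"
  using cross_b_cross_b[of "y \<times> b"] cross_b_perp[of y] by simp

text \<open>Tangent of half the angle by which one step turns the perpendicular velocity. On good
  runs it is at least \<open>1 / (2 * h)\<close>, so the angle tends to pi as \<open>h\<close> tends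
  to 0.\<close>

definition gyr :: "run \<Rightarrow> real" where "gyr r = stp r / (2 * eps r)"

lemma gyr_ge: "good r \<Longrightarrow> 1 / 2 \<le> gyr r"
  using goodD[of r] by (simp add: gyr_def divide_simps)

lemma perp_step:
  assumes "good r" "0 \<le> n" "n \<le> fin r"
  shows "vel r n \<times> b - gyr r *\<^sub>R ((vel r n \<times> b) \<times> b) =
    vel r (n - 1) \<times> b + gyr r *\<^sub>R ((vel r (n - 1) \<times> b) \<times> b) + (2 * eps r * gyr r) *\<^sub>R (frc r n \<times> b)"
proof -
  have "vel r n = vel r (n - 1) + (stp r / eps r) *\<^sub>R (mvel r n \<times> b) + stp r *\<^sub>R frc r n"
    using good_step[OF assms] by (simp add: algebra_simps)
  then have "vel r n \<times> b = (vel r (n - 1) + (stp r / eps r) *\<^sub>R (mvel r n \<times> b) + stp r *\<^sub>R frc r n) \<times> b"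
    by simp
  also have "(stp r / eps r) *\<^sub>R (mvel r n \<times> b) = gyr r *\<^sub>R (vel r n \<times> b + vel r (n - 1) \<times> b)"
    using goodD[OF assms(1)] by (simp add: mvel_def gyr_def cross_mult_left cross_add_left)
  finally show ?thesis
    using goodD[OF assms(1)] by (simp add: cross_add_left cross_mult_left gyr_def algebra_simps)
qed

lemma norm_rotation_minus:
  assumes "y \<bullet> b = 0"
  shows "norm (y - k *\<^sub>R (y \<times> b)) = sqrt (1 + k\<^sup>2) * norm y"
  using norm_rotation[OF assms, of "- k"] by simp

text \<open>The maps on both sides multiply norms on the perpendicular plane by the same factor
  \<open>sqrt (1 + k\<^sup>2)\<close>, which cancels and also divides the forcing.\<close>

lemma norm_cayley:
  assumes "y - k *\<^sub>R (y \<times> b) = z + k *\<^sub>R (z \<times> b) + p" "y \<bullet> b = 0" "z \<bullet> b = 0" "0 < k"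
    and "norm p \<le> sqrt (1 + k\<^sup>2) * q"
  shows "\<bar>norm y - norm z\<bar> \<le> q"
proof -
  have "\<bar>norm (z + k *\<^sub>R (z \<times> b) + p) - norm (z + k *\<^sub>R (z \<times> b))\<bar> \<le> norm p"
    using norm_triangle_ineq3[of "z + k *\<^sub>R (z \<times> b) + p" "z + k *\<^sub>R (z \<times> b)"] by simp
  then have "\<bar>sqrt (1 + k\<^sup>2) * norm y - sqrt (1 + k\<^sup>2) * norm z\<bar> \<le> sqrt (1 + k\<^sup>2) * q"
    using assms norm_rotation[OF assms(3), of k] norm_rotation_minus[OF assms(2), of k] by simp
  then have "sqrt (1 + k\<^sup>2) * \<bar>norm y - norm z\<bar> \<le> sqrt (1 + k\<^sup>2) * q"
    by (simp add: right_diff_distrib[symmetric] abs_mult del: mult_le_cancel_left_pos)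
  moreover have "0 < sqrt (1 + k\<^sup>2)" by (simp add: add_pos_nonneg)
  ultimately show ?thesis by (simp only: mult_le_cancel_left_pos)
qed

lemma le_sqrt_one_plus: "0 \<le> k \<Longrightarrow> k \<le> sqrt (1 + k\<^sup>2)"
  by (rule real_le_rsqrt) simp

text \<open>The crude version of the estimate. A change \<open>O(eps)\<close> per step would add up
  to \<open>O(1 / h)\<close> over a whole run, but it suffices to compare neighbouring
  steps.\<close>

lemma perp_norm_step:
  assumes "good r" "0 \<le> n" "n \<le> fin r"
  shows "\<bar>norm (vel r n \<times> b) - norm (vel r (n - 1) \<times> b)\<bar> \<le> 2 * eps r * norm (frc r n)"
proof (rule norm_cayley[OF perp_step[OF assms] cross_b_perp cross_b_perp])
  have k: "0 < gyr r" using gyr_ge[OF assms(1)] by linarith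
  then show "0 < gyr r" .
  have e: "0 < eps r" using goodD[OF assms(1)] by simp
  have "norm ((2 * eps r * gyr r) *\<^sub>R (frc r n \<times> b)) \<le> (2 * eps r * gyr r) * norm (frc r n)"
    using k e norm_cross_b_le[of "frc r n"] by simp
  also have "\<dots> = gyr r * (2 * eps r * norm (frc r n))" by simp
  also have "\<dots> \<le> sqrt (1 + (gyr r)\<^sup>2) * (2 * eps r * norm (frc r n))"
    using le_sqrt_one_plus[of "gyr r"] k e by (intro mult_right_mono) auto
  finally show "norm ((2 * eps r * gyr r) *\<^sub>R (frc r n \<times> b)) \<le> sqrt (1 + (gyr r)\<^sup>2) * (2 * eps r * norm (frc r n))" .
qed

text \<open>The perpendicular velocity minus the first two terms of its slowly varying part, obtained by
  summing the gyration by parts twice.\<close>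

definition osc :: "run \<Rightarrow> int \<Rightarrow> real^3" where
  "osc r n = vel r n \<times> b - eps r *\<^sub>R ((frc r n \<times> b) \<times> b)
     - (eps r / 2) *\<^sub>R (((frc r n \<times> b) \<times> b - (frc r (n - 1) \<times> b) \<times> b)
         + (1 / gyr r) *\<^sub>R (frc r n \<times> b - frc r (n - 1) \<times> b))"

definition dd_frc :: "run \<Rightarrow> int \<Rightarrow> real^3" where
  "dd_frc r n = frc r n - 2 *\<^sub>R frc r (n - 1) + frc r (n - 2)"

lemma osc_cayley:
  assumes "good r" "1 \<le> n" "n \<le> fin r"
  shows "osc r n - gyr r *\<^sub>R (osc r n \<times> b) = osc r (n - 1) + gyr r *\<^sub>R (osc r (n - 1) \<times> b)
    + (eps r / 2) *\<^sub>R ((gyr r - 1 / gyr r) *\<^sub>R (dd_frc r n \<times> b) - 2 *\<^sub>R ((dd_frc r n \<times> b) \<times> b))"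
proof -
  have oscJ: "osc r n \<times> b = (vel r n \<times> b) \<times> b + eps r *\<^sub>R (frc r n \<times> b)
     - (eps r / 2) *\<^sub>R ((1 / gyr r) *\<^sub>R ((frc r n \<times> b) \<times> b - (frc r (n - 1) \<times> b) \<times> b)
         - (frc r n \<times> b - frc r (n - 1) \<times> b))" for n
    by (simp add: osc_def Cross3.left_diff_distrib cross_add_left cross_mult_left cross_b_twice algebra_simps)
  have "gyr r \<noteq> 0" using gyr_ge[OF assms(1)] by linarith
  have eq: "vel r n \<times> b - gyr r *\<^sub>R ((vel r n \<times> b) \<times> b) =
    vel r (n - 1) \<times> b + gyr r *\<^sub>R ((vel r (n - 1) \<times> b) \<times> b) + (2 * eps r * gyr r) *\<^sub>R (frc r n \<times> b)"
    by (rule perp_step) (use assms in auto)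
  have dd: "dd_frc r n \<times> b = frc r n \<times> b - 2 *\<^sub>R (frc r (n - 1) \<times> b) + frc r (n - 2) \<times> b"
    "(dd_frc r n \<times> b) \<times> b = (frc r n \<times> b) \<times> b - 2 *\<^sub>R ((frc r (n - 1) \<times> b) \<times> b) + (frc r (n - 2) \<times> b) \<times> b"
    by (simp_all add: dd_frc_def Cross3.left_diff_distrib cross_add_left cross_mult_left)
  show ?thesis (is "?l = ?r")
    unfolding vec_eq_iff
  proof
    fix i
    have "(vel r n \<times> b) $ i - gyr r * (((vel r n \<times> b) \<times> b) $ i) =
      (vel r (n - 1) \<times> b) $ i + gyr r * (((vel r (n - 1) \<times> b) \<times> b) $ i) + 2 * eps r * gyr r * ((frc r n \<times> b) $ i)"
      using arg_cong[OF eq, of "\<lambda>z. z $ i"] by simp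
    from oscillation_identity_real[OF this \<open>gyr r \<noteq> 0\<close>, of "((frc r n \<times> b) \<times> b) $ i" "((frc r (n - 1) \<times> b) \<times> b) $ i"
        "(frc r (n - 1) \<times> b) $ i" "((frc r (n - 2) \<times> b) \<times> b) $ i" "(frc r (n - 2) \<times> b) $ i"]
    show "?l $ i = ?r $ i"
      unfolding oscJ unfolding dd(2) unfolding dd(1) osc_def by simp
  qed
qed

lemma osc_step:
  assumes "good r" "1 \<le> n" "n \<le> fin r"
  shows "norm (osc r n) \<le> norm (osc r (n - 1)) + 2 * eps r * norm (dd_frc r n)"
proof -
  let ?k = "gyr r" and ?y = "dd_frc r n \<times> b"
  have perp: "osc r n \<bullet> b = 0" for n
    by (simp add: osc_def inner_diff_left inner_add_left cross_b_perp)
  have k: "1 / 2 \<le> ?k" by (rule gyr_ge) fact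
  have e: "0 < eps r" using goodD[OF assms(1)] by simp
  let ?p = "(eps r / 2) *\<^sub>R ((?k - 1 / ?k) *\<^sub>R ?y - 2 *\<^sub>R (?y \<times> b))"
  \<comment> \<open>\<open>?y\<close> and \<open>?y \<times> b\<close> are orthogonal and equally
    long, so the norm follows exactly from
    \<open>(k - 1 / k)\<^sup>2 + 4 = (k + 1 / k)\<^sup>2\<close>.\<close>
  have "(norm ((?k - 1 / ?k) *\<^sub>R ?y - 2 *\<^sub>R (?y \<times> b)))\<^sup>2 = (?k - 1 / ?k)\<^sup>2 * (norm ?y)\<^sup>2 + 4 * (norm (?y \<times> b))\<^sup>2"
    unfolding power2_norm_eq_inner
    by (simp add: inner_diff_left inner_diff_right dot_cross_self power2_eq_square)
  also have "(norm (?y \<times> b))\<^sup>2 = (norm ?y)\<^sup>2"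
    using norm_cross_dot[of ?y b] norm_b cross_b_perp[of "dd_frc r n"] by simp
  also have "(?k - 1 / ?k)\<^sup>2 * (norm ?y)\<^sup>2 + 4 * (norm ?y)\<^sup>2 = ((?k + 1 / ?k) * norm ?y)\<^sup>2"
    using k by (simp add: power2_eq_square field_simps)
  finally have "norm ((?k - 1 / ?k) *\<^sub>R ?y - 2 *\<^sub>R (?y \<times> b)) = (?k + 1 / ?k) * norm ?y"
    by (rule power2_eq_imp_eq) (use k in auto)
  then have "norm ?p = eps r / 2 * ((?k + 1 / ?k) * norm ?y)" using e by simp
  also have "\<dots> \<le> eps r / 2 * ((?k + 1 / ?k) * norm (dd_frc r n))"
    using e k norm_cross_b_le by (intro mult_left_mono) auto
  also have "\<dots> = (?k + 1 / ?k) / 4 * (2 * eps r * norm (dd_frc r n))" by simp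
  also have "\<dots> \<le> sqrt (1 + ?k\<^sup>2) * (2 * eps r * norm (dd_frc r n))"
  proof (rule mult_right_mono)
    have "1 / ?k \<le> 2" using k by (simp add: divide_le_eq)
    moreover have "1 \<le> sqrt (1 + ?k\<^sup>2)" by simp
    moreover have "?k \<le> sqrt (1 + ?k\<^sup>2)" using k by (intro le_sqrt_one_plus) simp
    ultimately have "?k + 1 / ?k \<le> 4 * sqrt (1 + ?k\<^sup>2)" by linarith
    then show "(?k + 1 / ?k) / 4 \<le> sqrt (1 + ?k\<^sup>2)" by simp
  qed (use e in auto)
  finally have "\<bar>norm (osc r n) - norm (osc r (n - 1))\<bar> \<le> 2 * eps r * norm (dd_frc r n)"
    using k by (intro norm_cayley[OF osc_cayley[OF assms] perp perp]) auto
  then show ?thesis by linarith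
qed

section \<open>First and second differences of the force along a run\<close>

lemma ubd_stp: "ubd (win a e) (\<lambda>r n. stp r) (\<lambda>r n. stp r)"
  by (rule ubdI[of 1]) (auto simp: win_def goodD less_imp_le)

lemma ubd_field_pos:
  assumes "\<And>r. good r \<Longrightarrow> field_bound 3 (3 * R) L (F r)"
  shows "ubd (win (-1) 1) (\<lambda>r n. F r (pos r n)) (\<lambda>r n. 1)"
proof (rule ubdI[of L])
  fix r n assume w: "win (-1) 1 r n"
  then have "norm (pos r n) \<le> 3 * R" using good_pos[of r n] R_nonneg by (simp add: win_def)
  then show "norm (F r (pos r n)) \<le> L * 1"
    using field_bound_norm[OF assms] w by (simp add: win_def)
qed (rule L_nonneg)

lemma ubd_field_diff:
  assumes "\<And>r. good r \<Longrightarrow> field_bound 3 (3 * R) L (F r)"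
  shows "ubd (win 0 1) (\<lambda>r n. F r (pos r n) - F r (pos r (n - 1))) (\<lambda>r n. stp r)"
proof (rule ubdI[of "L' * U"])
  fix r n assume w: "win 0 1 r n"
  then have g: "good r" and x: "norm (pos r n) \<le> R" "norm (pos r (n - 1)) \<le> R"
    using good_pos[of r n] good_pos[of r "n - 1"] by (auto simp: win_def)
  have "norm (F r (pos r n) - F r (pos r (n - 1))) \<le> L' * norm (pos r n - pos r (n - 1))"
    unfolding L'_def by (rule field_lipschitz[OF assms[OF g] x(2,1)])
  also have "pos r n - pos r (n - 1) = stp r *\<^sub>R vel r (n - 1)"
    using goodD(11)[OF g] by (simp add: vel_def)
  also have "L' * norm (stp r *\<^sub>R vel r (n - 1)) \<le> L' * (stp r * U)"
    using good_vel[OF g, of "n - 1"] w goodD(3)[OF g] L'_nonneg by (auto simp: win_def intro!: mult_left_mono)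
  finally show "norm (F r (pos r n) - F r (pos r (n - 1))) \<le> L' * U * stp r" by (simp add: algebra_simps)
qed (use L'_nonneg U_ge in auto)

text \<open>Expanded about the middle position, the linear terms combine to the derivative in the
  direction of \<open>h\<close> times a velocity increment. At this stage the increment is only
  \<open>O(sp)\<close>, hence \<open>h * sp\<close> rather than \<open>h ^ 2\<close>.\<close>

lemma ubd_field_diff2:
  assumes F: "\<And>r. good r \<Longrightarrow> field_bound 3 (3 * R) L (F r)"
  shows "ubd (win 0 0) (\<lambda>r n. F r (pos r (n + 1)) - 2 *\<^sub>R F r (pos r n) + F r (pos r (n - 1))) (\<lambda>r n. stp r * sp r n)"
proof -
  obtain C where C: "0 \<le> C" "\<And>r n. win 0 0 r n \<Longrightarrow> norm (vel r n - vel r (n - 1)) \<le> C * sp r n"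
    using ubd_dvel by (rule ubdE) blast
  show ?thesis
  proof (rule ubdI[of "2 * L' * U\<^sup>2 + 3 * L * C"])
    fix r n assume w: "win 0 0 r n"
    then have g: "good r" and x: "norm (pos r n) \<le> R" "norm (pos r (n - 1)) \<le> R" "norm (pos r (n + 1)) \<le> R"
      using good_pos[of r n] good_pos[of r "n - 1"] good_pos[of r "n + 1"] by (auto simp: win_def)
    let ?x = "pos r n" and ?D = "dir (F r) (pos r n)"
    note h = goodD(3,11)[OF g]
    have s: "stp r \<le> sp r n" "0 \<le> sp r n" using sp_ge[OF g] sp_pos[OF g, of n] by auto
    have near: "norm (F r y - F r ?x - ?D (y - ?x)) \<le> L' * U\<^sup>2 * (stp r * sp r n)"
      if "norm y \<le> R" "norm (y - ?x) \<le> stp r * U" for y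
    proof -
      have "norm (F r y - F r ?x - ?D (y - ?x)) \<le> L' * (norm (y - ?x))\<^sup>2"
        unfolding L'_def by (rule field_taylor[OF F[OF g] x(1) that(1)])
      also have "\<dots> \<le> L' * (stp r * U)\<^sup>2"
        using that(2) L'_nonneg by (intro mult_left_mono power_mono) auto
      also have "\<dots> = L' * U\<^sup>2 * (stp r * stp r)" by (simp add: power2_eq_square)
      also have "\<dots> \<le> L' * U\<^sup>2 * (stp r * sp r n)"
        using s h L'_nonneg by (intro mult_left_mono) auto
      finally show ?thesis .
    qed
    have d1: "pos r (n + 1) - ?x = stp r *\<^sub>R vel r n" and d2: "pos r (n - 1) - ?x = - (stp r *\<^sub>R vel r (n - 1))"
      using h by (simp_all add: vel_def)
    have "norm (?D (stp r *\<^sub>R (vel r n - vel r (n - 1)))) \<le> 3 * L * norm (stp r *\<^sub>R (vel r n - vel r (n - 1)))"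
      using x(1) R_nonneg by (intro norm_dir_le[OF field_bound_lower[OF F[OF g]]]) auto
    also have "\<dots> \<le> 3 * L * (stp r * (C * sp r n))"
      using C(2)[OF w] h L_nonneg by (auto intro!: mult_left_mono)
    finally have 3: "norm (?D (stp r *\<^sub>R (vel r n - vel r (n - 1)))) \<le> 3 * L * C * (stp r * sp r n)"
      by (simp add: algebra_simps)
    have 1: "norm (F r (pos r (n + 1)) - F r ?x - ?D (pos r (n + 1) - ?x)) \<le> L' * U\<^sup>2 * (stp r * sp r n)"
      using x good_vel[OF g, of n] w h by (intro near) (auto simp: d1 win_def)
    have 2: "norm (F r (pos r (n - 1)) - F r ?x - ?D (pos r (n - 1) - ?x)) \<le> L' * U\<^sup>2 * (stp r * sp r n)"
      using x good_vel[OF g, of "n - 1"] w h by (intro near) (auto simp: d2 win_def)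
    have sumD: "?D (stp r *\<^sub>R (vel r n - vel r (n - 1))) = ?D (pos r (n + 1) - ?x) + ?D (pos r (n - 1) - ?x)"
      by (simp add: d1 d2 dir_add[symmetric] scaleR_diff_right)
    have eq: "F r (pos r (n + 1)) - 2 *\<^sub>R F r ?x + F r (pos r (n - 1)) =
        (F r (pos r (n + 1)) - F r ?x - ?D (pos r (n + 1) - ?x)) + (F r (pos r (n - 1)) - F r ?x - ?D (pos r (n - 1) - ?x))
        + ?D (stp r *\<^sub>R (vel r n - vel r (n - 1)))"
      unfolding sumD by (simp add: vec_eq_iff)
    show "norm (F r (pos r (n + 1)) - 2 *\<^sub>R F r (pos r n) + F r (pos r (n - 1)))
        \<le> (2 * L' * U\<^sup>2 + 3 * L * C) * (stp r * sp r n)"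
      unfolding eq
      by (rule order_trans[OF norm_triangle_le[OF add_mono[OF norm_triangle_le[OF add_mono[OF 1 2]] 3]]])
         (simp_all add: algebra_simps)
  qed (use C L_nonneg L'_nonneg in auto)
qed

text \<open>\<open>bet\<close> is a sum of fixed linear maps applied to the partial derivatives of
  the potential; naming these maps lets bounds for fields along the run carry over to
  \<open>bet\<close>.\<close>

definition bfun :: "3 \<Rightarrow> real^3 \<Rightarrow> real^3" where
  "bfun i y = (y \<bullet> b) *\<^sub>R axis i 1 - (b $ i) *\<^sub>R y"

lemma bet_sum: "bet r n = (\<Sum>i\<in>UNIV. bfun i (partial i (pot r) (pos r n)))"
  by (simp add: bet_def tdir_def dir_def bfun_def sum_subtractf)

lemma bfun_diff: "bfun i (y - z) = bfun i y - bfun i z"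
  and bfun_add: "bfun i (y + z) = bfun i y + bfun i z"
  and bfun_scaleR: "bfun i (k *\<^sub>R y) = k *\<^sub>R bfun i y"
  by (simp_all add: bfun_def inner_diff_left inner_add_left algebra_simps)

lemma norm_bfun_le: "norm (bfun i y) \<le> 2 * norm y"
proof -
  have "norm (bfun i y) \<le> \<bar>y \<bullet> b\<bar> * norm (axis i 1 :: real^3) + \<bar>b $ i\<bar> * norm y"
    unfolding bfun_def by (rule order_trans[OF norm_triangle_ineq4]) simp
  also have "\<dots> \<le> norm y * 1 + 1 * norm y"
    using abs_inner_b_le[of y] component_le_norm_cart[of b i] norm_b
    by (intro add_mono mult_mono) auto
  finally show ?thesis by simp
qed

lemma ubd_bfun: "ubd S f g \<Longrightarrow> ubd S (\<lambda>r n. bfun i (f r n)) g"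
  by (rule ubd_dom[of S f g 2]) (auto simp: norm_bfun_le)

lemma nn_stp: "win a e r n \<Longrightarrow> 0 \<le> stp r" and nn_sp: "win a e r n \<Longrightarrow> 0 \<le> sp r n"
  and nn_stp_sp: "win a e r n \<Longrightarrow> 0 \<le> stp r * sp r m"
  using goodD(3)[of r] sp_pos[of r] by (auto simp: win_def less_imp_le intro!: mult_nonneg_nonneg)

lemma ubd_bet: "ubd (win (-1) 1) bet (\<lambda>r n. 1)"
  unfolding bet_sum[abs_def] by (intro ubd_sum ubd_bfun ubd_field_pos goodD_field3) auto

lemma ubd_dbet: "ubd (win 0 1) (\<lambda>r n. bet r n - bet r (n - 1)) (\<lambda>r n. stp r)"
  unfolding bet_sum sum_subtractf[symmetric] bfun_diff[symmetric]
  by (intro ubd_sum ubd_bfun ubd_field_diff goodD_field3) (auto intro: nn_stp)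

lemma ubd_ddbet: "ubd (win 0 0) (\<lambda>r n. bet r (n + 1) - 2 *\<^sub>R bet r n + bet r (n - 1)) (\<lambda>r n. stp r * sp r n)"
  unfolding bet_sum scaleR_sum_right bfun_scaleR[symmetric] sum_subtractf[symmetric] sum.distrib[symmetric]
    bfun_diff[symmetric] bfun_add[symmetric]
  by (intro ubd_sum ubd_bfun ubd_field_diff2 goodD_field3) (auto intro: nn_stp_sp)

text \<open>Covers \<open>sp\<close> at the steps \<open>n\<close>, \<open>n - 1\<close> and
  \<open>n - 2\<close>, all of which enter a second difference of the force.\<close>

definition psi :: "run \<Rightarrow> int \<Rightarrow> real" where
  "psi r n = stp r + norm (vel r n \<times> b) + norm (vel r (n - 1) \<times> b) + norm (vel r (n - 2) \<times> b) + norm (vel r (n - 3) \<times> b)"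

lemma sp_le_psi: "sp r n \<le> psi r n" "sp r (n - 1) \<le> psi r n" "sp r (n - 2) \<le> psi r n"
  by (simp_all add: sp_def psi_def)

lemma stp_le_psi: "stp r \<le> psi r n"
  by (simp add: psi_def)

lemma ubd_stp_psi:
  assumes "ubd (win a e) f (\<lambda>r n. stp r * sp r n)" "a \<le> a' + k" "e' + k \<le> e" "k \<in> {0, -1, -2}"
  shows "ubd (win a' e') (\<lambda>r n. f r (n + k)) (\<lambda>r n. stp r * psi r n)"
proof (rule ubd_le[OF ubd_shift[OF assms(1-3)]])
  fix r n assume "win a' e' r n"
  then show "stp r * sp r (n + k) \<le> stp r * psi r n"
    using assms(4) sp_le_psi[of r n] by (intro mult_left_mono nn_stp) auto
qed

lemma ubd_dmvel_b: "ubd (win 1 0) (\<lambda>r n. mvel r n \<bullet> b - mvel r (n - 1) \<bullet> b) (\<lambda>r n. stp r)"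
proof -
  have "ubd (win 1 0) (\<lambda>r n. stp r *\<^sub>R ((1/2) *\<^sub>R (frc r n \<bullet> b + frc r (n - 1) \<bullet> b))) (\<lambda>r n. stp r)"
    using ubd_sub[OF ubd_frc, of 1 0] ubd_shift[OF ubd_frc, of 1 "-1" 0]
    by (intro ubd_scaleR_one ubd_stp ubd_const_scaleR ubd_add ubd_inner_const) auto
  then show ?thesis
  proof (rule ubd_cong)
    fix r n assume "win 1 0 r n"
    then show "mvel r n \<bullet> b - mvel r (n - 1) \<bullet> b = stp r *\<^sub>R ((1/2) *\<^sub>R (frc r n \<bullet> b + frc r (n - 1) \<bullet> b))"
      using parallel_step[of r n] parallel_step[of r "n - 1"]
      by (simp add: win_def mvel_def inner_diff_left inner_add_left algebra_simps)
  qed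
qed

text \<open>Averaging makes the second difference telescope to \<open>h / 2\<close> times the
  parallel force at \<open>n\<close> minus that at \<open>n - 2\<close>. There \<open>bet\<close>
  drops out, the electric field changes by \<open>O(h)\<close>, and \<open>rem\<close> is small by
  itself.\<close>

lemma ubd_ddmvel_b:
  "ubd (win 2 0) (\<lambda>r n. mvel r n \<bullet> b - 2 * (mvel r (n - 1) \<bullet> b) + mvel r (n - 2) \<bullet> b) (\<lambda>r n. stp r * psi r n)"
proof -
  have "ubd (win 2 0) (\<lambda>r n. ele r (pos r n) - ele r (pos r (n - 1))) (\<lambda>r n. stp r)"
    using ubd_shift[OF ubd_field_diff[of ele], of 2 0 0] by (simp add: goodD_field3)
  moreover have "ubd (win 2 0) (\<lambda>r n. ele r (pos r (n - 1)) - ele r (pos r (n - 2))) (\<lambda>r n. stp r)"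
    using ubd_shift[OF ubd_field_diff[of ele], of 2 "-1" 0] by (simp add: goodD_field3)
  ultimately have "ubd (win 2 0) (\<lambda>r n. (ele r (pos r n) - ele r (pos r (n - 1))) + (ele r (pos r (n - 1)) - ele r (pos r (n - 2)))) (\<lambda>r n. stp r)"
    by (rule ubd_add)
  then have E: "ubd (win 2 0) (\<lambda>r n. (ele r (pos r n) - ele r (pos r (n - 1))) + (ele r (pos r (n - 1)) - ele r (pos r (n - 2)))) psi"
    by (rule ubd_le) (rule stp_le_psi)
  have rem: "ubd (win 2 0) (\<lambda>r n. rem r n - rem r (n - 2)) (\<lambda>r n. stp r * psi r n)"
    using ubd_stp_psi[OF ubd_rem, of 2 0 0] ubd_stp_psi[OF ubd_rem, of 2 "-2" 0]
    by (intro ubd_diff) auto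
  have "ubd (win 2 0) (\<lambda>r n. rem r n - rem r (n - 2)) psi"
  proof (rule ubd_le[OF rem])
    fix r n assume "win 2 0 r n"
    then show "stp r * psi r n \<le> psi r n"
      using goodD(3,4)[of r] order_trans[OF less_imp_le stp_le_psi[of r n], of 0] by (auto simp: win_def mult_left_le_one_le)
  qed
  then have "ubd (win 2 0) (\<lambda>r n. stp r *\<^sub>R ((1/2) *\<^sub>R
      (((ele r (pos r n) - ele r (pos r (n - 1))) + (ele r (pos r (n - 1)) - ele r (pos r (n - 2)))) \<bullet> b
       + (rem r n - rem r (n - 2)) \<bullet> b))) (\<lambda>r n. stp r * psi r n)"
    by (intro ubd_scaleR ubd_stp ubd_const_scaleR ubd_add ubd_inner_const E)
  then show ?thesis
  proof (rule ubd_cong)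
    fix r n assume "win 2 0 r n"
    then have "good r" "2 \<le> n" "n \<le> fin r" by (auto simp: win_def)
    then have "vel r n \<bullet> b - vel r (n - 1) \<bullet> b = stp r * (frc r n \<bullet> b)"
      "vel r (n - 1) \<bullet> b - vel r (n - 2) \<bullet> b = stp r * (frc r (n - 1) \<bullet> b)"
      "vel r (n - 2) \<bullet> b - vel r (n - 3) \<bullet> b = stp r * (frc r (n - 2) \<bullet> b)"
      using parallel_step[of r n] parallel_step[of r "n - 1"] parallel_step[of r "n - 2"]
      by (simp_all add: inner_diff_left)
    then have "mvel r n \<bullet> b - 2 * (mvel r (n - 1) \<bullet> b) + mvel r (n - 2) \<bullet> b = stp r * ((frc r n \<bullet> b - frc r (n - 2) \<bullet> b) / 2)"
      by (simp add: mvel_def inner_add_left field_simps)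
    then show "mvel r n \<bullet> b - 2 * (mvel r (n - 1) \<bullet> b) + mvel r (n - 2) \<bullet> b = stp r *\<^sub>R ((1/2) *\<^sub>R
      (((ele r (pos r n) - ele r (pos r (n - 1))) + (ele r (pos r (n - 1)) - ele r (pos r (n - 2)))) \<bullet> b
       + (rem r n - rem r (n - 2)) \<bullet> b))"
      by (simp add: frc_inner_b inner_diff_left inner_add_left algebra_simps)
  qed
qed

lemma ubd_dd_frc: "ubd (win 2 0) dd_frc (\<lambda>r n. stp r * psi r n)"
proof -
  define q where "q r n = mvel r n \<bullet> b" for r n
  have q1: "ubd (win 2 0) (\<lambda>r n. q r (n - 1) - q r (n - 2)) (\<lambda>r n. stp r)"
    using ubd_shift[OF ubd_dmvel_b, of 2 "-1" 0] by (simp add: q_def)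
  have q0: "ubd (win 2 0) (\<lambda>r n. q r (n - 2)) (\<lambda>r n. 1)"
    unfolding q_def using ubd_shift[OF ubd_mvel, of 2 "-2" 0] by (intro ubd_inner_const) auto
  have q2: "ubd (win 2 0) (\<lambda>r n. q r n - 2 * q r (n - 1) + q r (n - 2)) (\<lambda>r n. stp r * psi r n)"
    unfolding q_def by (rule ubd_ddmvel_b)
  have b2: "ubd (win 2 0) (\<lambda>r n. bet r n - 2 *\<^sub>R bet r (n - 1) + bet r (n - 2)) (\<lambda>r n. stp r * psi r n)"
    using ubd_stp_psi[OF ubd_ddbet, of 2 "-1" 0] by simp
  have E2: "ubd (win 2 0) (\<lambda>r n. ele r (pos r n) - 2 *\<^sub>R ele r (pos r (n - 1)) + ele r (pos r (n - 2))) (\<lambda>r n. stp r * psi r n)"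
    using ubd_stp_psi[OF ubd_field_diff2[of ele], of 2 "-1" 0] by (simp add: goodD_field3)
  have R2: "ubd (win 2 0) (\<lambda>r n. rem r n - 2 *\<^sub>R rem r (n - 1) + rem r (n - 2)) (\<lambda>r n. stp r * psi r n)"
    using ubd_stp_psi[OF ubd_rem, of 2 0 0] ubd_stp_psi[OF ubd_rem, of 2 "-1" 0] ubd_stp_psi[OF ubd_rem, of 2 "-2" 0]
    by (intro ubd_add ubd_diff ubd_const_scaleR) auto
  have "ubd (win 2 0) (\<lambda>r n. 2 *\<^sub>R ((q r (n - 1) - q r (n - 2)) *\<^sub>R (bet r n - bet r (n - 1)))) (\<lambda>r n. stp r * stp r)"
    using ubd_sub[OF ubd_dbet, of 2 0] by (intro ubd_const_scaleR ubd_scaleR q1) auto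
  then have cross: "ubd (win 2 0) (\<lambda>r n. 2 *\<^sub>R ((q r (n - 1) - q r (n - 2)) *\<^sub>R (bet r n - bet r (n - 1)))) (\<lambda>r n. stp r * psi r n)"
    by (rule ubd_le) (auto intro!: mult_left_mono stp_le_psi intro: nn_stp)
  \<comment> \<open>Discrete Leibniz rule for the product of the parallel velocity \<open>q\<close>
    and \<open>bet\<close>, plus the contributions of \<open>ele\<close> and
    \<open>rem\<close>.\<close>
  have "ubd (win 2 0) (\<lambda>r n. (q r n - 2 * q r (n - 1) + q r (n - 2)) *\<^sub>R bet r n
      + 2 *\<^sub>R ((q r (n - 1) - q r (n - 2)) *\<^sub>R (bet r n - bet r (n - 1)))
      + q r (n - 2) *\<^sub>R (bet r n - 2 *\<^sub>R bet r (n - 1) + bet r (n - 2))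
      + (ele r (pos r n) - 2 *\<^sub>R ele r (pos r (n - 1)) + ele r (pos r (n - 2)))
      + (rem r n - 2 *\<^sub>R rem r (n - 1) + rem r (n - 2))) (\<lambda>r n. stp r * psi r n)"
    using ubd_sub[OF ubd_bet, of 2 0]
    by (intro ubd_add R2 E2 cross ubd_scaleR_one[OF q2] ubd_one_scaleR[OF q0 b2]) auto
  then show ?thesis
  proof (rule ubd_cong)
    fix r n
    have "frc r m = q r m *\<^sub>R bet r m + ele r (pos r m) + rem r m" for m
      by (simp add: rem_def q_def)
    then show "dd_frc r n = (q r n - 2 * q r (n - 1) + q r (n - 2)) *\<^sub>R bet r n
      + 2 *\<^sub>R ((q r (n - 1) - q r (n - 2)) *\<^sub>R (bet r n - bet r (n - 1)))
      + q r (n - 2) *\<^sub>R (bet r n - 2 *\<^sub>R bet r (n - 1) + bet r (n - 2))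
      + (ele r (pos r n) - 2 *\<^sub>R ele r (pos r (n - 1)) + ele r (pos r (n - 2)))
      + (rem r n - 2 *\<^sub>R rem r (n - 1) + rem r (n - 2))"
      unfolding dd_frc_def by (simp add: vec_eq_iff algebra_simps)
  qed
qed

text \<open>A Gronwall argument for \<open>osc\<close>, which differs from the perpendicular
  velocity by \<open>O(eps)\<close>. The forcing of a step is of size \<open>eps * h * psi\<close>,
  and \<open>psi\<close> contains perpendicular velocities again; so \<open>h\<close> plus the norm
  of \<open>osc\<close> grows by a factor of at most \<open>1 + Q * (eps * h)\<close> per step, and
  by at most \<open>exp (Q * c)\<close> in all.\<close>

lemma ubd_perp: "ubd (win (-1) 0) (\<lambda>r n. vel r n \<times> b) (\<lambda>r n. stp r)"
proof -
  obtain G where G: "0 \<le> G" "\<And>r n. win 0 0 r n \<Longrightarrow> norm (frc r n) \<le> G"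
    using ubd_frc by (rule ubdE) auto
  obtain D where D: "0 \<le> D" "\<And>r n. win 2 0 r n \<Longrightarrow> norm (dd_frc r n) \<le> D * (stp r * psi r n)"
    using ubd_dd_frc by (rule ubdE) blast
  define Q where "Q = 2 * D * (5 + 24 * G)"
  define C where "C = exp (Q * c) * (U + 8 * G + 1) + 4 * G + (U + 2 * G)"
  have Q: "0 \<le> Q" using G(1) D(1) by (simp add: Q_def)
  have C: "0 \<le> C" "exp (Q * c) * (U + 8 * G + 1) + 4 * G \<le> C" "U + 2 * G \<le> C" "U \<le> C"
    using G(1) U_ge by (simp_all add: C_def)
  show ?thesis
  proof (rule ubdI[OF C(1)])
    fix r n assume "win (-1) 0 r n"
    then have g: "good r" and n: "-1 \<le> n" "n \<le> fin r" by (auto simp: win_def)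
    note h = goodD(1,3,15)[OF g]
    define w where "w m = norm (vel r m \<times> b)" for m
    define o' where "o' m = norm (osc r m)" for m
    have eG: "eps r * G \<le> G * stp r" "0 \<le> eps r * G" using h G(1) by (simp_all add: mult.commute[of G] mult_right_mono)
    have F: "norm (frc r m) \<le> G" if "0 \<le> m" "m \<le> fin r" for m
      using G(2)[of r m] g that by (simp add: win_def)
    have ws: "\<bar>w m - w (m - 1)\<bar> \<le> 2 * (eps r * G)" if "0 \<le> m" "m \<le> fin r" for m
    proof -
      have "eps r * norm (frc r m) \<le> eps r * G" using F[OF that] h by (intro mult_left_mono) auto
      with perp_norm_step[OF g that] show ?thesis by (simp add: w_def)
    qed
    have wo: "\<bar>o' m - w m\<bar> \<le> 4 * (eps r * G)" if "1 \<le> m" "m \<le> fin r" for m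
    proof -
      let ?y = "frc r m \<times> b" and ?z = "frc r (m - 1) \<times> b"
      have y: "norm ?y \<le> G" "norm ?z \<le> G" "norm (?y \<times> b) \<le> G" "norm (?z \<times> b) \<le> G"
        using F[of m] F[of "m - 1"] that norm_cross_b_le[of "frc r m"] norm_cross_b_le[of "frc r (m - 1)"]
          norm_cross_b_le[of ?y] norm_cross_b_le[of ?z] by auto
      have "norm ((1 / gyr r) *\<^sub>R (?y - ?z)) \<le> 2 * (2 * G)"
      proof -
        have "norm (?y - ?z) \<le> 2 * G" using norm_triangle_ineq4[of ?y ?z] y by linarith
        moreover have "1 / gyr r \<le> 2" "0 \<le> 1 / gyr r" using gyr_ge[OF g] by (simp_all add: divide_le_eq)
        ultimately show ?thesis by (simp only: norm_scaleR abs_of_nonneg) (intro mult_mono, auto)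
      qed
      moreover have "norm (?y \<times> b - ?z \<times> b) \<le> 2 * G"
        using norm_triangle_ineq4[of "?y \<times> b" "?z \<times> b"] y by linarith
      ultimately have "norm ((?y \<times> b - ?z \<times> b) + (1 / gyr r) *\<^sub>R (?y - ?z)) \<le> 6 * G"
        using norm_triangle_ineq[of "?y \<times> b - ?z \<times> b" "(1 / gyr r) *\<^sub>R (?y - ?z)"] by linarith
      then have 1: "norm ((eps r / 2) *\<^sub>R ((?y \<times> b - ?z \<times> b) + (1 / gyr r) *\<^sub>R (?y - ?z))) \<le> eps r / 2 * (6 * G)"
        using h by (simp only: norm_scaleR) (intro mult_mono, auto)
      have 2: "norm (eps r *\<^sub>R (?y \<times> b)) \<le> eps r * G" using y h by (simp add: mult_left_mono)
      have "vel r m \<times> b - osc r m = eps r *\<^sub>R (?y \<times> b) + (eps r / 2) *\<^sub>R ((?y \<times> b - ?z \<times> b) + (1 / gyr r) *\<^sub>R (?y - ?z))"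
        by (simp add: osc_def)
      then have "norm (vel r m \<times> b - osc r m) \<le> 4 * (eps r * G)"
        using norm_triangle_le[OF add_mono[OF 2 1]] by (simp add: mult.commute[of G])
      then show ?thesis
        using norm_triangle_ineq3[of "vel r m \<times> b" "osc r m"] by (simp add: w_def o'_def)
    qed
    have growth: "o' m + stp r \<le> (1 + Q * (eps r * stp r)) * (o' (m - 1) + stp r)" if "2 \<le> m" "m \<le> fin r" for m
    proof -
      \<comment> \<open>All four velocities in \<open>psi\<close> are referred to step
        \<open>m - 1\<close>. By the crude bound \<open>ws\<close> they exceed it by at most 2, 0, 2
        and 4 times \<open>eps * G\<close>, in total 8.\<close>
      have "psi r m \<le> stp r + 4 * w (m - 1) + 8 * (eps r * G)"
        using ws[of m] ws[of "m - 1"] ws[of "m - 2"] that by (simp add: psi_def w_def)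
      also have "\<dots> \<le> 4 * o' (m - 1) + (1 + 24 * G) * stp r"
        using wo[of "m - 1"] that eG by (simp add: distrib_right)
      also have "\<dots> \<le> (5 + 24 * G) * (o' (m - 1) + stp r)"
        using G(1) h mult_nonneg_nonneg[of G "o' (m - 1)"] by (simp add: algebra_simps o'_def)
      finally have psi: "psi r m \<le> (5 + 24 * G) * (o' (m - 1) + stp r)" .
      have "o' m \<le> o' (m - 1) + 2 * eps r * norm (dd_frc r m)"
        unfolding o'_def by (rule osc_step[OF g]) (use that in auto)
      also have "norm (dd_frc r m) \<le> D * (stp r * psi r m)" using D(2)[of r m] that g by (simp add: win_def)
      also have "D * (stp r * psi r m) \<le> D * (stp r * ((5 + 24 * G) * (o' (m - 1) + stp r)))"
        using psi D(1) h by (intro mult_left_mono) auto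
      finally show ?thesis using h by (simp add: Q_def algebra_simps)
    qed
    have iter: "o' (1 + int k) + stp r \<le> (1 + Q * (eps r * stp r)) ^ k * (o' 1 + stp r)" if "1 + int k \<le> fin r" for k
      using that
    proof (induction k)
      case (Suc k)
      have "o' (1 + int (Suc k)) + stp r \<le> (1 + Q * (eps r * stp r)) * (o' (1 + int k) + stp r)"
        using growth[of "1 + int (Suc k)"] Suc.prems by simp
      also have "\<dots> \<le> (1 + Q * (eps r * stp r)) * ((1 + Q * (eps r * stp r)) ^ k * (o' 1 + stp r))"
        using Suc Q h by (intro mult_left_mono) auto
      finally show ?case by simp
    qed simp
    have w0: "w (-1) \<le> U * stp r" unfolding w_def by (rule goodD(14)[OF g])
    consider "n = -1" | "n = 0" | "1 \<le> n" using n by linarith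
    then have "w n \<le> C * stp r"
    proof cases
      case 1
      have "U * stp r \<le> C * stp r" using C(4) h by (intro mult_right_mono) auto
      then show ?thesis using w0 1 by simp
    next
      case 2
      then have "w n \<le> (U + 2 * G) * stp r"
        using ws[of 0] n w0 eG by (simp add: distrib_right)
      also have "\<dots> \<le> C * stp r" using C(3) h by (intro mult_right_mono) auto
      finally show ?thesis .
    next
      case 3
      define k where "k = nat (n - 1)"
      have k: "n = 1 + int k" using 3 by (simp add: k_def)
      have "(1 + Q * (eps r * stp r)) ^ k \<le> exp (Q * (eps r * stp r)) ^ k"
        using Q h by (intro power_mono) auto
      also have "\<dots> = exp (real k * (Q * (eps r * stp r)))" by (simp add: exp_of_nat_mult)
      also have "\<dots> \<le> exp (Q * c)"
      proof -
        have "real k * stp r \<le> real_of_int (fin r) * stp r"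
          using k n h by (intro mult_right_mono) auto
        also have "\<dots> \<le> c / eps r" by (rule goodD(13)[OF g])
        finally have "eps r * (real k * stp r) \<le> c" using h by (simp add: field_simps)
        from mult_left_mono[OF this Q] show ?thesis by (simp add: algebra_simps)
      qed
      finally have E: "(1 + Q * (eps r * stp r)) ^ k \<le> exp (Q * c)" .
      have "w 1 \<le> U * stp r + 4 * (eps r * G)"
        using ws[of 0] ws[of 1] w0 3 n by simp
      then have o1: "o' 1 + stp r \<le> (U + 8 * G + 1) * stp r"
        using wo[of 1] 3 n eG by (simp add: distrib_right)
      have "o' n + stp r \<le> exp (Q * c) * ((U + 8 * G + 1) * stp r)"
        using iter[of k] n k mult_mono[OF E o1] h by (simp add: o'_def)
      moreover have "w n \<le> o' n + 4 * (G * stp r)" using wo[of n] 3 n eG by simp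
      ultimately have "w n \<le> (exp (Q * c) * (U + 8 * G + 1) + 4 * G) * stp r"
        using h by (simp add: algebra_simps)
      also have "\<dots> \<le> C * stp r" using C(2) h by (intro mult_right_mono) auto
      finally show ?thesis .
    qed
    then show "norm (vel r n \<times> b) \<le> C * stp r" by (simp add: w_def)
  qed
qed

section \<open>Estimates with the gyration known to be of size \<open>h\<close>\<close>

lemma sp_le_stp: obtains C where "0 \<le> C" "\<And>r n. win 0 0 r n \<Longrightarrow> sp r n \<le> C * stp r"
proof -
  obtain C where C: "0 \<le> C" "\<And>r n. win (-1) 0 r n \<Longrightarrow> norm (vel r n \<times> b) \<le> C * stp r"
    using ubd_perp by (rule ubdE) blast
  have "sp r n \<le> (2 * C + 1) * stp r" if "win 0 0 r n" for r n
    using C(2)[of r n] C(2)[of r "n - 1"] that by (simp add: sp_def win_def algebra_simps)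
  then show thesis using C(1) by (intro that[of "2 * C + 1"]) auto
qed

lemma ubd_from_sp:
  assumes "ubd (win 0 0) f (\<lambda>r n. k r n * sp r n)" "\<And>r n. win 0 0 r n \<Longrightarrow> 0 \<le> k r n"
  shows "ubd (win 0 0) f (\<lambda>r n. k r n * stp r)"
proof -
  obtain C where C: "0 \<le> C" "\<And>r n. win 0 0 r n \<Longrightarrow> sp r n \<le> C * stp r" using sp_le_stp by blast
  show ?thesis
  proof (rule ubd_mono[OF assms(1) C(1)])
    fix r n assume "win 0 0 r n"
    with C(2)[OF this] assms(2)[OF this] show "k r n * sp r n \<le> C * (k r n * stp r)"
      by (metis mult.left_commute mult_left_mono)
  qed
qed

lemma ubd_dvel': "ubd (win 0 0) (\<lambda>r n. vel r n - vel r (n - 1)) (\<lambda>r n. stp r)"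
  using ubd_from_sp[of _ "\<lambda>r n. 1"] ubd_dvel by simp

text \<open>\<open>eps / h\<close> times a gyration of size \<open>h\<close>. The magnetic moment is
  governed by this bound.\<close>

lemma ubd_mvel_perp: "ubd (win 0 0) (\<lambda>r n. mvel r n \<times> b) (\<lambda>r n. eps r)"
proof (rule ubd_le[OF ubd_from_sp[OF ubd_mvel_cross]])
  fix r n assume "win 0 0 r n"
  then show "0 \<le> eps r / stp r" "eps r / stp r * stp r \<le> eps r"
    using goodD[of r] by (auto simp: win_def)
qed

lemma ubd_dpot_dir': "ubd (win 0 0) (\<lambda>r n. dpot r n - dir (pot r) (pos r n) (mvel r n)) (\<lambda>r n. (stp r)\<^sup>2)"
  using ubd_from_sp[OF ubd_dpot_dir] nn_stp by (auto simp: power2_eq_square)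

text \<open>Force differences of order \<open>k\<close> need positions up to order
  \<open>k + 1\<close>, because \<open>mvel\<close> and \<open>dpot\<close> divide a stride-two
  difference by \<open>h\<close>. The fields are sampled along Newton interpolants, so that their
  differences follow from derivative bounds.\<close>

lemma diff2_frc_bound:
  assumes C: "0 \<le> C"
    and pos: "\<And>r n j. good r \<Longrightarrow> j \<le> Suc k \<Longrightarrow> -1 \<le> n \<Longrightarrow> n + 2 * int j \<le> fin r + 1 \<Longrightarrow>
      norm ((diff2 ^^ j) (pos r) n) \<le> C * stp r ^ j"
  shows "\<exists>C'\<ge>0. \<forall>r n. good r \<longrightarrow> 0 \<le> n \<longrightarrow> n + 2 * int k \<le> fin r \<longrightarrow>
    norm ((diff2 ^^ k) (frc r) n) \<le> C' * stp r ^ k"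
proof -
  define CT where "CT = (\<Sum>i\<in>(UNIV::3 set). 2 ^ k * along_const (\<lambda>l. M (Suc l)) k k C * (newton_const k k * C))"
  define CA where "CA = along_const M (Suc k) (Suc k) C"
  define CE where "CE = along_const M k k C"
  have nn: "0 \<le> CT" "0 \<le> CA" "0 \<le> CE"
    using C by (auto simp: CT_def CA_def CE_def along_const_nonneg newton_const_nonneg)
  have main: "norm ((diff2 ^^ k) (frc r) n) \<le> (CT + CA + CE) * stp r ^ k"
    if g: "good r" and n: "0 \<le> n" "n + 2 * int k \<le> fin r" for r n
  proof -
    note h = goodD(3,4,11)[OF g]
    note smooth = goodD(5-8)[OF g]
    have x: "norm ((diff2 ^^ j) (pos r) n) \<le> C * stp r ^ j" if "j \<le> k" for j
      using that n by (intro pos[OF g]) auto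
    have x': "norm ((diff2 ^^ j) (pos r) (n - 1)) \<le> C * stp r ^ j" if "j \<le> Suc k" for j
      using that n by (intro pos[OF g]) auto
    have mv: "mvel r = (\<lambda>m. (1 / (2 * stp r)) *\<^sub>R diff2 (pos r) (m + (-1)))"
      by (rule ext) (simp add: mvel_def vel_def diff2_def vec_eq_iff field_simps)
    have v: "norm ((diff2 ^^ j) (mvel r) n) \<le> C * stp r ^ j" if "j \<le> k" for j
    proof -
      have "(diff2 ^^ j) (mvel r) n = (1 / (2 * stp r)) *\<^sub>R (diff2 ^^ Suc j) (pos r) (n - 1)"
        unfolding mv diff2_shift_scale diff2_power_Suc by simp
      then have "norm ((diff2 ^^ j) (mvel r) n) = (1 / (2 * stp r)) * norm ((diff2 ^^ Suc j) (pos r) (n - 1))"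
        using h by (simp del: funpow.simps)
      also have "\<dots> \<le> (1 / (2 * stp r)) * (C * stp r ^ Suc j)"
        using x'[of "Suc j"] that h by (intro mult_left_mono) auto
      also have "\<dots> = C * stp r ^ j / 2" using h by (simp add: field_simps)
      also have "\<dots> \<le> C * stp r ^ j" using C h by simp
      finally show ?thesis .
    qed
    define T where "T s = (\<Sum>i\<in>UNIV. (partial i (pot r) (newton_poly k (pos r) n s) \<bullet> newton_poly k (mvel r) n s) *\<^sub>R (axis i 1 :: real^3))" for s
    have "dbound k {0..real k} (stp r) CT T"
    proof -
      have "dbound k {0..real k} (stp r) (norm (axis i 1 :: real^3) * (2 ^ k * along_const (\<lambda>l. M (Suc l)) k k C * (newton_const k k * C)))
          (\<lambda>s. (partial i (pot r) (newton_poly k (pos r) n s) \<bullet> newton_poly k (mvel r) n s) *\<^sub>R (axis i 1 :: real^3))" for i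
        using h C x v
        by (intro dbound_scaleR_const dbound_inner dbound_field_newton[OF partial_smooth[OF smooth(1,3)]] dbound_newton_poly
            along_const_nonneg mult_nonneg_nonneg newton_const_nonneg) auto
      then show ?thesis
        unfolding T_def[abs_def] CT_def using h by (intro dbound_sum) auto
    qed
    then have 1: "norm ((diff2 ^^ k) (\<lambda>m. tdir (pot r) (pos r m) (mvel r m)) n) \<le> CT * stp r ^ k"
      by (rule norm_diff2_power_samples[rotated]) (simp add: T_def tdir_def newton_poly_node)
    have "norm ((diff2 ^^ Suc k) (\<lambda>m. pot r (pos r m)) (n - 1)) \<le> CA * stp r ^ Suc k"
      unfolding CA_def
      by (rule norm_diff2_power_samples[where F = "\<lambda>s. pot r (newton_poly (Suc k) (pos r) (n - 1) s)"])
         (use dbound_field_newton[where m = "Suc k", OF smooth(1,3) x' h(1,2)] in \<open>simp_all add: newton_poly_node del: funpow.simps dbound.simps of_nat_Suc\<close>)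
    moreover have "(diff2 ^^ k) (dpot r) n = (1 / (2 * stp r)) *\<^sub>R (diff2 ^^ Suc k) (\<lambda>m. pot r (pos r m)) (n - 1)"
    proof -
      have "dpot r = (\<lambda>m. (1 / (2 * stp r)) *\<^sub>R diff2 (\<lambda>m. pot r (pos r m)) (m + (-1)))"
        by (rule ext) (simp add: dpot_def diff2_def add.commute[of 1])
      then show ?thesis unfolding diff2_power_Suc by (simp only: diff2_shift_scale) simp
    qed
    ultimately have "norm ((diff2 ^^ k) (dpot r) n) \<le> (1 / (2 * stp r)) * (CA * stp r ^ Suc k)"
      using h mult_left_mono[of "norm ((diff2 ^^ Suc k) (\<lambda>m. pot r (pos r m)) (n - 1))" _ "1 / (2 * stp r)"]
      by (simp del: funpow.simps power_Suc)
    also have "\<dots> = CA * stp r ^ k / 2" using h by (simp add: field_simps)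
    also have "\<dots> \<le> CA * stp r ^ k" using nn h by simp
    finally have 2: "norm ((diff2 ^^ k) (dpot r) n) \<le> CA * stp r ^ k" .
    have 3: "norm ((diff2 ^^ k) (\<lambda>m. ele r (pos r m)) n) \<le> CE * stp r ^ k"
      unfolding CE_def
      by (rule norm_diff2_power_samples[where F = "\<lambda>s. ele r (newton_poly k (pos r) n s)"])
         (use dbound_field_newton[where m = k, OF smooth(2,4) x h(1,2)] in \<open>simp_all add: newton_poly_node\<close>)
    have "(diff2 ^^ k) (frc r) n = (diff2 ^^ k) (\<lambda>m. tdir (pot r) (pos r m) (mvel r m)) n - (diff2 ^^ k) (dpot r) n
        + (diff2 ^^ k) (\<lambda>m. ele r (pos r m)) n"
      unfolding frc_def[abs_def] by (simp only: diff2_add diff2_minus)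
    then show ?thesis
      using norm_triangle_le[OF add_mono[OF order_trans[OF norm_triangle_ineq4 add_mono[OF 1 2]] 3]]
      by (simp add: distrib_right)
  qed
  have "0 \<le> CT + CA + CE" using nn by simp
  with main show ?thesis by blast
qed

text \<open>The gyration contributes a factor close to \<open>-1\<close> per step, so positions vary smoothly with the
  step number only along even and along odd step numbers; hence the stride two.\<close>

lemma diff2_pos_bound:
  "\<exists>C\<ge>0. \<forall>r n. good r \<longrightarrow> -1 \<le> n \<longrightarrow> n + 2 * int k \<le> fin r + 1 \<longrightarrow> norm ((diff2 ^^ k) (pos r) n) \<le> C * stp r ^ k"
proof (induction k rule: less_induct)
  case (less k)
  consider "k = 0" | "k = 1" | K where "k = Suc (Suc K)" by (metis One_nat_def not0_implies_Suc)
  then show ?case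
  proof cases
    case 1
    then show ?thesis using R_nonneg by (intro exI[of _ R]) (auto simp: good_pos)
  next
    case 2
    have "norm (diff2 (pos r) n) \<le> 2 * U * stp r" if "good r" "-1 \<le> n" "n + 2 \<le> fin r + 1" for r n
    proof -
      have "diff2 (pos r) n = stp r *\<^sub>R (vel r (n + 1) + vel r n)"
        using goodD(11)[OF that(1)] by (simp add: diff2_def vel_def scaleR_add_right add.assoc)
      moreover have "norm (vel r (n + 1) + vel r n) \<le> 2 * U"
        using good_vel[of r n] good_vel[of r "n + 1"] that norm_triangle_ineq[of "vel r (n + 1)" "vel r n"] by simp
      ultimately show ?thesis
        using goodD(3)[OF that(1)] by (simp add: mult.commute[of _ "stp r"] mult_left_mono)
    qed
    then show ?thesis using 2 U_ge by (intro exI[of _ "2 * U"]) auto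
  next
    case (3 K)
    have "\<forall>j\<in>{..<k}. \<exists>C\<ge>0. \<forall>r n. good r \<longrightarrow> -1 \<le> n \<longrightarrow> n + 2 * int j \<le> fin r + 1 \<longrightarrow> norm ((diff2 ^^ j) (pos r) n) \<le> C * stp r ^ j"
      using less by blast
    then obtain Cf where Cf: "\<And>j. j < k \<Longrightarrow> 0 \<le> Cf j"
      "\<And>j r n. j < k \<Longrightarrow> good r \<Longrightarrow> -1 \<le> n \<Longrightarrow> n + 2 * int j \<le> fin r + 1 \<Longrightarrow> norm ((diff2 ^^ j) (pos r) n) \<le> Cf j * stp r ^ j"
      unfolding bchoice_iff by (metis lessThan_iff)
    define C where "C = (\<Sum>j<k. Cf j)"
    have C: "0 \<le> C" using Cf(1) by (auto simp: C_def intro: sum_nonneg)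
    have pos: "norm ((diff2 ^^ j) (pos r) n) \<le> C * stp r ^ j"
      if "good r" "j \<le> Suc K" "-1 \<le> n" "n + 2 * int j \<le> fin r + 1" for r n j
    proof -
      have "Cf j \<le> C" unfolding C_def using that(2) 3 Cf(1) by (intro member_le_sum) auto
      then have "Cf j * stp r ^ j \<le> C * stp r ^ j" using goodD(3)[OF that(1)] by (intro mult_right_mono) auto
      with Cf(2)[of j r n] that 3 show ?thesis by auto
    qed
    \<comment> \<open>Order \<open>K\<close> of the force needs positions up to order
      \<open>K + 1\<close>, which is below \<open>k\<close>; this gap lets the strong induction
      proceed.\<close>
    obtain G where G: "0 \<le> G"
      "\<And>r n. good r \<Longrightarrow> 0 \<le> n \<Longrightarrow> n + 2 * int K \<le> fin r \<Longrightarrow> norm ((diff2 ^^ K) (frc r) n) \<le> G * stp r ^ K"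
      using diff2_frc_bound[OF C pos] by blast
    have "norm ((diff2 ^^ k) (pos r) n) \<le> (8 * C + 8 * G) * stp r ^ k"
      if g: "good r" and n: "-1 \<le> n" "n + 2 * int k \<le> fin r + 1" for r n
    proof -
      note h = goodD(1-4,11,12,18)[OF g]
      have frc: "norm ((diff2 ^^ K) (frc r) m) \<le> G * stp r ^ K" if "m \<in> {n + 1, n + 2, n + 3}" for m
        using that n 3 by (intro G(2)[OF g]) auto
      let ?x = "(diff2 ^^ k) (pos r) n"
      have par: "\<bar>?x \<bullet> b\<bar> \<le> 4 * G * stp r ^ k"
      proof -
        \<comment> \<open>In direction \<open>b\<close> the scheme has no stiff term. Two
          differences of stride two are ordinary second differences at three centres with weights 1,
          2, 1, each of them \<open>h ^ 2\<close> times a force.\<close>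
        define a where "a m = (stp r)\<^sup>2 *\<^sub>R (frc r (m + 1) + 2 *\<^sub>R frc r (m + 2) + frc r (m + 3))" for m
        have "?x \<bullet> b = (diff2 ^^ K) (\<lambda>m. diff2 (diff2 (pos r)) m \<bullet> b) n"
          unfolding 3 diff2_power_Suc by (rule diff2_linear[symmetric]) (simp add: inner_diff_left)
        also have "\<dots> = (diff2 ^^ K) (\<lambda>m. a m \<bullet> b) n"
        proof (rule diff2_cong)
          fix i assume "i \<le> K"
          let ?m = "n + 2 * int i"
          have acc: "(pos r (m + 1) - 2 *\<^sub>R pos r m + pos r (m - 1)) \<bullet> b = (stp r)\<^sup>2 * (frc r m \<bullet> b)"
            if "m \<in> {?m + 1, ?m + 2, ?m + 3}" for m
          proof -
            have "pos r (m + 1) - 2 *\<^sub>R pos r m + pos r (m - 1) = stp r *\<^sub>R (vel r m - vel r (m - 1))"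
              using h by (simp add: vel_def vec_eq_iff field_simps)
            moreover have "(vel r m - vel r (m - 1)) \<bullet> b = stp r * (frc r m \<bullet> b)"
              using that n 3 \<open>i \<le> K\<close> by (intro parallel_step[OF g]) auto
            ultimately show ?thesis by (simp add: power2_eq_square)
          qed
          have "diff2 (diff2 (pos r)) m = (pos r (m + 1 + 1) - 2 *\<^sub>R pos r (m + 1) + pos r (m + 1 - 1))
            + 2 *\<^sub>R (pos r (m + 2 + 1) - 2 *\<^sub>R pos r (m + 2) + pos r (m + 2 - 1))
            + (pos r (m + 3 + 1) - 2 *\<^sub>R pos r (m + 3) + pos r (m + 3 - 1))" for m
            by (simp add: diff2_def vec_eq_iff add.commute[of 1 m] add.commute[of 2 m] add.commute[of 3 m])
          then show "diff2 (diff2 (pos r)) ?m \<bullet> b = a ?m \<bullet> b"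
            using acc[of "?m + 1"] acc[of "?m + 2"] acc[of "?m + 3"]
            by (simp only: inner_add_left a_def inner_scaleR_left insert_iff simp_thms) (simp add: algebra_simps)
        qed
        also have "\<dots> = (diff2 ^^ K) a n \<bullet> b" by (rule diff2_linear) (simp add: inner_diff_left)
        also have "(diff2 ^^ K) a n = (stp r)\<^sup>2 *\<^sub>R ((diff2 ^^ K) (frc r) (n + 1) + 2 *\<^sub>R (diff2 ^^ K) (frc r) (n + 2) + (diff2 ^^ K) (frc r) (n + 3))"
          unfolding a_def[abs_def]
          using diff2_shift_scale[of K "(stp r)\<^sup>2" "\<lambda>m. frc r (m + 1) + 2 *\<^sub>R frc r (m + 2) + frc r (m + 3)" 0 n]
          by (simp only: add_0_right diff2_add diff2_shift_scale diff2_shift)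
        finally have eq: "?x \<bullet> b = ((stp r)\<^sup>2 *\<^sub>R ((diff2 ^^ K) (frc r) (n + 1) + 2 *\<^sub>R (diff2 ^^ K) (frc r) (n + 2) + (diff2 ^^ K) (frc r) (n + 3))) \<bullet> b" .
        have "norm ((diff2 ^^ K) (frc r) (n + 1) + 2 *\<^sub>R (diff2 ^^ K) (frc r) (n + 2) + (diff2 ^^ K) (frc r) (n + 3)) \<le> 4 * (G * stp r ^ K)"
          using norm_triangle_le[OF add_mono[OF norm_triangle_le[OF add_mono[OF frc[of "n + 1"], of "norm (2 *\<^sub>R (diff2 ^^ K) (frc r) (n + 2))" "2 * (G * stp r ^ K)"]] frc[of "n + 3"]]]
            frc[of "n + 2"] by simp
        then have "\<bar>?x \<bullet> b\<bar> \<le> (stp r)\<^sup>2 * (4 * (G * stp r ^ K))"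
          unfolding eq by (intro order_trans[OF abs_inner_b_le]) (simp add: mult_left_mono)
        also have "\<dots> = 4 * G * stp r ^ k" by (simp add: 3 power2_eq_square)
        finally show ?thesis .
      qed
      have perp: "norm (?x \<times> b) \<le> (8 * C + 4 * G) * stp r ^ k"
      proof -
        \<comment> \<open>Across \<open>b\<close> only one stride-two difference is used, as a
          multiple of \<open>mvel \<times> b\<close>. The scheme turns it into
          \<open>2 * eps / h\<close> times ordinary second differences of positions, and
          \<open>eps / h \<le> h\<close> supplies the power of \<open>h\<close> to be
          gained.\<close>
        define a where "a m = (2 * eps r / stp r) *\<^sub>R (pos r (m + 2) - 2 *\<^sub>R pos r (m + 1) + pos r m) - (2 * eps r * stp r) *\<^sub>R frc r (m + 1)" for m
        let ?d = "\<lambda>m. (diff2 ^^ Suc K) (pos r) m"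
        have "?x \<times> b = (diff2 ^^ Suc K) (\<lambda>m. diff2 (pos r) m \<times> b) n"
          unfolding 3 diff2_power_Suc[of "Suc K"] by (rule diff2_linear[symmetric]) (simp add: Cross3.left_diff_distrib)
        also have "\<dots> = (diff2 ^^ Suc K) a n"
        proof (rule diff2_cong)
          fix i assume "i \<le> Suc K"
          let ?m = "n + 2 * int i"
          have "vel r (?m + 1) - vel r (?m + 1 - 1) = (stp r / eps r) *\<^sub>R (mvel r (?m + 1) \<times> b) + stp r *\<^sub>R frc r (?m + 1)"
            using n 3 \<open>i \<le> Suc K\<close> by (intro good_step[OF g]) auto
          then have "mvel r (?m + 1) \<times> b = (eps r / stp r) *\<^sub>R (vel r (?m + 1) - vel r (?m + 1 - 1) - stp r *\<^sub>R frc r (?m + 1))"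
            using h by simp
          moreover have "diff2 (pos r) ?m = (2 * stp r) *\<^sub>R mvel r (?m + 1)"
            using pos_mvel[of r "?m + 1"] h by (simp add: diff2_def add.assoc)
          ultimately have "diff2 (pos r) ?m \<times> b = (2 * eps r) *\<^sub>R (vel r (?m + 1) - vel r (?m + 1 - 1) - stp r *\<^sub>R frc r (?m + 1))"
            using h by (simp add: cross_mult_left)
          also have "\<dots> = a ?m"
            using h by (simp add: a_def vel_def vec_eq_iff field_simps)
          finally show "diff2 (pos r) ?m \<times> b = a ?m" .
        qed
        also have "\<dots> = (2 * eps r / stp r) *\<^sub>R (?d (n + 2) - 2 *\<^sub>R ?d (n + 1) + ?d n)
            - (2 * eps r * stp r) *\<^sub>R (diff2 ^^ Suc K) (frc r) (n + 1)"
          unfolding a_def[abs_def] diff2_minus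
          using diff2_shift_scale[of "Suc K" "2 * eps r / stp r" "\<lambda>m. pos r (m + 2) - 2 *\<^sub>R pos r (m + 1) + pos r m" 0 n]
          by (simp only: add_0_right diff2_add diff2_minus diff2_shift_scale diff2_shift)
        also have "(diff2 ^^ Suc K) (frc r) (n + 1) = (diff2 ^^ K) (frc r) (n + 3) - (diff2 ^^ K) (frc r) (n + 1)"
          by (simp add: diff2_def[of "(diff2 ^^ K) _"] add.assoc)
        finally have eq: "?x \<times> b = (2 * eps r / stp r) *\<^sub>R (?d (n + 2) - 2 *\<^sub>R ?d (n + 1) + ?d n)
            - (2 * eps r * stp r) *\<^sub>R ((diff2 ^^ K) (frc r) (n + 3) - (diff2 ^^ K) (frc r) (n + 1))" .
        have d: "norm (?d m) \<le> C * stp r ^ Suc K" if "m \<in> {n, n + 1, n + 2}" for m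
          using that n 3 by (intro pos[OF g]) auto
        have "norm (?d (n + 2) - 2 *\<^sub>R ?d (n + 1)) \<le> C * stp r ^ Suc K + 2 * (C * stp r ^ Suc K)"
          using d[of "n + 1"] by (intro order_trans[OF norm_triangle_ineq4] add_mono d) auto
        then have "norm (?d (n + 2) - 2 *\<^sub>R ?d (n + 1) + ?d n) \<le> 4 * (C * stp r ^ Suc K)"
          using norm_triangle_ineq[of "?d (n + 2) - 2 *\<^sub>R ?d (n + 1)" "?d n"] d[of n] by simp
        then have "norm ((2 * eps r / stp r) *\<^sub>R (?d (n + 2) - 2 *\<^sub>R ?d (n + 1) + ?d n)) \<le> (2 * stp r) * (4 * (C * stp r ^ Suc K))"
          using eps_over_stp[OF g] h by (simp only: norm_scaleR) (intro mult_mono, auto)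
        moreover have "norm ((2 * eps r * stp r) *\<^sub>R ((diff2 ^^ K) (frc r) (n + 3) - (diff2 ^^ K) (frc r) (n + 1))) \<le> (2 * (stp r)\<^sup>2) * (2 * (G * stp r ^ K))"
        proof -
          have "norm ((diff2 ^^ K) (frc r) (n + 3) - (diff2 ^^ K) (frc r) (n + 1)) \<le> 2 * (G * stp r ^ K)"
            using norm_triangle_ineq4[of "(diff2 ^^ K) (frc r) (n + 3)" "(diff2 ^^ K) (frc r) (n + 1)"] frc[of "n + 1"] frc[of "n + 3"] by simp
          moreover have "2 * eps r * stp r \<le> 2 * (stp r)\<^sup>2"
            using h mult_mono[of "eps r" "(stp r)\<^sup>2" "stp r" 1] by simp
          ultimately show ?thesis using h by (simp only: norm_scaleR) (intro mult_mono, auto)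
        qed
        ultimately have "norm (?x \<times> b) \<le> (2 * stp r) * (4 * (C * stp r ^ Suc K)) + (2 * (stp r)\<^sup>2) * (2 * (G * stp r ^ K))"
          unfolding eq by (intro order_trans[OF norm_triangle_ineq4] add_mono)
        also have "\<dots> = (8 * C + 4 * G) * stp r ^ k" by (simp add: 3 power2_eq_square algebra_simps)
        finally show ?thesis .
      qed
      show ?thesis using norm_decomp[of ?x] par perp by (simp add: algebra_simps)
    qed
    then show ?thesis using C G(1) by (intro exI[of _ "8 * C + 8 * G"]) auto
  qed
qed

section \<open>A modified energy that nearly stays constant\<close>

definition pen :: "run \<Rightarrow> int \<Rightarrow> real" where "pen r n = enp r (pos r n)"

definition energy :: "run \<Rightarrow> int \<Rightarrow> real" where
  "energy r n = (norm (mvel r n))\<^sup>2 / 2 + pen r n"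

lemma ubd_stencil:
  assumes "\<And>k. k \<in> {1..4} \<Longrightarrow> ubd S (f k) g"
  shows "ubd S (\<lambda>r n. stencil (\<lambda>k. f k r n)) g"
  unfolding stencil_def using assms by (intro ubd_add ubd_diff ubd_const_scaleR) auto

definition zdiff :: "(int \<Rightarrow> 'a) \<Rightarrow> nat \<Rightarrow> int \<Rightarrow> 'a::ab_group_add" where
  "zdiff f k n = f (n + 2 * int k) - f (n - 2 * int k)"

text \<open>Along the interpolant \<open>q\<close> of the positions with even offsets, the function
  \<open>y \<bullet> q + enp \<circ> q - mvel \<bullet> (pot \<circ> q)\<close> with \<open>y = frc + dpot\<close> is stationary at the centre. This cancels in the energy
  balance all but the remainder of the difference quotient.\<close>

lemma ubd_stencil_force:
  "ubd (win 7 (-7)) (\<lambda>r n. stencil (\<lambda>k. (frc r n + dpot r n) \<bullet> zdiff (pos r) k n + zdiff (pen r) k n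
     - mvel r n \<bullet> zdiff (\<lambda>m. pot r (pos r m)) k n)) (\<lambda>r n. stp r ^ 9)"
proof -
  obtain Cf where Cf: "\<And>j. 0 \<le> Cf j" "\<And>j r n. good r \<Longrightarrow> -1 \<le> n \<Longrightarrow> n + 2 * int j \<le> fin r + 1 \<Longrightarrow>
      norm ((diff2 ^^ j) (pos r) n) \<le> Cf j * stp r ^ j"
    using diff2_pos_bound by metis
  define C where "C = (\<Sum>j\<le>8. Cf j)"
  have C: "0 \<le> C" "\<And>j. j \<le> 8 \<Longrightarrow> Cf j \<le> C"
    using Cf(1) by (auto simp: C_def intro: sum_nonneg member_le_sum)
  define Y where "Y = 3 * L * U + L"
  define N where "N = newton_const 9 8 * C"
  define CF where "CF = Y * N + 2 ^ 8 * along_const M 8 8 C * N + U * along_const M 9 8 C"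
  have nn: "0 \<le> N" "0 \<le> Y" "0 \<le> along_const M 8 8 C" "0 \<le> along_const M 9 8 C"
    using C(1) L_nonneg U_ge by (auto simp: N_def Y_def newton_const_nonneg along_const_nonneg)
  show ?thesis
  proof (rule ubdI[of CF])
    fix r n assume "win 7 (-7) r n"
    then have g: "good r" and n: "7 \<le> n" "n \<le> fin r - 7" by (auto simp: win_def)
    note h = goodD(3,4)[OF g]
    note smooth = goodD(5-8)[OF g]
    \<comment> \<open>The nodes are \<open>n - 8, n - 6, ..., n + 8\<close>. As positions run from
      -1 to \<open>fin r + 1\<close>, this fixes the window from 7 to
      \<open>fin r - 7\<close>.\<close>
    have x: "norm ((diff2 ^^ j) (pos r) (n - 8)) \<le> C * stp r ^ j" if "j \<le> 8" for j
    proof -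
      have "norm ((diff2 ^^ j) (pos r) (n - 8)) \<le> Cf j * stp r ^ j"
        using n that by (intro Cf(2)[OF g]) auto
      also have "\<dots> \<le> C * stp r ^ j" using C(2)[OF that] h by (intro mult_right_mono) auto
      finally show ?thesis .
    qed
    define q where "q = newton_poly 8 (pos r) (n - 8)"
    have node: "q (real i) = pos r (n - 8 + 2 * int i)" if "i \<le> 8" for i
      unfolding q_def by (rule newton_poly_node[OF that])
    obtain q' where q': "\<And>s. (q has_vector_derivative q' s) (at s)" "dbound 8 {0..8} (stp r) (N * stp r) q'"
      using newton_poly_derivative[where k = 8 and m = 8 and a = "pos r" and n = "n - 8" and C = C and h = "stp r", OF x h]
      by (auto simp: q_def N_def)
    have "dbound 9 {0..8} (stp r) (along_const M 9 8 C) (\<lambda>s. pot r (q s))"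
      using dbound_field_newton[where k = 8 and m = 9 and a = "pos r" and n = "n - 8" and C = C and h = "stp r", OF smooth(1,3) x h] by (simp add: q_def)
    then obtain p' where p': "\<And>s. ((\<lambda>s. pot r (q s)) has_vector_derivative p' s) (at s)"
      "dbound 8 {0..8} (stp r) (along_const M 9 8 C * stp r) p'"
      using dbound.simps(2)[of 8 "{0..8}" "stp r" "along_const M 9 8 C" "\<lambda>s. pot r (q s)"]
      by (auto simp del: dbound.simps)
    have E: "dbound 8 {0..8} (stp r) (along_const M 8 8 C) (\<lambda>s. ele r (q s))"
      using dbound_field_newton[where k = 8 and m = 8 and a = "pos r" and n = "n - 8" and C = C and h = "stp r", OF smooth(2,4) x h] by (simp add: q_def)
    define y where "y = frc r n + dpot r n"
    have y: "y = tdir (pot r) (pos r n) (mvel r n) + ele r (pos r n)" by (simp add: y_def frc_def)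
    have mv: "norm (mvel r n) \<le> U"
      using good_vel[OF g, of n] good_vel[OF g, of "n - 1"] n norm_triangle_ineq[of "vel r n" "vel r (n - 1)"]
      by (simp add: mvel_def)
    have xR: "norm (pos r n) \<le> 3 * R" using good_pos[OF g, of n] n R_nonneg by simp
    have yY: "norm y \<le> Y"
    proof -
      have "norm (tdir (pot r) (pos r n) (mvel r n)) \<le> 3 * L * norm (mvel r n)"
        by (rule norm_tdir_le[OF field_bound_lower[OF goodD(9)[OF g]] xR]) simp
      also have "\<dots> \<le> 3 * L * U" using mv L_nonneg by (intro mult_left_mono) auto
      finally show ?thesis
        unfolding y Y_def using field_bound_norm[OF goodD(10)[OF g] xR] by (rule norm_triangle_mono)
    qed
    define F where "F s = q s \<bullet> y + enp r (q s) - pot r (q s) \<bullet> mvel r n" for s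
    define F' where "F' s = q' s \<bullet> y - ele r (q s) \<bullet> q' s - p' s \<bullet> mvel r n" for s
    have dF: "(F has_vector_derivative F' s) (at s)" for s
    proof -
      have "((\<lambda>s. enp r (q s)) has_derivative (\<lambda>t. (t *\<^sub>R q' s) \<bullet> (- ele r (q s)))) (at s)"
        using has_derivative_compose[OF q'(1)[of s, unfolded has_vector_derivative_def] good_potential[OF g, unfolded gderiv_def]] .
      then have "((\<lambda>s. enp r (q s)) has_vector_derivative (- (ele r (q s) \<bullet> q' s))) (at s)"
        by (simp add: has_vector_derivative_def inner_commute)
      moreover have "((\<lambda>s. q s \<bullet> y) has_vector_derivative q' s \<bullet> y) (at s)"
        "((\<lambda>s. pot r (q s) \<bullet> mvel r n) has_vector_derivative p' s \<bullet> mvel r n) (at s)"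
        using q'(1) p'(1) by (auto intro: bounded_linear.has_vector_derivative[OF bounded_linear_inner_left])
      ultimately show ?thesis
        unfolding F_def[abs_def] F'_def
        by (auto intro!: derivative_eq_intros has_vector_derivative_diff has_vector_derivative_add)
    qed
    have "dbound 8 {0..8} (stp r) (Y * (N * stp r) + 2 ^ 8 * along_const M 8 8 C * (N * stp r) + U * (along_const M 9 8 C * stp r))
        (\<lambda>s. q' s \<bullet> y + - (ele r (q s) \<bullet> q' s) + - (p' s \<bullet> mvel r n))"
    proof (intro dbound_add dbound_minus)
      show "dbound 8 {0..8} (stp r) (Y * (N * stp r)) (\<lambda>s. q' s \<bullet> y)"
        using yY nn h by (intro dbound_weaken[OF dbound_inner_right[OF q'(2)]] mult_right_mono) auto
      show "dbound 8 {0..8} (stp r) (2 ^ 8 * along_const M 8 8 C * (N * stp r)) (\<lambda>s. ele r (q s) \<bullet> q' s)"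
        using E q'(2) nn h by (intro dbound_inner) auto
      show "dbound 8 {0..8} (stp r) (U * (along_const M 9 8 C * stp r)) (\<lambda>s. p' s \<bullet> mvel r n)"
        using mv nn h by (intro dbound_weaken[OF dbound_inner_right[OF p'(2)]] mult_right_mono) auto
    qed
    then have "dbound 8 {4 - 4..4 + 4} (stp r) (CF * stp r) F'"
      by (simp add: F'_def[abs_def] CF_def algebra_simps)
    from stencil_error[OF dF this]
    have "\<bar>stencil (\<lambda>k. F (4 + real k) - F (4 - real k)) - F' 4\<bar> \<le> CF * stp r ^ 9" .
    \<comment> \<open>Node 4 is the centre \<open>n\<close>. There the terms with
      \<open>tdir\<close> and \<open>dir\<close> cancel by adjointness, as do the electric force and
      the gradient of \<open>enp\<close>.\<close>
    moreover have "F' 4 = 0"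
    proof -
      have "p' 4 = dir (pot r) (q 4) (q' 4)"
        using p'(1)[of 4] has_vector_derivative_along[OF smooth(1) q'(1)[of 4]] by (rule vector_derivative_unique_at)
      moreover have "q 4 = pos r n" using node[of 4] by simp
      ultimately show ?thesis
        by (simp add: F'_def y inner_add_right inner_commute[of "q' 4"] tdir_inner inner_commute[of "dir _ _ _"])
    qed
    moreover have "stencil (\<lambda>k. F (4 + real k) - F (4 - real k)) = stencil (\<lambda>k. y \<bullet> zdiff (pos r) k n + zdiff (pen r) k n
        - mvel r n \<bullet> zdiff (\<lambda>m. pot r (pos r m)) k n)"
    proof (rule stencil_cong)
      fix k :: nat assume k: "k \<in> {1..4}"
      have "q (4 + real k) = pos r (n + 2 * int k)" "q (4 - real k) = pos r (n - 2 * int k)"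
        using node[of "4 + k"] node[of "4 - k"] k by (simp_all add: of_nat_diff algebra_simps)
      then show "F (4 + real k) - F (4 - real k) = y \<bullet> zdiff (pos r) k n + zdiff (pen r) k n
        - mvel r n \<bullet> zdiff (\<lambda>m. pot r (pos r m)) k n"
        by (simp add: F_def zdiff_def pen_def inner_diff_right inner_commute algebra_simps)
    qed
    ultimately show "norm (stencil (\<lambda>k. (frc r n + dpot r n) \<bullet> zdiff (pos r) k n + zdiff (pen r) k n
        - mvel r n \<bullet> zdiff (\<lambda>m. pot r (pos r m)) k n)) \<le> CF * stp r ^ 9"
      by (simp add: y_def)
  qed (use nn U_ge in \<open>auto simp: CF_def\<close>)
qed

text \<open>The result of summing the kinetic term by parts: the sum collects the products
  \<open>vel r m \<bullet> vel r (m + 2 * k)\<close> that appear when \<open>zdiff\<close> is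
  differenced.\<close>

definition kin :: "run \<Rightarrow> nat \<Rightarrow> int \<Rightarrow> real" where
  "kin r k n = (1 / stp r) * (vel r n \<bullet> zdiff (pos r) k n) - (\<Sum>m<2 * k. vel r (n - 1 - int m) \<bullet> vel r (n - 1 - int m + 2 * int k))"

text \<open>A Wronskian: the expression changes sign when the steps \<open>n\<close> and
  \<open>n + i\<close> are exchanged. Therefore pairing step \<open>n\<close> with
  \<open>n + i\<close> and with \<open>n - i\<close> produces a difference of two values.\<close>

definition wron :: "run \<Rightarrow> int \<Rightarrow> int \<Rightarrow> real" where
  "wron r i n = - (1 / eps r) * ((mvel r n \<times> b) \<bullet> mvel r (n + i)) + dpot r n \<bullet> mvel r (n + i) - mvel r n \<bullet> dpot r (n + i)"

text \<open>Close to \<open>4 * k\<close> times the energy: there are \<open>4 * k\<close> potential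
  terms, and \<open>kin\<close> is about \<open>2 * k\<close> times the squared speed.\<close>

definition menergy :: "run \<Rightarrow> nat \<Rightarrow> int \<Rightarrow> real" where
  "menergy r k n = kin r k n + 2 * stp r * (\<Sum>i<k. \<Sum>l<2 * i + 1. wron r (2 * int i + 1) (n - int l))
     + (\<Sum>l<4 * k. pen r (n + 2 * int k - int l))"

lemma kin_diff:
  assumes "stp r \<noteq> 0"
  shows "kin r k n - kin r k (n - 1) = (1 / stp r) * ((vel r n - vel r (n - 1)) \<bullet> zdiff (pos r) k n)"
proof -
  define f where "f m = vel r m \<bullet> vel r (m + 2 * int k)" for m
  have "(\<Sum>m<2 * k. f (n - 1 - int m)) - (\<Sum>m<2 * k. f (n - 1 - 1 - int m)) = f (n - 1) - f (n - 1 - int (2 * k))"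
    by (rule sum_telescope_shift)
  moreover have z: "zdiff (pos r) k n = zdiff (pos r) k (n - 1) + stp r *\<^sub>R (vel r (n - 1 + 2 * int k) - vel r (n - 1 - 2 * int k))"
    using assms by (simp add: zdiff_def vel_def scaleR_diff_right algebra_simps)
  have "(1 / stp r) * (vel r (n - 1) \<bullet> zdiff (pos r) k n) = (1 / stp r) * (vel r (n - 1) \<bullet> zdiff (pos r) k (n - 1))
      + (f (n - 1) - f (n - 1 - int (2 * k)))"
    unfolding z using assms by (simp add: f_def inner_add_right inner_diff_right distrib_left inner_commute[of "vel r (n - 1)"])
  ultimately show ?thesis
    by (simp add: kin_def f_def[symmetric] inner_diff_left right_diff_distrib)
qed

lemma zdiff_pos:
  assumes "stp r \<noteq> 0"
  shows "zdiff (pos r) k n = (2 * stp r) *\<^sub>R (\<Sum>i<k. mvel r (n + (2 * int i + 1)) + mvel r (n - (2 * int i + 1)))"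
proof (induction k)
  case (Suc k)
  have "(2 * stp r) *\<^sub>R mvel r (n + (2 * int k + 1)) = pos r (n + 2 * int (Suc k)) - pos r (n + 2 * int k)"
    "(2 * stp r) *\<^sub>R mvel r (n - (2 * int k + 1)) = pos r (n - 2 * int k) - pos r (n - 2 * int (Suc k))"
    using pos_mvel[OF assms, of "n + (2 * int k + 1)"] pos_mvel[OF assms, of "n - (2 * int k + 1)"]
    by (simp_all add: algebra_simps)
  then have "zdiff (pos r) (Suc k) n = zdiff (pos r) k n
      + (2 * stp r) *\<^sub>R (mvel r (n + (2 * int k + 1)) + mvel r (n - (2 * int k + 1)))"
    by (simp only: zdiff_def scaleR_right_distrib) simp
  then show ?case by (simp only: Suc sum.lessThan_Suc scaleR_right_distrib)
qed (simp add: zdiff_def)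

lemma zdiff_pot:
  assumes "stp r \<noteq> 0"
  shows "zdiff (\<lambda>m. pot r (pos r m)) k n = (2 * stp r) *\<^sub>R (\<Sum>i<k. dpot r (n + (2 * int i + 1)) + dpot r (n - (2 * int i + 1)))"
proof (induction k)
  case (Suc k)
  have "(2 * stp r) *\<^sub>R dpot r (n + (2 * int k + 1)) = pot r (pos r (n + 2 * int (Suc k))) - pot r (pos r (n + 2 * int k))"
    "(2 * stp r) *\<^sub>R dpot r (n - (2 * int k + 1)) = pot r (pos r (n - 2 * int k)) - pot r (pos r (n - 2 * int (Suc k)))"
    using assms by (simp_all add: dpot_def algebra_simps)
  then have "zdiff (\<lambda>m. pot r (pos r m)) (Suc k) n = zdiff (\<lambda>m. pot r (pos r m)) k n
      + (2 * stp r) *\<^sub>R (dpot r (n + (2 * int k + 1)) + dpot r (n - (2 * int k + 1)))"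
    by (simp only: zdiff_def scaleR_right_distrib) simp
  then show ?case by (simp only: Suc sum.lessThan_Suc scaleR_right_distrib)
qed (simp add: zdiff_def)

lemma wron_diff:
  "(- (1 / eps r) *\<^sub>R (mvel r n \<times> b) + dpot r n) \<bullet> (mvel r (n + i) + mvel r (n - i)) - mvel r n \<bullet> (dpot r (n + i) + dpot r (n - i))
    = wron r i n - wron r i (n - i)"
  using cross_inner_skew[of "mvel r n" b "mvel r (n - i)"]
  by (simp add: wron_def inner_add_left inner_add_right inner_commute algebra_simps)

text \<open>The variational structure makes each contribution telescope exactly: a symmetric difference
  operator paired with an antisymmetric one, respectively two commuting antisymmetric ones.\<close>

lemma menergy_diff:
  assumes g: "good r" and n: "0 \<le> n" "n \<le> fin r"
  shows "menergy r k n - menergy r k (n - 1) = (frc r n + dpot r n) \<bullet> zdiff (pos r) k n + zdiff (pen r) k n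
     - mvel r n \<bullet> zdiff (\<lambda>m. pot r (pos r m)) k n"
proof -
  note h = goodD(11,12)[OF g]
  have 1: "kin r k n - kin r k (n - 1) = (frc r n + (1 / eps r) *\<^sub>R (mvel r n \<times> b)) \<bullet> zdiff (pos r) k n"
  proof -
    have "vel r n - vel r (n - 1) = stp r *\<^sub>R (frc r n + (1 / eps r) *\<^sub>R (mvel r n \<times> b))"
      using good_step[OF g n] by (simp add: scaleR_right_distrib)
    then show ?thesis unfolding kin_diff[OF h(1)] using h(1) by simp
  qed
  have "(\<Sum>i<k. \<Sum>l<2 * i + 1. wron r (2 * int i + 1) (n - int l)) - (\<Sum>i<k. \<Sum>l<2 * i + 1. wron r (2 * int i + 1) (n - 1 - int l))
      = (\<Sum>i<k. wron r (2 * int i + 1) n - wron r (2 * int i + 1) (n - (2 * int i + 1)))"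
    unfolding sum_subtractf[of _ _ "{..<k}", symmetric] sum_telescope_shift by (simp add: add.commute)
  also have "\<dots> = (\<Sum>i<k. (- (1 / eps r) *\<^sub>R (mvel r n \<times> b) + dpot r n) \<bullet> (mvel r (n + (2 * int i + 1)) + mvel r (n - (2 * int i + 1)))
      - mvel r n \<bullet> (dpot r (n + (2 * int i + 1)) + dpot r (n - (2 * int i + 1))))"
    by (simp only: wron_diff)
  finally have 2: "2 * stp r * ((\<Sum>i<k. \<Sum>l<2 * i + 1. wron r (2 * int i + 1) (n - int l)) - (\<Sum>i<k. \<Sum>l<2 * i + 1. wron r (2 * int i + 1) (n - 1 - int l)))
      = (- (1 / eps r) *\<^sub>R (mvel r n \<times> b) + dpot r n) \<bullet> zdiff (pos r) k n - mvel r n \<bullet> zdiff (\<lambda>m. pot r (pos r m)) k n"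
    by (simp add: zdiff_pos[OF h(1)] zdiff_pot[OF h(1)] sum_subtractf inner_sum_right right_diff_distrib)
  have 3: "(\<Sum>l<4 * k. pen r (n + 2 * int k - int l)) - (\<Sum>l<4 * k. pen r (n - 1 + 2 * int k - int l)) = zdiff (pen r) k n"
    using sum_telescope_shift[of "pen r" "n + 2 * int k" "4 * k"] by (simp add: zdiff_def algebra_simps)
  show ?thesis
    using 1 2 3 by (simp add: menergy_def inner_add_left algebra_simps)
qed

section \<open>Comparison of the modified energy with the energy\<close>

lemma ubd_shift_diff:
  assumes "ubd (win a e) (\<lambda>r n. f r n - f r (n - 1)) (\<lambda>r n. stp r)"
  shows "ubd (win a (e - int p)) (\<lambda>r n. f r (n + int p) - f r n) (\<lambda>r n. stp r)"
proof (induction p)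
  case 0
  show ?case by (simp add: ubd_zero nn_stp)
next
  case (Suc p)
  have "ubd (win a (e - int (Suc p))) (\<lambda>r n. (f r (n + (int p + 1)) - f r (n + (int p + 1) - 1)) + (f r (n + int p) - f r n)) (\<lambda>r n. stp r)"
    by (intro ubd_add ubd_shift[OF assms] ubd_sub[OF Suc]) auto
  then show ?case by (simp add: ac_simps)
qed

lemma ubd_shift_diff':
  assumes "ubd (win a e) (\<lambda>r n. f r n - f r (n - 1)) (\<lambda>r n. stp r)"
  shows "ubd (win (a + int p) e) (\<lambda>r n. f r (n - int p) - f r n) (\<lambda>r n. stp r)"
  using ubd_minus[OF ubd_shift[OF ubd_shift_diff[OF assms, of p], of "a + int p" "- int p" e]] by simp

lemma ubd_dmvel: "ubd (win 1 0) (\<lambda>r n. mvel r n - mvel r (n - 1)) (\<lambda>r n. stp r)"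
proof -
  have "ubd (win 1 0) (\<lambda>r n. (1/2) *\<^sub>R ((vel r n - vel r (n - 1)) + (vel r (n + (-1)) - vel r (n + (-1) - 1)))) (\<lambda>r n. stp r)"
    by (intro ubd_const_scaleR ubd_add ubd_sub[OF ubd_dvel'] ubd_shift[OF ubd_dvel', where k = "-1"]) auto
  then show ?thesis by (rule ubd_cong) (simp add: mvel_def vec_eq_iff field_simps)
qed

definition dirv :: "run \<Rightarrow> int \<Rightarrow> real^3" where
  "dirv r n = dir (pot r) (pos r n) (mvel r n)"

lemma norm_mvel_le: "good r \<Longrightarrow> 0 \<le> n \<Longrightarrow> n \<le> fin r \<Longrightarrow> norm (mvel r n) \<le> U"
  using good_vel[of r n] good_vel[of r "n - 1"] norm_triangle_ineq[of "vel r n" "vel r (n - 1)"]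
  by (simp add: mvel_def)

lemma ubd_dirv: "ubd (win 0 0) dirv (\<lambda>r n. 1)"
proof (rule ubd_dom[OF ubd_mvel, of "3 * L"])
  fix r n assume "win 0 0 r n"
  then show "norm (dirv r n) \<le> 3 * L * norm (mvel r n)"
    unfolding dirv_def using good_pos[of r n] R_nonneg
    by (intro norm_dir_le[where R = "3 * R"] field_bound_lower[OF goodD_field3(1)]) (auto simp: win_def)
qed (use L_nonneg in auto)

lemma ubd_ddirv: "ubd (win 1 0) (\<lambda>r n. dirv r n - dirv r (n - 1)) (\<lambda>r n. stp r)"
proof -
  have "ubd (win 1 0) (\<lambda>r n. dir (pot r) (pos r n) (mvel r n) - dir (pot r) (pos r (n - 1)) (mvel r n)) (\<lambda>r n. stp r)"
  proof (rule ubdI[of "3 * L' * U * U"])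
    fix r n assume "win 1 0 r n"
    then have g: "good r" and n: "1 \<le> n" "n \<le> fin r" by (auto simp: win_def)
    have "norm (dir (pot r) (pos r n) (mvel r n) - dir (pot r) (pos r (n - 1)) (mvel r n))
        \<le> 3 * L' * norm (pos r n - pos r (n - 1)) * norm (mvel r n)"
      unfolding L'_def using n by (intro dir_lipschitz[OF goodD(9)[OF g]] good_pos[OF g]) auto
    also have "pos r n - pos r (n - 1) = stp r *\<^sub>R vel r (n - 1)"
      using goodD(11)[OF g] by (simp add: vel_def)
    also have "3 * L' * norm (stp r *\<^sub>R vel r (n - 1)) * norm (mvel r n) \<le> 3 * L' * (stp r * U) * U"
      using good_vel[OF g, of "n - 1"] norm_mvel_le[OF g, of n] n goodD(3)[OF g] L'_nonneg U_ge
      by (intro mult_mono mult_nonneg_nonneg) auto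
    finally show "norm (dir (pot r) (pos r n) (mvel r n) - dir (pot r) (pos r (n - 1)) (mvel r n)) \<le> 3 * L' * U * U * stp r"
      by (simp add: algebra_simps)
  qed (use L'_nonneg U_ge in auto)
  moreover have "ubd (win 1 0) (\<lambda>r n. dir (pot r) (pos r (n - 1)) (mvel r n - mvel r (n - 1))) (\<lambda>r n. stp r)"
  proof (rule ubd_dom[OF ubd_dmvel, of "3 * L"])
    fix r n assume "win 1 0 r n"
    then show "norm (dir (pot r) (pos r (n - 1)) (mvel r n - mvel r (n - 1))) \<le> 3 * L * norm (mvel r n - mvel r (n - 1))"
      using good_pos[of r "n - 1"] R_nonneg
      by (intro norm_dir_le[where R = "3 * R"] field_bound_lower[OF goodD_field3(1)]) (auto simp: win_def)
  qed (use L_nonneg in auto)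
  ultimately show ?thesis
    by (rule ubd_cong[OF ubd_add]) (simp add: dirv_def dir_diff)
qed

lemma ubd_dpot_dirv: "ubd (win 0 0) (\<lambda>r n. dpot r n - dirv r n) (\<lambda>r n. (stp r)\<^sup>2)"
  unfolding dirv_def by (rule ubd_dpot_dir')

lemma ubd_sq_stp: "ubd (win a e) f (\<lambda>r n. (stp r)\<^sup>2) \<Longrightarrow> ubd (win a e) f (\<lambda>r n. stp r)"
  by (erule ubd_le) (simp add: win_def goodD)

lemma ubd_dpot: "ubd (win 0 0) dpot (\<lambda>r n. 1)"
proof -
  have "ubd (win 0 0) (\<lambda>r n. dpot r n - dirv r n) (\<lambda>r n. 1)"
    by (rule ubd_le[OF ubd_dpot_dirv]) (simp add: win_def goodD)
  from ubd_add[OF this ubd_dirv] show ?thesis by simp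
qed

lemma ubd_ddpot: "ubd (win 1 0) (\<lambda>r n. dpot r n - dpot r (n - 1)) (\<lambda>r n. stp r)"
proof -
  have "ubd (win 1 0) (\<lambda>r n. (dpot r n - dirv r n) - (dpot r (n + (-1)) - dirv r (n + (-1))) + (dirv r n - dirv r (n - 1))) (\<lambda>r n. stp r)"
    by (intro ubd_add ubd_diff ubd_ddirv ubd_sub[OF ubd_sq_stp[OF ubd_dpot_dirv]]
        ubd_shift[OF ubd_sq_stp[OF ubd_dpot_dirv], where k = "-1"]) auto
  then show ?thesis by (rule ubd_cong) simp
qed

text \<open>For \<open>i = 0\<close> skewness makes the expression vanish, and for fixed
  \<open>i\<close> the shifted factors of the \<open>dpot\<close> terms change by
  \<open>O(h)\<close> only. In the stiff term both velocities are \<open>O(eps)\<close> across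
  \<open>b\<close>, which beats the factor \<open>1 / eps\<close>.\<close>

lemma ubd_wron: "ubd (win 1 (- int i)) (\<lambda>r n. wron r (int i) n) (\<lambda>r n. stp r)"
proof -
  have "ubd (win 0 (- int i)) (\<lambda>r n. (1 / eps r) *\<^sub>R (- ((mvel r n \<times> b) \<bullet> ((mvel r (n + int i) \<times> b) \<times> b)))) (\<lambda>r n. 1 / eps r * (eps r * eps r))"
    using ubd_shift[OF ubd_mvel_perp, of 0 "int i" "- int i"] ubd_sub[OF ubd_mvel_perp, of 0 "- int i"]
    by (intro ubd_scaleR ubd_minus ubd_inner ubd_cross_const[of _ "\<lambda>r n. mvel r (n + int i) \<times> b"])
       (auto intro!: ubdI[of 1] simp: win_def goodD less_imp_le)
  then have "ubd (win 0 (- int i)) (\<lambda>r n. (1 / eps r) *\<^sub>R (- ((mvel r n \<times> b) \<bullet> ((mvel r (n + int i) \<times> b) \<times> b)))) (\<lambda>r n. stp r)"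
    by (rule ubd_le) (simp add: win_def goodD)
  then have 1: "ubd (win 1 (- int i)) (\<lambda>r n. (1 / eps r) *\<^sub>R (- ((mvel r n \<times> b) \<bullet> ((mvel r (n + int i) \<times> b) \<times> b)))) (\<lambda>r n. stp r)"
    by (rule ubd_sub) auto
  have 2: "ubd (win 1 (- int i)) (\<lambda>r n. dpot r n \<bullet> (mvel r (n + int i) - mvel r n)) (\<lambda>r n. stp r)"
    using ubd_shift_diff[OF ubd_dmvel, of i] ubd_sub[OF ubd_dpot, of 1 "- int i"] by (intro ubd_one_inner) auto
  have 3: "ubd (win 1 (- int i)) (\<lambda>r n. mvel r n \<bullet> (dpot r (n + int i) - dpot r n)) (\<lambda>r n. stp r)"
    using ubd_shift_diff[OF ubd_ddpot, of i] ubd_sub[OF ubd_mvel, of 1 "- int i"] by (intro ubd_one_inner) auto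
  show ?thesis
  proof (rule ubd_cong[OF ubd_diff[OF ubd_diff[OF 2 1] 3]])
    fix r n
    have "(mvel r n \<times> b) \<bullet> ((mvel r (n + int i) \<times> b) \<times> b) = - ((mvel r n \<times> b) \<bullet> mvel r (n + int i))"
      by (simp add: cross_b_cross_b inner_diff_right dot_cross_self)
    then show "wron r (int i) n = dpot r n \<bullet> (mvel r (n + int i) - mvel r n)
      - (1 / eps r) *\<^sub>R (- ((mvel r n \<times> b) \<bullet> ((mvel r (n + int i) \<times> b) \<times> b)))
      - mvel r n \<bullet> (dpot r (n + int i) - dpot r n)"
      by (simp add: wron_def inner_diff_right inner_commute)
  qed
qed

definition pow :: "run \<Rightarrow> int \<Rightarrow> real" where
  "pow r n = ele r (pos r n) \<bullet> mvel r n"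

lemma ubd_ele: "ubd (win (-1) 1) (\<lambda>r n. ele r (pos r n)) (\<lambda>r n. 1)"
  by (rule ubd_field_pos) (rule goodD_field3)

lemma ubd_dpow: "ubd (win 1 0) (\<lambda>r n. pow r n - pow r (n - 1)) (\<lambda>r n. stp r)"
proof -
  have "ubd (win 1 0) (\<lambda>r n. (ele r (pos r n) - ele r (pos r (n - 1))) \<bullet> mvel r n
      + ele r (pos r (n + (-1))) \<bullet> (mvel r n - mvel r (n - 1))) (\<lambda>r n. stp r)"
    by (intro ubd_add ubd_inner_one ubd_one_inner ubd_dmvel ubd_sub[OF ubd_mvel] ubd_sub[OF ubd_field_diff[of ele]]
        ubd_shift[OF ubd_ele, where k = "-1"]) (auto intro: goodD_field3)
  then show ?thesis by (rule ubd_cong) (simp add: pow_def algebra_simps)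
qed

lemma ubd_prod_stp: "ubd (win a e) f (\<lambda>r n. stp r) \<Longrightarrow> ubd (win a e) (\<lambda>r n. stp r * f r n) (\<lambda>r n. (stp r)\<^sup>2)"
  for f :: "run \<Rightarrow> int \<Rightarrow> real"
  using ubd_scaleR[OF ubd_stp[of a e], of f "\<lambda>r n. stp r"] by (simp add: power2_eq_square)

lemma ubd_pen_step: "ubd (win 0 0) (\<lambda>r n. pen r (n + 1) - pen r n + stp r * pow r n) (\<lambda>r n. (stp r)\<^sup>2)"
proof -
  have "ubd (win 0 0) (\<lambda>r n. pen r (n + 1) - pen r n + stp r * (ele r (pos r n) \<bullet> vel r n)) (\<lambda>r n. (stp r)\<^sup>2)"
  proof (rule ubdI[of "L' * U\<^sup>2"])
    fix r n assume "win 0 0 r n"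
    then have g: "good r" and n: "0 \<le> n" "n \<le> fin r" by (auto simp: win_def)
    note h = goodD(3,11)[OF g]
    let ?x = "pos r n" and ?d = "stp r *\<^sub>R vel r n"
    have d: "norm ?d \<le> stp r * U" using good_vel[OF g, of n] n h by (simp add: mult_left_mono)
    have x: "norm ?x \<le> R" "norm (?x + ?d) \<le> R"
      using good_pos[OF g, of n] good_pos[OF g, of "n + 1"] n pos_vel[OF h(2), of n] by auto
    define F where "F s = enp r (?x + s *\<^sub>R ?d)" for s
    have F': "(F has_real_derivative (- (ele r (?x + s *\<^sub>R ?d) \<bullet> ?d))) (at s)" for s
    proof -
      have "((\<lambda>s. ?x + s *\<^sub>R ?d) has_derivative (\<lambda>t. t *\<^sub>R ?d)) (at s)" by (auto intro!: derivative_eq_intros)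
      from has_derivative_compose[OF this good_potential[OF g, unfolded gderiv_def]]
      show ?thesis unfolding F_def[abs_def] has_field_derivative_def
        by (rule has_derivative_eq_rhs) (auto simp: inner_commute)
    qed
    obtain s where s: "0 < s" "s < 1" "F 1 - F 0 = (1 - 0) * (- (ele r (?x + s *\<^sub>R ?d) \<bullet> ?d))"
      using MVT2[of 0 1 F, OF _ F'] by auto
    have "?x + s *\<^sub>R ?d = (1 - s) *\<^sub>R ?x + s *\<^sub>R (?x + ?d)" by (simp add: vec_eq_iff field_simps)
    also have "\<dots> \<in> cball 0 R"
      by (rule convexD[OF convex_cball]) (use s x in auto)
    finally have xs: "norm (?x + s *\<^sub>R ?d) \<le> R" by simp
    have "norm (ele r (?x + s *\<^sub>R ?d) - ele r ?x) \<le> L' * norm (s *\<^sub>R ?d)"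
      using field_lipschitz[OF goodD_field3(2)[OF g] x(1) xs] by (simp add: L'_def)
    also have "\<dots> \<le> L' * (1 * (stp r * U))"
      using s d L'_nonneg by (simp only: norm_scaleR[of s]) (intro mult_left_mono mult_mono, auto)
    finally have lip: "norm (ele r (?x + s *\<^sub>R ?d) - ele r ?x) \<le> L' * (stp r * U)" by simp
    have "pen r (n + 1) - pen r n + stp r * (ele r ?x \<bullet> vel r n) = - ((ele r (?x + s *\<^sub>R ?d) - ele r ?x) \<bullet> ?d)"
      using s(3) pos_vel[OF h(2), of n] by (simp add: F_def pen_def inner_diff_left right_diff_distrib)
    then have "norm (pen r (n + 1) - pen r n + stp r * (ele r ?x \<bullet> vel r n)) \<le> norm (ele r (?x + s *\<^sub>R ?d) - ele r ?x) * norm ?d"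
      by (simp only: abs_minus_cancel real_norm_def Cauchy_Schwarz_ineq2)
    also have "\<dots> \<le> (L' * (stp r * U)) * (stp r * U)"
      using lip d L'_nonneg h U_ge by (intro mult_mono) auto
    finally show "norm (pen r (n + 1) - pen r n + stp r * (ele r ?x \<bullet> vel r n)) \<le> L' * U\<^sup>2 * (stp r)\<^sup>2"
      by (simp add: power2_eq_square algebra_simps)
  qed (use L'_nonneg in auto)
  moreover have "ubd (win 0 0) (\<lambda>r n. stp r * (ele r (pos r n) \<bullet> ((1/2) *\<^sub>R (vel r n - vel r (n - 1))))) (\<lambda>r n. (stp r)\<^sup>2)"
    by (intro ubd_prod_stp ubd_one_inner ubd_sub[OF ubd_ele] ubd_const_scaleR ubd_dvel') auto
  ultimately have "ubd (win 0 0) (\<lambda>r n. (pen r (n + 1) - pen r n + stp r * (ele r (pos r n) \<bullet> vel r n))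
      - stp r * (ele r (pos r n) \<bullet> ((1/2) *\<^sub>R (vel r n - vel r (n - 1))))) (\<lambda>r n. (stp r)\<^sup>2)"
    by (rule ubd_diff)
  then show ?thesis
    by (rule ubd_cong) (simp add: pow_def mvel_def inner_diff_right inner_add_right field_simps)
qed

lemma ubd_pen_shift:
  "ubd (win 1 (- int p)) (\<lambda>r n. pen r (n + int p) - pen r n + real p * stp r * pow r n) (\<lambda>r n. (stp r)\<^sup>2)"
proof (induction p)
  case 0
  show ?case by (simp add: ubd_zero)
next
  case (Suc p)
  have "ubd (win 1 (- int (Suc p))) (\<lambda>r n. (pen r (n + int p) - pen r n + real p * stp r * pow r n)
      + (pen r (n + int p + 1) - pen r (n + int p) + stp r * pow r (n + int p))
      - stp r * (pow r (n + int p) - pow r n)) (\<lambda>r n. (stp r)\<^sup>2)"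
    by (intro ubd_add ubd_diff ubd_sub[OF Suc] ubd_shift[OF ubd_pen_step] ubd_prod_stp ubd_sub[OF ubd_shift_diff[OF ubd_dpow]]) auto
  then show ?case by (rule ubd_cong) (simp add: algebra_simps)
qed

lemma ubd_pen_shift':
  "ubd (win (1 + int p) 0) (\<lambda>r n. pen r (n - int p) - pen r n - real p * stp r * pow r n) (\<lambda>r n. (stp r)\<^sup>2)"
proof -
  have 1: "ubd (win (1 + int p) 0) (\<lambda>r n. pen r (n + (- int p) + int p) - pen r (n + (- int p)) + real p * stp r * pow r (n + (- int p))) (\<lambda>r n. (stp r)\<^sup>2)"
    by (rule ubd_shift[OF ubd_pen_shift[of p]]) auto
  have 2: "ubd (win (1 + int p) 0) (\<lambda>r n. real p *\<^sub>R (stp r * (pow r (n - int p) - pow r n))) (\<lambda>r n. (stp r)\<^sup>2)"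
    by (intro ubd_const_scaleR ubd_prod_stp ubd_shift_diff' ubd_dpow)
  show ?thesis
    by (rule ubd_cong[OF ubd_diff[OF 2 1]]) (simp add: algebra_simps)
qed

text \<open>The stiff force does no work, and \<open>tdir\<close> cancels against \<open>dir\<close>
  by adjointness up to the error of \<open>dpot\<close>; only the electric power remains.\<close>

lemma ubd_mvel_dvel:
  "ubd (win 0 0) (\<lambda>r n. mvel r n \<bullet> (vel r n - vel r (n - 1)) - stp r * pow r n) (\<lambda>r n. (stp r)\<^sup>2)"
proof -
  have "ubd (win 0 0) (\<lambda>r n. stp r * (- (mvel r n \<bullet> (dpot r n - dirv r n)))) (\<lambda>r n. (stp r)\<^sup>2)"
    by (intro ubd_prod_stp ubd_minus ubd_one_inner ubd_mvel ubd_sq_stp ubd_dpot_dirv)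
  then show ?thesis
  proof (rule ubd_cong)
    fix r n assume "win 0 0 r n"
    then have "mvel r n \<bullet> (vel r n - vel r (n - 1)) = mvel r n \<bullet> ((stp r / eps r) *\<^sub>R (mvel r n \<times> b) + stp r *\<^sub>R frc r n)"
      by (subst good_step) (auto simp: win_def)
    also have "\<dots> = stp r * (mvel r n \<bullet> frc r n)"
      by (simp add: inner_add_right dot_cross_self)
    also have "mvel r n \<bullet> frc r n = pow r n - mvel r n \<bullet> (dpot r n - dirv r n)"
      using tdir_inner[of "pot r" "pos r n" "mvel r n" "mvel r n"]
      by (simp add: frc_def pow_def dirv_def inner_add_right inner_diff_right
          inner_commute[of "mvel r n" "tdir _ _ _"] inner_commute[of "mvel r n" "ele _ _"])
    finally show "mvel r n \<bullet> (vel r n - vel r (n - 1)) - stp r * pow r n = stp r * (- (mvel r n \<bullet> (dpot r n - dirv r n)))"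
      by (simp add: algebra_simps)
  qed
qed

text \<open>Every correction to the kinetic energy is a product of two velocity increments, hence \<open>O(h\<^sup>2)\<close>.\<close>

lemma kin_eq:
  assumes "stp r \<noteq> 0"
  shows "kin r k n = real (2 * k) * (vel r n \<bullet> vel r n)
    - (\<Sum>m<2 * k. (vel r n - vel r (n - int (m + 1))) \<bullet> (vel r n - vel r (n - int (m + 1) + 2 * int k)))"
proof -
  have tele: "(\<Sum>m<2 * k. vel r (N - 1 - int m)) = (1 / stp r) *\<^sub>R (pos r N - pos r (N - 2 * int k))" for N
  proof -
    have "(\<Sum>m<2 * k. vel r (N - 1 - int m)) = (1 / stp r) *\<^sub>R (\<Sum>m<2 * k. pos r (N - int m) - pos r (N - 1 - int m))"
      by (simp add: vel_def scaleR_sum_right algebra_simps)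
    then show ?thesis using sum_telescope_shift[of "pos r" N "2 * k"] by (simp add: sum_subtractf)
  qed
  have "(1 / stp r) *\<^sub>R zdiff (pos r) k n = (\<Sum>m<2 * k. vel r (n - 1 - int m)) + (\<Sum>m<2 * k. vel r (n + 2 * int k - 1 - int m))"
    unfolding tele by (simp add: zdiff_def scaleR_add_right[symmetric])
  then have "(1 / stp r) * (vel r n \<bullet> zdiff (pos r) k n) =
      (\<Sum>m<2 * k. vel r n \<bullet> vel r (n - int (m + 1)) + vel r n \<bullet> vel r (n - int (m + 1) + 2 * int k))"
    by (simp add: inner_scaleR_right[symmetric] inner_add_right inner_sum_right sum.distrib algebra_simps del: inner_scaleR_right)
  then have "kin r k n = (\<Sum>m<2 * k. vel r n \<bullet> vel r (n - int (m + 1)) + vel r n \<bullet> vel r (n - int (m + 1) + 2 * int k)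
      - vel r (n - int (m + 1)) \<bullet> vel r (n - int (m + 1) + 2 * int k))"
    by (simp add: kin_def sum_subtractf algebra_simps)
  also have "\<dots> = (\<Sum>m<2 * k. vel r n \<bullet> vel r n
      - (vel r n - vel r (n - int (m + 1))) \<bullet> (vel r n - vel r (n - int (m + 1) + 2 * int k)))"
    by (intro sum.cong refl) (simp add: inner_diff_left inner_diff_right inner_commute)
  finally show ?thesis by (simp add: sum_subtractf)
qed

text \<open>\<open>vel r n\<close> belongs to half a step after \<open>n\<close>, so its square
  differs from that of \<open>mvel r n\<close> by \<open>stp r * pow r n\<close> up to second
  order.\<close>

lemma ubd_kin:
  assumes "k \<le> 4"
  shows "ubd (win 8 (-8)) (\<lambda>r n. kin r k n - real (2 * k) * ((norm (mvel r n))\<^sup>2 + stp r * pow r n)) (\<lambda>r n. (stp r)\<^sup>2)"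
proof -
  have d: "ubd (win 8 (-8)) (\<lambda>r n. vel r n - vel r (n - int (m + 1))) (\<lambda>r n. stp r)" if "m < 2 * k" for m
    using ubd_minus[OF ubd_sub[OF ubd_shift_diff'[OF ubd_dvel', of "m + 1"], of 8 "-8"]] that assms by simp
  have d': "ubd (win 8 (-8)) (\<lambda>r n. vel r n - vel r (n - int (m + 1) + 2 * int k)) (\<lambda>r n. stp r)" if "m < 2 * k" for m
  proof -
    have "ubd (win 8 (-8)) (\<lambda>r n. vel r (n + int (2 * k - (m + 1))) - vel r n) (\<lambda>r n. stp r)"
      using that assms by (intro ubd_sub[OF ubd_shift_diff[OF ubd_dvel']]) auto
    from ubd_minus[OF this] show ?thesis using that by (simp add: of_nat_diff algebra_simps)
  qed
  have 1: "ubd (win 8 (-8)) (\<lambda>r n. \<Sum>m<2 * k. (vel r n - vel r (n - int (m + 1))) \<bullet> (vel r n - vel r (n - int (m + 1) + 2 * int k))) (\<lambda>r n. (stp r)\<^sup>2)"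
  proof (rule ubd_sum)
    fix m assume "m \<in> {..<2 * k}"
    then show "ubd (win 8 (-8)) (\<lambda>r n. (vel r n - vel r (n - int (m + 1))) \<bullet> (vel r n - vel r (n - int (m + 1) + 2 * int k))) (\<lambda>r n. (stp r)\<^sup>2)"
      using ubd_inner[OF d[of m] d'[of m]] by (simp add: power2_eq_square)
  qed auto
  have "ubd (win 0 0) (\<lambda>r n. (1/4) *\<^sub>R ((vel r n - vel r (n - 1)) \<bullet> (vel r n - vel r (n - 1)))) (\<lambda>r n. stp r * stp r)"
    by (intro ubd_const_scaleR ubd_inner ubd_dvel')
  then have 2: "ubd (win 0 0) (\<lambda>r n. (1/4) *\<^sub>R ((vel r n - vel r (n - 1)) \<bullet> (vel r n - vel r (n - 1)))) (\<lambda>r n. (stp r)\<^sup>2)"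
    by (simp add: power2_eq_square)
  have 3: "ubd (win 8 (-8)) (\<lambda>r n. real (2 * k) *\<^sub>R ((mvel r n \<bullet> (vel r n - vel r (n - 1)) - stp r * pow r n)
      + (1/4) *\<^sub>R ((vel r n - vel r (n - 1)) \<bullet> (vel r n - vel r (n - 1))))) (\<lambda>r n. (stp r)\<^sup>2)"
    by (intro ubd_const_scaleR ubd_sub[OF ubd_add[OF ubd_mvel_dvel 2]]) auto
  show ?thesis
  proof (rule ubd_cong[OF ubd_diff[OF 3 1]])
    fix r n assume "win 8 (-8) r n"
    then have "stp r \<noteq> 0" using goodD(11) by (auto simp: win_def)
    have vv: "vel r n \<bullet> vel r n = (norm (mvel r n))\<^sup>2 + mvel r n \<bullet> (vel r n - vel r (n - 1))
        + (1/4) * ((vel r n - vel r (n - 1)) \<bullet> (vel r n - vel r (n - 1)))"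
      unfolding power2_norm_eq_inner mvel_def
      by (simp add: inner_add_left inner_add_right inner_diff_left inner_diff_right inner_commute[of "vel r (n - 1)" "vel r n"] field_simps)
    have gen: "K * (N + a + 1/4 * q) - S - K * (N + p) = K * ((a - p) + 1/4 * q) - S" for K N a q S p :: real
      by (simp add: algebra_simps)
    show "kin r k n - real (2 * k) * ((norm (mvel r n))\<^sup>2 + stp r * pow r n) =
      real (2 * k) *\<^sub>R ((mvel r n \<bullet> (vel r n - vel r (n - 1)) - stp r * pow r n)
      + (1/4) *\<^sub>R ((vel r n - vel r (n - 1)) \<bullet> (vel r n - vel r (n - 1))))
      - (\<Sum>m<2 * k. (vel r n - vel r (n - int (m + 1))) \<bullet> (vel r n - vel r (n - int (m + 1) + 2 * int k)))"
      unfolding kin_eq[OF \<open>stp r \<noteq> 0\<close>] vv real_scaleR_def by (rule gen)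
  qed
qed

text \<open>The first-order terms cancel. Both the one-step velocity in \<open>kin\<close> and the
  potential window, which runs from \<open>n - 2 * k + 1\<close> to \<open>n + 2 * k\<close>, are
  centred half a step after \<open>n\<close>; they contribute \<open>2 * k * h * pow\<close> with
  opposite signs.\<close>

lemma ubd_menergy:
  assumes k: "k \<le> 4"
  shows "ubd (win 9 (-9)) (\<lambda>r n. menergy r k n - real (4 * k) * energy r n) (\<lambda>r n. (stp r)\<^sup>2)"
proof -
  have 1: "ubd (win 9 (-9)) (\<lambda>r n. kin r k n - real (2 * k) * ((norm (mvel r n))\<^sup>2 + stp r * pow r n)) (\<lambda>r n. (stp r)\<^sup>2)"
    by (rule ubd_sub[OF ubd_kin[OF k]]) auto
  have W: "ubd (win 9 (-9)) (\<lambda>r n. wron r (2 * int i + 1) (n - int l)) (\<lambda>r n. stp r)" if "i < k" "l < 2 * i + 1" for i l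
  proof -
    have "ubd (win 9 (-9)) (\<lambda>r n. wron r (int (2 * i + 1)) (n + (- int l))) (\<lambda>r n. stp r)"
      using that k by (intro ubd_shift[OF ubd_wron]) auto
    then show ?thesis by (simp add: add.commute)
  qed
  have 2: "ubd (win 9 (-9)) (\<lambda>r n. 2 *\<^sub>R (stp r * (\<Sum>i<k. \<Sum>l<2 * i + 1. wron r (2 * int i + 1) (n - int l)))) (\<lambda>r n. (stp r)\<^sup>2)"
    using W by (intro ubd_const_scaleR ubd_prod_stp ubd_sum) (auto intro: nn_stp)
  have P: "ubd (win 9 (-9)) (\<lambda>r n. pen r (n + 2 * int k - int l) - pen r n + (real (2 * k) - real l) * (stp r * pow r n)) (\<lambda>r n. (stp r)\<^sup>2)"
    if "l < 4 * k" for l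
  proof (cases "l \<le> 2 * k")
    case True
    have "ubd (win 9 (-9)) (\<lambda>r n. pen r (n + int (2 * k - l)) - pen r n + real (2 * k - l) * stp r * pow r n) (\<lambda>r n. (stp r)\<^sup>2)"
      using k by (intro ubd_sub[OF ubd_pen_shift]) auto
    then show ?thesis using True by (simp add: of_nat_diff algebra_simps)
  next
    case False
    have "ubd (win 9 (-9)) (\<lambda>r n. pen r (n - int (l - 2 * k)) - pen r n - real (l - 2 * k) * stp r * pow r n) (\<lambda>r n. (stp r)\<^sup>2)"
      using k that by (intro ubd_sub[OF ubd_pen_shift']) auto
    then show ?thesis using False by (simp add: of_nat_diff algebra_simps)
  qed
  have 3: "ubd (win 9 (-9)) (\<lambda>r n. \<Sum>l<4 * k. pen r (n + 2 * int k - int l) - pen r n + (real (2 * k) - real l) * (stp r * pow r n)) (\<lambda>r n. (stp r)\<^sup>2)"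
    using P by (intro ubd_sum) auto
  have arith: "(\<Sum>l<4 * k. real (2 * k) - real l) = real (2 * k)"
    unfolding sum_arith by (simp add: field_simps)
  show ?thesis
  proof (rule ubd_cong[OF ubd_add[OF ubd_add[OF 1 2] 3]])
    fix r n
    have "(\<Sum>l<4 * k. pen r (n + 2 * int k - int l) - pen r n + (real (2 * k) - real l) * (stp r * pow r n))
      = (\<Sum>l<4 * k. pen r (n + 2 * int k - int l)) - real (4 * k) * pen r n + real (2 * k) * (stp r * pow r n)"
      unfolding sum.distrib sum_subtractf sum_distrib_right[symmetric] arith[unfolded sum_subtractf] by simp
    then show "menergy r k n - real (4 * k) * energy r n = kin r k n - real (2 * k) * ((norm (mvel r n))\<^sup>2 + stp r * pow r n)
      + 2 *\<^sub>R (stp r * (\<Sum>i<k. \<Sum>l<2 * i + 1. wron r (2 * int i + 1) (n - int l)))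
      + (\<Sum>l<4 * k. pen r (n + 2 * int k - int l) - pen r n + (real (2 * k) - real l) * (stp r * pow r n))"
      unfolding menergy_def energy_def by (simp add: algebra_simps)
  qed
qed

text \<open>Bridges the bounded number of steps near the ends of a run, for which the difference
  quotient lacks neighbours.\<close>

lemma ubd_energy_step: "ubd (win 0 (-1)) (\<lambda>r n. energy r (n + 1) - energy r n) (\<lambda>r n. (stp r)\<^sup>2)"
proof -
  let ?d = "\<lambda>r n. vel r n - vel r (n - 1)" and ?m = "\<lambda>r n. mvel r (n + 1) - mvel r n"
  have m: "ubd (win 0 (-1)) ?m (\<lambda>r n. stp r)"
    using ubd_shift[OF ubd_dmvel, of 0 1 "-1"] by simp
  have d1: "ubd (win 0 (-1)) (\<lambda>r n. ?d r (n + 1)) (\<lambda>r n. stp r)"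
    using ubd_shift[OF ubd_dvel', of 0 1 "-1"] by simp
  have sq: "ubd (win 0 (-1)) (\<lambda>r n. f r n \<bullet> g r n) (\<lambda>r n. (stp r)\<^sup>2)"
    if "ubd (win 0 (-1)) f (\<lambda>r n. stp r)" "ubd (win 0 (-1)) g (\<lambda>r n. stp r)" for f g :: "run \<Rightarrow> int \<Rightarrow> real^3"
    using ubd_inner[OF that] by (simp add: power2_eq_square)
  have 1: "ubd (win 0 (-1)) (\<lambda>r n. mvel r n \<bullet> ?d r n - stp r * pow r n) (\<lambda>r n. (stp r)\<^sup>2)"
    by (rule ubd_sub[OF ubd_mvel_dvel]) auto
  have 2: "ubd (win 0 (-1)) (\<lambda>r n. mvel r (n + 1) \<bullet> ?d r (n + 1) - stp r * pow r (n + 1)) (\<lambda>r n. (stp r)\<^sup>2)"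
    using ubd_shift[OF ubd_mvel_dvel, of 0 1 "-1"] by simp
  have 3: "ubd (win 0 (-1)) (\<lambda>r n. stp r * (pow r (n + 1) - pow r n)) (\<lambda>r n. (stp r)\<^sup>2)"
    using ubd_shift[OF ubd_dpow, of 0 1 "-1"] by (intro ubd_prod_stp) simp
  have 4: "ubd (win 0 (-1)) (\<lambda>r n. pen r (n + 1) - pen r n + stp r * pow r n) (\<lambda>r n. (stp r)\<^sup>2)"
    by (rule ubd_sub[OF ubd_pen_step]) auto
  have "ubd (win 0 (-1)) (\<lambda>r n. (1/2) *\<^sub>R (?m r n \<bullet> ?m r n) + (1/2) *\<^sub>R ((mvel r n \<bullet> ?d r n - stp r * pow r n)
      + (mvel r (n + 1) \<bullet> ?d r (n + 1) - stp r * pow r (n + 1)) - ?m r n \<bullet> ?d r (n + 1) + stp r * (pow r (n + 1) - pow r n))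
      + (pen r (n + 1) - pen r n + stp r * pow r n)) (\<lambda>r n. (stp r)\<^sup>2)"
    by (intro ubd_add ubd_diff ubd_const_scaleR sq m d1 1 2 3 4)
  then show ?thesis
  proof (rule ubd_cong)
    fix r n
    have "?m r n = (1/2) *\<^sub>R (?d r (n + 1) + ?d r n)"
      by (simp add: mvel_def vec_eq_iff field_simps)
    then have *: "mvel r n \<bullet> ?m r n = (mvel r n \<bullet> ?d r (n + 1) + mvel r n \<bullet> ?d r n) / 2"
      by (simp only: inner_scaleR_right inner_add_right)
    have sq: "(norm (mvel r (n + 1)))\<^sup>2 / 2 - (norm (mvel r n))\<^sup>2 / 2 = mvel r n \<bullet> ?m r n + (?m r n \<bullet> ?m r n) / 2"
      unfolding power2_norm_eq_inner
      by (simp add: inner_diff_left inner_diff_right inner_commute[of "mvel r (1 + n)" "mvel r n"]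
          inner_commute[of "mvel r (n + 1)" "mvel r n"] field_simps)
    have dm: "?m r n \<bullet> ?d r (n + 1) = mvel r (n + 1) \<bullet> ?d r (n + 1) - mvel r n \<bullet> ?d r (n + 1)"
      by (simp only: inner_diff_left)
    have gen: "m1 / 2 + P1 - (m0 / 2 + P0) = 1/2 * mm + 1/2 * ((b0 - p0) + (c1 - p1) - (c1 - a) + (p1 - p0)) + (P1 - P0 + p0)"
      if "m1 / 2 - m0 / 2 = (a + b0) / 2 + mm / 2" for m0 m1 mm P0 P1 a b0 c1 p0 p1 :: real
      using that by (simp add: field_simps)
    show "energy r (n + 1) - energy r n = (1/2) *\<^sub>R (?m r n \<bullet> ?m r n) + (1/2) *\<^sub>R ((mvel r n \<bullet> ?d r n - stp r * pow r n)
      + (mvel r (n + 1) \<bullet> ?d r (n + 1) - stp r * pow r (n + 1)) - ?m r n \<bullet> ?d r (n + 1) + stp r * (pow r (n + 1) - pow r n))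
      + (pen r (n + 1) - pen r n + stp r * pow r n)"
      unfolding energy_def dm real_scaleR_def right_diff_distrib[of "stp r"] by (rule gen[OF sq[unfolded *]])
  qed
qed

lemma energy_drift:
  "\<exists>C\<ge>0. \<forall>r n. good r \<longrightarrow> 0 \<le> n \<longrightarrow> n \<le> fin r \<longrightarrow>
     \<bar>energy r n - energy r 0\<bar> \<le> C * ((stp r)\<^sup>2 + real_of_int n * stp r ^ 9)"
proof -
  obtain C1 where C1: "0 \<le> C1" "\<And>r n. win 0 (-1) r n \<Longrightarrow> norm (energy r (n + 1) - energy r n) \<le> C1 * (stp r)\<^sup>2"
    using ubd_energy_step by (rule ubdE) blast
  have "ubd (win 9 (-9)) (\<lambda>r n. stencil (\<lambda>k. menergy r k n - real (4 * k) * energy r n)) (\<lambda>r n. (stp r)\<^sup>2)"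
    by (rule ubd_stencil) (rule ubd_menergy, simp)
  \<comment> \<open>The quotient differentiates linear functions exactly, so the weights applied to
    \<open>4 * k\<close> give 2.\<close>
  then have "ubd (win 9 (-9)) (\<lambda>r n. stencil (\<lambda>k. menergy r k n) - 2 * energy r n) (\<lambda>r n. (stp r)\<^sup>2)"
    by (rule ubd_cong) (simp add: stencil_def field_simps)
  then obtain C2 where C2: "0 \<le> C2" "\<And>r n. win 9 (-9) r n \<Longrightarrow>
      norm (stencil (\<lambda>k. menergy r k n) - 2 * energy r n) \<le> C2 * (stp r)\<^sup>2"
    by (rule ubdE) blast
  have "ubd (win 7 (-7)) (\<lambda>r n. stencil (\<lambda>k. menergy r k n) - stencil (\<lambda>k. menergy r k (n - 1))) (\<lambda>r n. stp r ^ 9)"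
    by (rule ubd_cong[OF ubd_stencil_force])
       (simp add: stencil_diff[symmetric] menergy_diff[symmetric] win_def)
  then obtain C3 where C3: "0 \<le> C3" "\<And>r n. win 7 (-7) r n \<Longrightarrow>
      norm (stencil (\<lambda>k. menergy r k n) - stencil (\<lambda>k. menergy r k (n - 1))) \<le> C3 * stp r ^ 9"
    by (rule ubdE) blast
  define C where "C = 18 * C1 + C2 + C3"
  have "\<bar>energy r n - energy r 0\<bar> \<le> C * ((stp r)\<^sup>2 + real_of_int n * stp r ^ 9)"
    if g: "good r" and n: "0 \<le> n" "n \<le> fin r" for r n
  proof -
    note h = goodD(3)[OF g]
    have few: "\<bar>energy r (m + int k) - energy r m\<bar> \<le> real k * (C1 * (stp r)\<^sup>2)" if "0 \<le> m" "m + int k \<le> fin r" for m k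
      using that
    proof (induction k)
      case (Suc k)
      have "norm (energy r (m + int k + 1) - energy r (m + int k)) \<le> C1 * (stp r)\<^sup>2"
        using Suc.prems g by (intro C1(2)) (simp add: win_def)
      moreover have "\<bar>energy r (m + int k) - energy r m\<bar> \<le> real k * (C1 * (stp r)\<^sup>2)"
        using Suc by simp
      moreover have eq: "m + int (Suc k) = m + int k + 1" by simp
      ultimately show ?case unfolding eq by (simp add: distrib_right)
    qed simp
    have few': "\<bar>energy r n' - energy r m\<bar> \<le> real K * (C1 * (stp r)\<^sup>2)"
      if "0 \<le> m" "m \<le> n'" "n' \<le> fin r" "n' - m \<le> int K" for m n' K
    proof -
      have "\<bar>energy r n' - energy r m\<bar> \<le> real (nat (n' - m)) * (C1 * (stp r)\<^sup>2)"
        using few[of m "nat (n' - m)"] that by simp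
      also have "\<dots> \<le> real K * (C1 * (stp r)\<^sup>2)"
        using that C1(1) by (intro mult_right_mono) auto
      finally show ?thesis .
    qed
    have nn: "0 \<le> C1 * (stp r)\<^sup>2" "0 \<le> C2 * (stp r)\<^sup>2" "0 \<le> C3 * (stp r)\<^sup>2"
      "0 \<le> C1 * (real_of_int n * stp r ^ 9)" "0 \<le> C2 * (real_of_int n * stp r ^ 9)" "0 \<le> C3 * (real_of_int n * stp r ^ 9)"
      using C1(1) C2(1) C3(1) h n by simp_all
    have Cexp: "C * ((stp r)\<^sup>2 + real_of_int n * stp r ^ 9) = 18 * (C1 * (stp r)\<^sup>2) + C2 * (stp r)\<^sup>2 + C3 * (stp r)\<^sup>2
        + (18 * (C1 * (real_of_int n * stp r ^ 9)) + C2 * (real_of_int n * stp r ^ 9) + C3 * (real_of_int n * stp r ^ 9))"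
      by (simp add: C_def algebra_simps)
    show ?thesis
    proof (cases "n \<le> 18")
      case True
      then have "\<bar>energy r n - energy r 0\<bar> \<le> 18 * (C1 * (stp r)\<^sup>2)"
        using few'[of 0 n 18] n by simp
      then show ?thesis unfolding Cexp using nn by linarith
    next
      case False
      \<comment> \<open>The comparison with the energy needs nine steps of distance from both ends;
        the at most nine steps left over on either side are covered by \<open>few'\<close>.\<close>
      define m where "m = min n (fin r - 9)"
      have m: "9 \<le> m" "m \<le> fin r - 9" "m \<le> n" "n - m \<le> 9" using False n by (auto simp: m_def)
      have drift: "\<bar>stencil (\<lambda>k. menergy r k (9 + int j)) - stencil (\<lambda>k. menergy r k 9)\<bar> \<le> real j * (C3 * stp r ^ 9)"
        if "9 + int j \<le> m" for j
        using that
      proof (induction j)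
        case (Suc j)
        have "norm (stencil (\<lambda>k. menergy r k (9 + int j + 1)) - stencil (\<lambda>k. menergy r k (9 + int j + 1 - 1))) \<le> C3 * stp r ^ 9"
          using Suc.prems g m by (intro C3(2)) (simp add: win_def)
        moreover have "\<bar>stencil (\<lambda>k. menergy r k (9 + int j)) - stencil (\<lambda>k. menergy r k 9)\<bar> \<le> real j * (C3 * stp r ^ 9)"
          using Suc by simp
        moreover have eq: "9 + int (Suc j) = 9 + int j + 1" by simp
        ultimately show ?case unfolding eq by (simp add: distrib_right)
      qed simp
      have "\<bar>stencil (\<lambda>k. menergy r k m) - stencil (\<lambda>k. menergy r k 9)\<bar> \<le> real (nat (m - 9)) * (C3 * stp r ^ 9)"
        using drift[of "nat (m - 9)"] m by simp
      also have "\<dots> \<le> real_of_int n * (C3 * stp r ^ 9)"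
        using m C3(1) h by (intro mult_right_mono) auto
      also have "\<dots> = C3 * (real_of_int n * stp r ^ 9)" by simp
      finally have 1: "\<bar>stencil (\<lambda>k. menergy r k m) - stencil (\<lambda>k. menergy r k 9)\<bar> \<le> C3 * (real_of_int n * stp r ^ 9)" .
      have 2: "\<bar>stencil (\<lambda>k. menergy r k m) - 2 * energy r m\<bar> \<le> C2 * (stp r)\<^sup>2"
        "\<bar>stencil (\<lambda>k. menergy r k 9) - 2 * energy r 9\<bar> \<le> C2 * (stp r)\<^sup>2"
        using C2(2)[of r m] C2(2)[of r 9] g m by (simp_all add: win_def)
      have 3: "\<bar>energy r n - energy r m\<bar> \<le> 9 * (C1 * (stp r)\<^sup>2)" "\<bar>energy r 9 - energy r 0\<bar> \<le> 9 * (C1 * (stp r)\<^sup>2)"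
        using few'[of m n 9] few'[of 0 9 9] m n by simp_all
      show ?thesis unfolding Cexp using 1 2 3 nn by linarith
    qed
  qed
  moreover have "0 \<le> C" using C1 C2 C3 by (simp add: C_def)
  ultimately show ?thesis by blast
qed

section \<open>Removing the provisional velocity bound\<close>

lemma norm_vel_step:
  assumes "vel r n - vel r (n - 1) = (stp r / eps r) *\<^sub>R (mvel r n \<times> b) + stp r *\<^sub>R frc r n" "0 < stp r"
  shows "norm (vel r n) \<le> norm (vel r (n - 1)) + stp r * norm (frc r n)"
proof -
  let ?u = "vel r n" and ?w = "vel r (n - 1)"
  \<comment> \<open>The stiff force is orthogonal to \<open>mvel\<close>, half the sum of both
    velocities, so it drops out of the kinetic balance and no factor \<open>h / eps\<close>
    arises.\<close>
  have "(?u - ?w) \<bullet> (?u + ?w) = stp r * (frc r n \<bullet> (?u + ?w))"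
  proof -
    have "?u + ?w = 2 *\<^sub>R mvel r n" by (simp add: mvel_def)
    then show ?thesis
      unfolding assms(1) by (simp add: inner_add_left dot_cross_self)
  qed
  then have "(norm ?u)\<^sup>2 - (norm ?w)\<^sup>2 = stp r * (frc r n \<bullet> (?u + ?w))"
    unfolding power2_norm_eq_inner by (simp add: inner_diff_left inner_add_right inner_commute[of ?w ?u])
  also have "\<dots> \<le> stp r * (norm (frc r n) * (norm ?u + norm ?w))"
    using assms(2) norm_triangle_ineq[of ?u ?w]
    by (intro mult_left_mono order_trans[OF norm_cauchy_schwarz]) auto
  finally have "(norm ?u + norm ?w) * (norm ?u - norm ?w) \<le> (norm ?u + norm ?w) * (stp r * norm (frc r n))"
    by (simp add: power2_eq_square algebra_simps)
  then show ?thesis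
  proof (cases "norm ?u + norm ?w = 0")
    case True
    then have "norm ?u = 0" using norm_ge_zero[of ?u] norm_ge_zero[of ?w] by linarith
    then show ?thesis using assms(2) by simp
  next
    case False
    then have "0 < norm ?u + norm ?w" using norm_ge_zero[of ?u] norm_ge_zero[of ?w] by linarith
    then show ?thesis using \<open>_ \<le> (norm ?u + norm ?w) * (stp r * norm (frc r n))\<close>
      by (simp only: mult_le_cancel_left_pos)
  qed
qed

text \<open>As \<open>good\<close>, but with the velocities bounded at -1 only, where the bounds can
  be read off from the starting data.\<close>

definition started :: "real \<Rightarrow> run \<Rightarrow> bool" where
  "started V r \<longleftrightarrow> 0 < eps r \<and> eps r \<le> (stp r)\<^sup>2 \<and> 0 < stp r \<and> stp r \<le> 1 \<and>
     smooth_field (pot r) \<and> derivs_bounded_by M (pot r) \<and>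
     smooth_field (ele r) \<and> derivs_bounded_by M (ele r) \<and> (\<forall>y. GDERIV (enp r) y :> - ele r y) \<and>
     (\<forall>n\<in>{-1..fin r + 1}. norm (pos r n) \<le> R) \<and>
     (\<forall>n\<in>{0..fin r}. vel r n - vel r (n - 1) = (stp r / eps r) *\<^sub>R (mvel r n \<times> b) + stp r *\<^sub>R frc r n) \<and>
     0 \<le> fin r \<and> real_of_int (fin r) * stp r \<le> c / eps r \<and>
     norm (vel r (-1)) \<le> V \<and> norm (vel r (-1) \<times> b) \<le> U * stp r"

text \<open>Continuation along the run: velocities up to \<open>U\<close> make a truncated run good,
  which improves the bound to \<open>U - 1\<close>; and a single step is too short to bridge the gap
  of 1.\<close>

lemma started_good:
  assumes U: "V + 2 * R + 2 * (\<bar>M 0 R\<bar> + 1) + 2 \<le> U"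
  shows "\<exists>h0>0. \<forall>r. started V r \<longrightarrow> stp r \<le> h0 \<longrightarrow> good r"
proof -
  obtain h1 where h1: "0 < h1" "\<And>r n. good r \<Longrightarrow> stp r \<le> h1 \<Longrightarrow> \<bar>vel r (-1) \<bullet> b\<bar> \<le> V \<Longrightarrow> -1 \<le> n \<Longrightarrow> n \<le> fin r \<Longrightarrow>
     \<bar>vel r n \<bullet> b\<bar> \<le> V + 2 * R + 2 * (\<bar>M 0 R\<bar> + 1)"
    using parallel_velocity_bound[of V] by blast
  obtain C where C: "0 \<le> C" "\<And>r n. win (-1) 0 r n \<Longrightarrow> norm (vel r n \<times> b) \<le> C * stp r"
    using ubd_perp by (rule ubdE) blast
  define q where "q = 3 * L + L'"
  \<comment> \<open>The three entries give the parallel bound, a perpendicular velocity of at most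
    1, and the exclusion of a speed jump by more than 1 in one step.\<close>
  define h0 where "h0 = min h1 (min (1 / (C + 1)) (1 / (2 * (2 * (q * U) + L + 1))))"
  have q: "0 \<le> q" using L_nonneg L'_nonneg by (simp add: q_def)
  then have qU: "0 \<le> q * U" using U_ge by simp
  have h0: "0 < h0" "h0 \<le> h1" "h0 * (C + 1) \<le> 1" "h0 * (2 * (q * U) + L + 1) \<le> 1 / 2"
  proof -
    show "0 < h0" using h1 C(1) qU L_nonneg by (simp add: h0_def add_nonneg_pos)
    show "h0 \<le> h1" by (simp add: h0_def)
    have "h0 \<le> 1 / (C + 1)" by (simp add: h0_def)
    then show "h0 * (C + 1) \<le> 1" using C(1) by (simp add: field_simps)
    have "h0 \<le> 1 / (2 * (2 * (q * U) + L + 1))" by (simp add: h0_def)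
    then show "h0 * (2 * (q * U) + L + 1) \<le> 1 / 2" using qU L_nonneg by (simp add: field_simps add_nonneg_pos)
  qed
  \<comment> \<open>The scheme is implicit, so the force depends on the new velocity. For a speed
    jump \<open>d\<close> larger than 1 it is bounded by a multiple of \<open>d\<close>, and a small
    step cannot have caused such a jump.\<close>
  have absorb: "q * (U + d / 2) + L \<le> (2 * (q * U) + L + 1) * d" if "1 < d" for d
  proof -
    have "q * U * 1 \<le> q * U * d" "L * 1 \<le> L * d"
      using that qU L_nonneg by (intro mult_left_mono; simp)+
    moreover have "q * 1 * d \<le> q * U * d"
      using that q U_ge by (intro mult_right_mono mult_left_mono) simp_all
    moreover have "0 \<le> q * d" using that q by simp
    moreover have "q * (U + d / 2) + L = q * U + q * d / 2 + L"
      "(2 * (q * U) + L + 1) * d = 2 * (q * U * d) + L * d + d"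
      by (simp_all add: algebra_simps)
    ultimately show ?thesis using that by linarith
  qed
  have "good r" if r: "started V r" "stp r \<le> h0" for r
  proof -
    note S = r(1)[unfolded started_def]
    \<comment> \<open>The same run, declared to end at step \<open>m\<close>; velocities and forces
      do not depend on the last index.\<close>
    define tr where "tr m = Run (eps r) (stp r) (pot r) (ele r) (enp r) (pos r) m" for m
    have sel: "eps (tr m) = eps r" "stp (tr m) = stp r" "pot (tr m) = pot r" "ele (tr m) = ele r" "enp (tr m) = enp r"
      "pos (tr m) = pos r" "fin (tr m) = m" for m
      by (simp_all add: tr_def)
    have vel_tr: "vel (tr m) = vel r" for m by (rule ext) (simp add: vel_def sel)
    have mvel_tr: "mvel (tr m) = mvel r" for m by (rule ext) (simp add: mvel_def vel_tr)
    have frc_tr: "frc (tr m) = frc r" for m by (rule ext) (simp add: frc_def dpot_def mvel_tr sel)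
    have good_tr: "good (tr m)" if "m \<le> fin r" "\<And>n. -1 \<le> n \<Longrightarrow> n \<le> m \<Longrightarrow> norm (vel r n) \<le> U" for m
    proof -
      have "real_of_int m * stp r \<le> real_of_int (fin r) * stp r"
        using that(1) S by (intro mult_right_mono) auto
      also have "\<dots> \<le> c / eps r" using S by auto
      finally have "real_of_int m * stp r \<le> c / eps r" .
      then show ?thesis
        using S that unfolding good_def sel vel_tr mvel_tr frc_tr by auto
    qed
    have bound: "norm (vel r n) \<le> U - 1" if "-1 \<le> n" "n \<le> m" "m \<le> fin r" "good (tr m)" for n m
    proof -
      have "\<bar>vel (tr m) n \<bullet> b\<bar> \<le> V + 2 * R + 2 * (\<bar>M 0 R\<bar> + 1)"
        using that r(2) h0(2) S abs_inner_b_le[of "vel r (-1)"] by (intro h1(2)) (auto simp: sel vel_tr)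
      moreover have "norm (vel (tr m) n \<times> b) \<le> C * stp (tr m)"
        using that by (intro C(2)) (auto simp: win_def sel)
      moreover have "C * stp r \<le> 1"
      proof -
        have "C * stp r \<le> (C + 1) * h0" using r(2) S C(1) by (intro mult_mono) auto
        then show ?thesis using h0(3) by (simp add: mult.commute)
      qed
      ultimately show ?thesis
        using norm_decomp[of "vel r n"] U by (simp add: sel vel_tr)
    qed
    have "\<forall>n. -1 \<le> n \<longrightarrow> n \<le> int j - 1 \<longrightarrow> norm (vel r n) \<le> U - 1" if "int j - 1 \<le> fin r" for j
      using that
    proof (induction j)
      case 0
      have "norm (vel r (-1)) \<le> U - 1" using S U R_nonneg by auto
      moreover have "n = -1" if "-1 \<le> n" "n \<le> int 0 - 1" for n using that by simp
      ultimately show ?case by blast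
    next
      case (Suc j)
      let ?m = "int j"
      have m: "0 \<le> ?m" "?m \<le> fin r" using Suc.prems by auto
      have IH: "norm (vel r n) \<le> U - 1" if "-1 \<le> n" "n < ?m" for n
        using Suc that by simp
      have step: "norm (vel r ?m) \<le> norm (vel r (?m - 1)) + stp r * norm (frc r ?m)"
        using S m by (intro norm_vel_step) auto
      have "norm (frc r ?m) \<le> q * norm (mvel r ?m) + L"
        unfolding q_def L'_def using S m R_nonneg
        by (intro norm_frc_le[where R = R])
           (auto simp: L_def intro: field_bound_lower[OF field_bound_derivs[where m = 4]])
      also have "norm (mvel r ?m) \<le> (norm (vel r ?m) + norm (vel r (?m - 1))) / 2"
        using norm_triangle_ineq[of "vel r ?m" "vel r (?m - 1)"] by (simp add: mvel_def)
      finally have F: "norm (frc r ?m) \<le> q * ((norm (vel r ?m) + norm (vel r (?m - 1))) / 2) + L"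
        using q by (auto intro: mult_left_mono)
      have "norm (vel r ?m) \<le> U"
      proof (rule ccontr)
        assume neg: "\<not> norm (vel r ?m) \<le> U"
        let ?D = "norm (vel r ?m) - norm (vel r (?m - 1))"
        have w: "norm (vel r (?m - 1)) \<le> U - 1" using IH[of "?m - 1"] m by simp
        have D: "1 < ?D" using neg w by linarith
        have "(norm (vel r ?m) + norm (vel r (?m - 1))) / 2 \<le> U + ?D / 2" using w by (simp add: field_simps)
        then have "norm (frc r ?m) \<le> q * (U + ?D / 2) + L"
          by (intro order_trans[OF F] add_right_mono mult_left_mono q)
        also have "\<dots> \<le> (2 * (q * U) + L + 1) * ?D" by (rule absorb[OF D])
        finally have "stp r * norm (frc r ?m) \<le> h0 * ((2 * (q * U) + L + 1) * ?D)"
          using r(2) S h0(1) by (intro mult_mono) auto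
        also have "\<dots> \<le> 1 / 2 * ?D"
          using mult_right_mono[OF h0(4), of ?D] D by (simp add: mult.assoc)
        finally have small: "stp r * norm (frc r ?m) \<le> 1 / 2 * ?D" .
        have contra: False if "p \<le> 1 / 2 * (a - w)" "a \<le> w + p" "1 < a - w" for a w p :: real
          using that by argo
        show False by (rule contra[OF small step D])
      qed
      then have "norm (vel r n) \<le> U" if "-1 \<le> n" "n \<le> ?m" for n
        using IH[of n] that by (cases "n = ?m") auto
      then have "good (tr ?m)" using m by (intro good_tr) auto
      then show ?case using bound[of _ ?m] m by simp
    qed
    from this[of "nat (fin r + 1)"] have "norm (vel r n) \<le> U" if "-1 \<le> n" "n \<le> fin r" for n
      using that S by fastforce
    then have "good (tr (fin r))" by (intro good_tr) auto
    moreover have "tr (fin r) = r" by (simp add: tr_def)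
    ultimately show ?thesis by simp
  qed
  with h0(1) show ?thesis by blast
qed

end

theorem theorem7p1:
  fixes B0 :: "real^3"
    and M :: "nat \<Rightarrow> real \<Rightarrow> real"
    and K :: "(real^3) set"
    and V c \<rho> :: real
  assumes "norm B0 = 1"
    and "compact K"
    and "c > 0"
    and "\<rho> > 0"
  shows "\<exists>C h0. h0 > 0 \<and>
    (\<forall>(\<epsilon>::real) (h::real) (A1::real^3 \<Rightarrow> real^3) (B1::real^3 \<Rightarrow> real^3) (E::real^3 \<Rightarrow> real^3)
       (\<phi>::real^3 \<Rightarrow> real) (x_init::real^3) (xdot_init::real^3)
       (x::int \<Rightarrow> real^3) (v::int \<Rightarrow> real^3).
       0 < \<epsilon> \<and> \<epsilon> \<le> h\<^sup>2 \<and> 0 < h \<and> h \<le> h0 \<and>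
       smooth_field A1 \<and> derivs_bounded_by M A1 \<and>
       smooth_field B1 \<and> derivs_bounded_by M B1 \<and>
       smooth_field E \<and> derivs_bounded_by M E \<and>
       (\<forall>y. B1 y = curl A1 y) \<and>
       (\<forall>y. GDERIV \<phi> y :> - E y) \<and>
       norm x_init \<le> V \<and> norm xdot_init \<le> V \<and>
       (x 0 = x_init \<or> x 0 = x_init + \<epsilon> *\<^sub>R (xdot_init \<times> B0)) \<and>
       v 0 = modified_start_velocity \<epsilon> B0 B1 E (x 0) xdot_init \<and>
       numerical_solution \<rho> h (vector_potential \<epsilon> B0 A1) E (c / \<epsilon>) x v \<and>
       (\<forall>n\<ge>0. of_int n * h \<le> c / \<epsilon> \<longrightarrow> x n \<in> K)
       \<longrightarrow>
       (\<forall>n\<ge>0. of_int n * h \<le> c * min (1 / \<epsilon>) (1 / h ^ 6) \<longrightarrow>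
          \<bar>total_energy \<phi> (x n) (v n) - total_energy \<phi> (x 0) (v 0)\<bar> \<le> C * h\<^sup>2) \<and>
       (\<forall>n\<ge>0. of_int n * h \<le> c / \<epsilon> \<longrightarrow>
          \<bar>magnetic_moment \<epsilon> (magnetic_field \<epsilon> B0 B1) (x n) (v n)\<bar> \<le> C * \<epsilon>\<^sup>2))"
proof -
  obtain R0 where R0: "\<And>y. y \<in> K \<Longrightarrow> norm y \<le> R0" "0 \<le> R0"
    using compact_imp_bounded[OF assms(2)] unfolding bounded_pos by (meson less_imp_le)
  \<comment> \<open>Room for \<open>K\<close>, for the position beyond the last step
    (\<open>\<rho>\<close>) and for \<open>x (-1)\<close> (another 1).\<close>
  define R where "R = R0 + \<rho> + 1"
  define W where "W = \<bar>V\<bar>"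
  define m where "m = \<bar>M 0 R\<bar>"
  \<comment> \<open>\<open>V0\<close> bounds the starting velocity, \<open>F0\<close> the force and
    \<open>A0\<close> the acceleration there, and \<open>Vs\<close> the velocity of the step
    preceding it.\<close>
  define V0 where "V0 = W + (W * m + m)"
  define Lc where "Lc = (\<Sum>l\<le>4. \<bar>M l (3 * R)\<bar>)"
  define F0 where "F0 = (3 * Lc + chain_const 3 Lc 1) * V0 + Lc"
  define A0 where "A0 = (W * m + m) + F0"
  define Vs where "Vs = V0 + A0"
  define U where "U = Vs + 2 * R + 2 * (\<bar>M 0 R\<bar> + 1) + 2"
  have nn: "0 \<le> R" "0 \<le> W" "0 \<le> m" "0 \<le> V0" "0 \<le> Lc" "0 \<le> F0" "0 \<le> A0" "0 \<le> Vs" "1 \<le> U" "Vs \<le> U"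
  proof -
    show R: "0 \<le> R" and W: "0 \<le> W" and m: "0 \<le> m" using R0(2) assms(4) by (simp_all add: R_def W_def m_def)
    then show V0: "0 \<le> V0" by (simp add: V0_def)
    show Lc: "0 \<le> Lc" by (simp add: Lc_def sum_nonneg)
    show F0: "0 \<le> F0" using V0 Lc chain_const_nonneg[of Lc 1 3] by (simp add: F0_def)
    then show A0: "0 \<le> A0" using W m by (simp add: A0_def)
    then show Vs: "0 \<le> Vs" using V0 by (simp add: Vs_def)
    then show "1 \<le> U" "Vs \<le> U" using R by (simp_all add: U_def)
  qed
  interpret run_family B0 M c R U
    using assms(1) nn by unfold_locales auto
  obtain h1 where h1: "0 < h1" "\<And>r. started Vs r \<Longrightarrow> stp r \<le> h1 \<Longrightarrow> good r"
    using started_good[of Vs] by (auto simp: U_def)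
  obtain CE where CE: "0 \<le> CE" "\<And>r n. good r \<Longrightarrow> 0 \<le> n \<Longrightarrow> n \<le> fin r \<Longrightarrow>
     \<bar>energy r n - energy r 0\<bar> \<le> CE * ((stp r)\<^sup>2 + real_of_int n * stp r ^ 9)"
    using energy_drift by blast
  obtain CP where CP: "0 \<le> CP" "\<And>r n. win 0 0 r n \<Longrightarrow> norm (mvel r n \<times> B0) \<le> CP * eps r"
    using ubd_mvel_perp by (rule ubdE) blast
  define Q where "Q = CP + U * m"
  \<comment> \<open>The last two entries ensure \<open>2 * h * V0 \<le> 1\<close>, which keeps
    \<open>x (-1)\<close> within \<open>R\<close>, and \<open>2 * \<epsilon> * m \<le> 1\<close>,
    which makes the full field at least half as strong as its constant part.\<close>
  define h0 where "h0 = min (min 1 h1) (min (1 / (2 * V0 + 1)) (1 / (2 * m + 1)))"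
  \<comment> \<open>\<open>CE * (1 + c)\<close> serves the energy. For the moment, a product
    \<open>v \<times> B\<close> bounded by \<open>Q\<close> and a field of size at least
    \<open>1 / (2 * \<epsilon>)\<close> give
    \<open>Q\<^sup>2 * (2 * \<epsilon>) ^ 3 / (2 * \<epsilon>)\<close>, that is,
    \<open>4 * Q\<^sup>2 * \<epsilon>\<^sup>2\<close>.\<close>
  define C where "C = CE * (1 + c) + 4 * Q\<^sup>2"
  have h0: "0 < h0" "h0 \<le> 1" "h0 \<le> h1" "h0 * (2 * V0 + 1) \<le> 1" "h0 * (2 * m + 1) \<le> 1"
  proof -
    show "0 < h0" using h1(1) nn by (simp add: h0_def add_nonneg_pos)
    show "h0 \<le> 1" "h0 \<le> h1" by (simp_all add: h0_def)
    have "h0 \<le> 1 / (2 * V0 + 1)" "h0 \<le> 1 / (2 * m + 1)" by (simp_all add: h0_def)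
    then show "h0 * (2 * V0 + 1) \<le> 1" "h0 * (2 * m + 1) \<le> 1" using nn by (simp_all add: field_simps)
  qed
  show ?thesis
  proof (rule exI[of _ C], rule exI[of _ h0], intro conjI[OF h0(1)] allI impI, goal_cases)
    case hyps: (1 \<epsilon> h A1 B1 E \<phi> x_init xdot_init x v)
    have e: "0 < \<epsilon>" "\<epsilon> \<le> h\<^sup>2" and h: "0 < h" "h \<le> h0" and A1: "smooth_field A1" "derivs_bounded_by M A1"
      and B1: "derivs_bounded_by M B1" and E: "smooth_field E" "derivs_bounded_by M E"
      and \<phi>: "\<And>y. GDERIV \<phi> y :> - E y" and xd: "norm xdot_init \<le> V"
      and v0: "v 0 = modified_start_velocity \<epsilon> B0 B1 E (x 0) xdot_init"
      and num: "numerical_solution \<rho> h (vector_potential \<epsilon> B0 A1) E (c / \<epsilon>) x v"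
      and inK: "\<And>n. 0 \<le> n \<Longrightarrow> of_int n * h \<le> c / \<epsilon> \<Longrightarrow> x n \<in> K"
      using hyps by blast+
    have h1': "h \<le> 1" "h\<^sup>2 \<le> h" "\<epsilon> \<le> h" "\<epsilon> \<le> 1"
    proof -
      show "h \<le> 1" using h h0 by linarith
      then show "h\<^sup>2 \<le> h" using h by (simp add: power2_eq_square mult_left_le)
      then show "\<epsilon> \<le> h" "\<epsilon> \<le> 1" using e \<open>h \<le> 1\<close> by linarith+
    qed
    define N where "N = \<lfloor>c / (\<epsilon> * h)\<rfloor>"
    have N: "of_int n * h \<le> c / \<epsilon> \<longleftrightarrow> n \<le> N" for n
      using e h by (simp add: N_def le_floor_iff field_simps)
    have N0: "0 \<le> N" using N[of 0] assms(3) e by simp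
    have step: "variational_step h (vector_potential \<epsilon> B0 A1) E (x (n - 1)) (x n) (x (n + 1))"
      and vn: "v n = (1 / (2 * h)) *\<^sub>R (x (n + 1) - x (n - 1))" and near: "dist (x (n + 1)) (x n) \<le> \<rho>"
      if "0 \<le> n" "n \<le> N" for n
      using num that N unfolding numerical_solution_def by blast+
    have xR0: "norm (x n) \<le> R0" if "0 \<le> n" "n \<le> N" for n
      using R0(1)[OF inK] that N by blast
    have xR1: "norm (x (n + 1)) \<le> R0 + \<rho>" if "0 \<le> n" "n \<le> N" for n
      using xR0[OF that] near[OF that] norm_triangle_sub[of "x (n + 1)" "x n"] by (simp add: dist_norm)
    define r where "r = Run \<epsilon> h A1 E \<phi> x N"
    have sel: "eps r = \<epsilon>" "stp r = h" "pot r = A1" "ele r = E" "enp r = \<phi>" "pos r = x" "fin r = N"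
      by (simp_all add: r_def)
    have vm: "v n = mvel r n" if "0 \<le> n" "n \<le> N" for n
      using vn[OF that] pos_mvel[of r n] h by (simp add: sel)
    have x0R: "norm (x 0) \<le> R" using xR0[of 0] N0 assms(4) by (simp add: R_def)
    have v0b: "norm (v 0) \<le> V0" "norm (v 0 \<times> B0) \<le> \<epsilon> * (W * m + m)"
      unfolding v0 V0_def
      using xd derivs_bounded_by_norm[OF B1 x0R] derivs_bounded_by_norm[OF E(2) x0R]
      by (intro modified_start_velocity_bounds[OF assms(1) e(1) h1'(4)]; simp add: m_def W_def)+
    have xm1: "norm (x (-1)) \<le> R"
    proof -
      have "x (-1) = x 1 - (2 * h) *\<^sub>R v 0" using vn[of 0] N0 h by simp
      then have "norm (x (-1)) \<le> norm (x 1) + 2 * h * norm (v 0)"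
        using norm_triangle_ineq4[of "x 1" "(2 * h) *\<^sub>R v 0"] h by simp
      also have "2 * h * norm (v 0) \<le> 2 * h * V0" using v0b h by (intro mult_left_mono) auto
      also have "2 * h * V0 \<le> h0 * (2 * V0 + 1)" using h nn mult_right_mono[OF h(2), of V0] h0(1) by (simp add: algebra_simps)
      finally show ?thesis using xR1[of 0] N0 h0(4) by (simp add: R_def)
    qed
    have xR: "norm (x n) \<le> R" if "-1 \<le> n" "n \<le> N + 1" for n
    proof -
      note bounds = that
      consider "n = -1" | "n = 0" | "1 \<le> n" using bounds by linarith
      then show ?thesis
      proof cases
        case 3
        then show ?thesis using xR1[of "n - 1"] bounds by (simp add: R_def)
      qed (use xm1 x0R in simp_all)
    qed
    have vstep: "vel r n - vel r (n - 1) = (stp r / eps r) *\<^sub>R (mvel r n \<times> B0) + stp r *\<^sub>R frc r n"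
      if "0 \<le> n" "n \<le> N" for n
      using step[OF that] A1 h e by (intro variational_step_vel) (simp_all add: sel)
    have started: "started Vs r"
    proof -
      have F: "norm (frc r 0) \<le> F0"
      proof -
        have "norm (frc r 0) \<le> (3 * Lc + chain_const 3 Lc 1) * norm (mvel r 0) + Lc"
          unfolding Lc_def using A1 E h xR[of 0] xR[of 1] xR[of "-1"] N0
          by (intro norm_frc_le[where R = R])
             (auto simp: sel intro: field_bound_lower[OF field_bound_derivs[where m = 4]])
        also have "\<dots> \<le> F0"
          unfolding F0_def using v0b vm[of 0] N0 nn chain_const_nonneg[of Lc 1 3]
          by (intro add_right_mono mult_left_mono) auto
        finally show ?thesis .
      qed
      \<comment> \<open>The acceleration at the start. It is bounded because
        \<open>v 0 \<times> B0\<close> is \<open>O(\<epsilon>)\<close>; hence the velocity half a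
        step earlier is close to \<open>v 0\<close>.\<close>
      let ?a = "(1 / \<epsilon>) *\<^sub>R (v 0 \<times> B0) + frc r 0"
      have "norm ((1 / \<epsilon>) *\<^sub>R (v 0 \<times> B0)) \<le> W * m + m"
        using v0b(2) e by (simp add: field_simps)
      then have a: "norm ?a \<le> A0" unfolding A0_def using F by (intro norm_triangle_mono)
      have half: "q = w - (h / 2) *\<^sub>R a" if "p - q = h *\<^sub>R a" "w = (1 / 2) *\<^sub>R (p + q)" for p q w a :: "real^3"
      proof -
        have "p = q + h *\<^sub>R a" using that(1) by (simp add: algebra_simps)
        then show ?thesis using that(2) by (simp add: vec_eq_iff field_simps)
      qed
      have "vel r 0 - vel r (-1) = h *\<^sub>R ?a"
        using vstep[of 0] N0 vm[of 0] by (simp add: sel scaleR_right_distrib)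
      then have um: "vel r (-1) = v 0 - (h / 2) *\<^sub>R ?a"
        using vm[of 0] N0 by (intro half) (simp_all add: mvel_def)
      have ha: "norm ((h / 2) *\<^sub>R ?a) \<le> h * A0"
        using a h nn mult_mono[of "h / 2" h "norm ?a" A0] by simp
      have "h * A0 \<le> A0" using h1' h nn by (simp add: mult_left_le_one_le)
      then have 1: "norm (vel r (-1)) \<le> Vs"
        unfolding um Vs_def using norm_triangle_ineq4[of "v 0" "(h / 2) *\<^sub>R ?a"] ha v0b by linarith
      have "vel r (-1) \<times> B0 = v 0 \<times> B0 - ((h / 2) *\<^sub>R ?a) \<times> B0" by (simp add: um Cross3.left_diff_distrib)
      then have "norm (vel r (-1) \<times> B0) \<le> norm (v 0 \<times> B0) + norm ((h / 2) *\<^sub>R ?a)"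
        by (simp only:) (rule order_trans[OF norm_triangle_ineq4 add_left_mono[OF norm_cross_b_le]])
      also have "\<dots> \<le> h * V0 + h * A0"
      proof -
        have "\<epsilon> * (W * m + m) \<le> h * V0"
          unfolding V0_def using h1' e nn by (intro mult_mono) auto
        then show ?thesis using v0b(2) ha by linarith
      qed
      also have "\<dots> = Vs * h" by (simp add: Vs_def algebra_simps)
      also have "\<dots> \<le> U * h" using nn h by (intro mult_right_mono) auto
      finally have 2: "norm (vel r (-1) \<times> B0) \<le> U * h" .
      show ?thesis
        unfolding started_def
        using 1 2 e h h1' A1 E \<phi> xR vstep N0 N[of N] by (auto simp: sel)
    qed
    have good: "good r" using h1(2)[OF started] h h0 by (simp add: sel)
    show ?case
    proof (intro conjI allI impI)
      fix n assume n: "0 \<le> n" "of_int n * h \<le> c * min (1 / \<epsilon>) (1 / h ^ 6)"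
      have "c * min (1 / \<epsilon>) (1 / h ^ 6) \<le> c * (1 / \<epsilon>)" "c * min (1 / \<epsilon>) (1 / h ^ 6) \<le> c * (1 / h ^ 6)"
        using assms(3) by (intro mult_left_mono; simp)+
      then have "of_int n * h \<le> c / \<epsilon>" and n6: "of_int n * h \<le> c / h ^ 6" using n by simp_all
      then have nN: "n \<le> N" using N by simp
      have H: "total_energy \<phi> (x k) (v k) = energy r k" if "0 \<le> k" "k \<le> N" for k
        using vm[OF that] by (simp add: total_energy_def energy_def pen_def sel)
      have "of_int n * h ^ 9 = (of_int n * h) * h ^ 8" by (simp add: eval_nat_numeral)
      also have "\<dots> \<le> (c / h ^ 6) * h ^ 8" using n6 h by (intro mult_right_mono) auto
      also have "\<dots> = c * h\<^sup>2" using h by (simp add: field_simps eval_nat_numeral)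
      finally have drift: "of_int n * h ^ 9 \<le> c * h\<^sup>2" .
      have "\<bar>energy r n - energy r 0\<bar> \<le> CE * (h\<^sup>2 + of_int n * h ^ 9)"
        using CE(2)[OF good n(1)] nN by (simp add: sel)
      also have "\<dots> \<le> CE * (h\<^sup>2 + c * h\<^sup>2)" using drift CE(1) by (intro mult_left_mono) auto
      also have "\<dots> = CE * (1 + c) * h\<^sup>2" by (simp add: algebra_simps)
      also have "\<dots> \<le> C * h\<^sup>2" unfolding C_def by (intro mult_right_mono) auto
      finally show "\<bar>total_energy \<phi> (x n) (v n) - total_energy \<phi> (x 0) (v 0)\<bar> \<le> C * h\<^sup>2"
        using H[OF n(1) nN] H[of 0] N0 by simp
    next
      fix n assume n: "0 \<le> n" "of_int n * h \<le> c / \<epsilon>"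
      then have nN: "n \<le> N" using N by simp
      have "norm (mvel r n \<times> B0) \<le> CP * \<epsilon>"
        using CP(2)[of r n] good n nN by (simp add: win_def sel)
      then have vperp: "norm (v n \<times> B0) \<le> CP * \<epsilon>" using vm[OF n(1) nN] by simp
      have vU: "norm (v n) \<le> U" using norm_mvel_le[OF good n(1)] nN vm[OF n(1) nN] by (simp add: sel)
      have Bm: "norm (B1 (x n)) \<le> m"
        unfolding m_def using xR[of n] n nN by (intro derivs_bounded_by_norm[OF B1]) auto
      let ?B = "magnetic_field \<epsilon> B0 B1 (x n)"
      have "v n \<times> ?B = (1 / \<epsilon>) *\<^sub>R (v n \<times> B0) + v n \<times> B1 (x n)"
        by (simp add: magnetic_field_def cross_add_right cross_mult_right)
      moreover have "norm ((1 / \<epsilon>) *\<^sub>R (v n \<times> B0)) \<le> CP" using vperp e by (simp add: field_simps)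
      moreover have "norm (v n \<times> B1 (x n)) \<le> U * m"
        using vU Bm nn by (intro order_trans[OF norm_cross_le] mult_mono) auto
      ultimately have num: "norm (v n \<times> ?B) \<le> Q" unfolding Q_def by (simp add: norm_triangle_mono)
      have "\<epsilon> * (2 * m + 1) \<le> h0 * (2 * m + 1)" using h1' h nn by (intro mult_right_mono) auto
      then have "2 * \<epsilon> * m \<le> 1" using h0(5) e by (simp add: algebra_simps)
      then have "m \<le> 1 / (2 * \<epsilon>)" using e by (simp add: field_simps)
      moreover have "norm ((1 / \<epsilon>) *\<^sub>R B0) = 1 / \<epsilon>" using assms(1) e by simp
      moreover have "norm ((1 / \<epsilon>) *\<^sub>R B0) - norm (B1 (x n)) \<le> norm ?B"
        unfolding magnetic_field_def by (rule norm_diff_ineq)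
      moreover have "1 / \<epsilon> = 1 / (2 * \<epsilon>) + 1 / (2 * \<epsilon>)" by simp
      ultimately have den: "1 / (2 * \<epsilon>) \<le> norm ?B" using Bm by linarith
      have "(norm (v n \<times> ?B))\<^sup>2 / norm ?B ^ 3 \<le> Q\<^sup>2 / (1 / (2 * \<epsilon>)) ^ 3"
        using num den e by (intro frac_le power_mono) auto
      then have "magnetic_moment \<epsilon> (magnetic_field \<epsilon> B0 B1) (x n) (v n) \<le> (1 / (2 * \<epsilon>)) * (Q\<^sup>2 / (1 / (2 * \<epsilon>)) ^ 3)"
        unfolding magnetic_moment_def using e by (intro mult_left_mono) auto
      also have "\<dots> = 4 * Q\<^sup>2 * \<epsilon>\<^sup>2" using e by (simp add: field_simps eval_nat_numeral)
      also have "\<dots> \<le> C * \<epsilon>\<^sup>2" unfolding C_def using CE(1) assms(3) by (intro mult_right_mono) auto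
      finally have "magnetic_moment \<epsilon> (magnetic_field \<epsilon> B0 B1) (x n) (v n) \<le> C * \<epsilon>\<^sup>2" .
      moreover have "0 \<le> magnetic_moment \<epsilon> (magnetic_field \<epsilon> B0 B1) (x n) (v n)"
        unfolding magnetic_moment_def using e by simp
      ultimately show "\<bar>magnetic_moment \<epsilon> (magnetic_field \<epsilon> B0 B1) (x n) (v n)\<bar> \<le> C * \<epsilon>\<^sup>2" by simp
    qed
  qed
qed

end
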